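(* The $q$-monopole connection $\omega(t^n)=[n;q^2]e^0$, viewed as spin connection in the frame bundle of $\mathbb{C}_q[S^2]$, induces the covariant derivative $\nabla:\Omega^1(\mathbb{C}_q[S^2])\to\Omega^1(\mathbb{C}_q[S^2])\bar\otimes\Omega^1(\mathbb{C}_q[S^2])$ given by $$\nabla(\mathrm{d}b_\pm)=[2]_qb_\pm\,g,\qquad \nabla(\mathrm{d}b_0)=(1+[2]_qb_0)\,g,$$ where $g=q^2\,\mathrm{d}b_-\bar\otimes\mathrm{d}b_++\mathrm{d}b_+\bar\otimes\mathrm{d}b_--[2]_q\,\mathrm{d}b_0\bar\otimes\mathrm{d}b_0$. This $\nabla$ is torsion-free, i.e. $\wedge\circ\nabla-\mathrm{d}=0$ as a map $\Omega^1\to\Omega^2$, and skew-metric compatible in the sense of zero cotorsion, $$(\nabla\wedge\mathrm{id}-\mathrm{id}\wedge\nabla)g=0\in\Omega^2(\mathbb{C}_q[S^2])\bar\otimes\Omega^1(\mathbb{C}_q[S^2])$$ (a generalised Levi-Civita connection).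
   Context: $q\in\mathbb{C}$ is invertible, $[2]_q=q+q^{-1}$, $[n;q^2]=(1-q^{2n})/(1-q^2)$; $\bar\otimes$ is the tensor product over $\mathbb{C}_q[S^2]$. $\mathbb{C}_q[SL_2]$ is the Hopf algebra generated by $a,b,c,d$ with $ba=qab$, $ca=qac$, $db=qbd$, $dc=qcd$, $bc=cb$, $ad=1+q^{-1}bc$, $da=1+qbc$. It is $\mathbb{Z}$-graded by $\deg a=\deg c=1$, $\deg b=\deg d=-1$; $\mathbb{C}_q[SL_2]_n$ is the degree $n$ component. $\mathbb{C}_q[S^2]=\mathbb{C}_q[SL_2]_0$ is generated by $b_0=bc$, $b_+=cd$, $b_-=ab$. $\Omega^1(\mathbb{C}_q[SL_2])$ is the bimodule calculus that is free as a left module on $e^+,e^-,e^0$, with $e^\pm x=q^{\deg x}x\,e^\pm$ and $e^0x=q^{2\deg x}x\,e^0$ for homogeneous $x$, and $$\mathrm{d}a=ae^0+qbe^+,\quad \mathrm{d}b=ae^--q^{-2}be^0,\quad \mathrm{d}c=ce^0+qde^+,\quad \mathrm{d}d=ce^--q^{-2}de^0.$$ It extends to an exterior algebra with $(e^\pm)^2=(e^0)^2=0$, $q^2e^+\wedge e^-+e^-\wedge e^+=0$, $e^0\wedge e^\pm+q^{\pm4}e^\pm\wedge e^0=0$, $\mathrm{d}e^0=q^3e^+\wedge e^-$, $\mathrm{d}e^\pm=\mp q^{\pm2}(1+q^{-2})e^\pm\wedge e^0$. $\Omega(\mathbb{C}_q[S^2])$ is the differential subalgebra generated by $\mathbb{C}_q[S^2]$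 and $\mathrm{d}\mathbb{C}_q[S^2]$; $\Omega^1(\mathbb{C}_q[S^2])=\mathbb{C}_q[SL_2]_2e^-\oplus\mathbb{C}_q[SL_2]_{-2}e^+$. Induced covariant derivatives. Sections of the charge $-n$ monopole bundle ($n\in\mathbb{Z}$) are $\mathcal{E}_{-n}=\mathbb{C}_q[SL_2]_n$, with covariant derivative $D\sigma=\mathrm{d}\sigma-\sigma\,\omega(t^n)=\mathrm{d}\sigma-[n;q^2]\sigma e^0$. This lies in $\mathbb{C}_q[SL_2]e^+\oplus\mathbb{C}_q[SL_2]e^-$ and is regarded as an element of $\Omega^1(\mathbb{C}_q[S^2])\bar\otimes\mathcal{E}_{-n}$ via the (injective) multiplication map $\tau\bar\otimes\sigma\mapsto\tau\sigma\in\Omega^1(\mathbb{C}_q[SL_2])$. The framing identifies $\mathcal{E}_{-2}\oplus\mathcal{E}_2$ with $\Omega^1(\mathbb{C}_q[S^2])$ by $f\oplus h\mapsto fe^-+he^+$, and $\nabla$ is $D$ transported along this: if $Df=\sum\tau_i\bar\otimes\sigma_i$ then $\nabla(fe^\mp)=\sum\tau_i\bar\otimes\sigma_ie^\mp$ for $f\in\mathbb{C}_q[SL_2]_{\pm2}$. It satisfies $\nabla(m\tau)=\mathrm{d}m\bar\otimes\tau+m\nabla\tau$ for $m\in\mathbb{C}_q[S^2]$. In the cotorsion, $(\nabla\wedge\mathrm{id})(\tau\bar\otimes\eta)=(\wedge\nabla\tau)\bar\otimes\eta$ and $(\mathrm{id}\wedge\nabla)(\tau\bar\otimes\eta)=\tau\wedge\nabla\eta$,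 with $\tau$ wedged into the first tensor factor of $\nabla\eta$; each is applied to $g$ in the displayed form of $g$ as a sum of tensor products of exact differentials. *)

theory Defs
  imports Complex_Main "HOL-Algebra.Free_Abelian_Groups" "HOL-Algebra.QuotRing"
    "HOL-Algebra.Algebraic_Closure_Type"
begin

section \<open>Tensor products over a noncommutative ring\<close>

text \<open>
  All modules in play are additive subgroups of one ambient ring \<open>R\<close>, with module structure given by
  multiplication in \<open>R\<close>.  For a subring \<open>B\<close>, a right \<open>B\<close>-submodule \<open>M\<close> and a left \<open>B\<close>-submodule \<open>N\<close>,
  the tensor product of \<open>M\<close> and \<open>N\<close> over \<open>B\<close> is the free abelian group on \<open>M \<times> N\<close> modulo
  biadditivity and \<open>B\<close>-balancing.  As usual for \<^const>\<open>free_Abelian_group\<close>, the abelian group of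
  tensors is a multiplicatively written record: \<open>\<otimes>\<close> is addition of tensors, \<open>\<one>\<close> is the zero tensor.
\<close>

inductive_set tensor_relators ::
  "('r, 'm) ring_scheme \<Rightarrow> 'r set \<Rightarrow> 'r set \<Rightarrow> 'r set \<Rightarrow> ('r \<times> 'r \<Rightarrow>\<^sub>0 int) set"
  for R B M N where
  add_left: "\<lbrakk>x \<in> M; x' \<in> M; y \<in> N\<rbrakk> \<Longrightarrow>
    frag_of (x \<oplus>\<^bsub>R\<^esub> x', y) - frag_of (x, y) - frag_of (x', y) \<in> tensor_relators R B M N"
| add_right: "\<lbrakk>x \<in> M; y \<in> N; y' \<in> N\<rbrakk> \<Longrightarrow>
    frag_of (x, y \<oplus>\<^bsub>R\<^esub> y') - frag_of (x, y) - frag_of (x, y') \<in> tensor_relators R B M N"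
| balance: "\<lbrakk>x \<in> M; b \<in> B; y \<in> N\<rbrakk> \<Longrightarrow>
    frag_of (x \<otimes>\<^bsub>R\<^esub> b, y) - frag_of (x, b \<otimes>\<^bsub>R\<^esub> y) \<in> tensor_relators R B M N"

definition tensor_kernel where
  "tensor_kernel R B M N = generate (free_Abelian_group (M \<times> N)) (tensor_relators R B M N)"

definition tensor ::
  "('r, 'm) ring_scheme \<Rightarrow> 'r set \<Rightarrow> 'r set \<Rightarrow> 'r set \<Rightarrow> ('r \<times> 'r \<Rightarrow>\<^sub>0 int) set monoid" where
  "tensor R B M N = free_Abelian_group (M \<times> N) Mod tensor_kernel R B M N"

definition tensor_class where
  "tensor_class R B M N c = tensor_kernel R B M N #>\<^bsub>free_Abelian_group (M \<times> N)\<^esub> c"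

definition tens ::
  "('r, 'm) ring_scheme \<Rightarrow> 'r set \<Rightarrow> 'r set \<Rightarrow> 'r set \<Rightarrow> 'r \<Rightarrow> 'r \<Rightarrow> ('r \<times> 'r \<Rightarrow>\<^sub>0 int) set" where
  "tens R B M N x y = tensor_class R B M N (frag_of (x, y))"

definition free_lift :: "('g, 'm) monoid_scheme \<Rightarrow> ('a \<Rightarrow> 'g) \<Rightarrow> ('a \<Rightarrow>\<^sub>0 int) \<Rightarrow> 'g" where
  "free_lift G \<phi> c = finprod G (\<lambda>p. \<phi> p [^]\<^bsub>G\<^esub> Poly_Mapping.lookup c p) (Poly_Mapping.keys c)"

text \<open>The homomorphism on tensors induced by a balanced biadditive \<open>\<phi>\<close>: the common value of
  the extension of \<open>\<phi>\<close> on all formal sums representing the tensor.\<close>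

definition tensor_lift ::
  "('g, 'm) monoid_scheme \<Rightarrow> ('a \<Rightarrow> 'g) \<Rightarrow> ('a \<Rightarrow>\<^sub>0 int) set \<Rightarrow> 'g" where
  "tensor_lift G \<phi> t = the_elem (free_lift G \<phi> ` t)"

definition tensor_mult :: "('r, 'm) ring_scheme \<Rightarrow> ('r \<times> 'r \<Rightarrow>\<^sub>0 int) set \<Rightarrow> 'r" where
  "tensor_mult R = tensor_lift (add_monoid R) (\<lambda>(x, y). x \<otimes>\<^bsub>R\<^esub> y)"

section \<open>The exterior algebra of quantum SL(2)\<close>

datatype gen = GA | GB | GC | GD | EPlus | EMinus | EZero

instantiation list :: (type) monoid_add
begin
definition zero_list :: "'a list" where "zero_list = []"
definition plus_list :: "'a list \<Rightarrow> 'a list \<Rightarrow> 'a list" where "plus_list = (@)"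
instance by standard (simp_all add: zero_list_def plus_list_def)
end

text \<open>The monoid algebra of the free monoid, that is, the free complex algebra on \<^typ>\<open>gen\<close>.\<close>

type_synonym free_alg = "gen list \<Rightarrow>\<^sub>0 complex"

definition word :: "gen list \<Rightarrow> free_alg" where
  "word w = Poly_Mapping.single w 1"

definition scalar :: "complex \<Rightarrow> free_alg" where
  "scalar z = Poly_Mapping.single [] z"

fun gdeg :: "gen \<Rightarrow> int" where
  "gdeg GA = 1" | "gdeg GB = -1" | "gdeg GC = 1" | "gdeg GD = -1" | "gdeg _ = 0"

definition coord_gens :: "gen set" where
  "coord_gens = {GA, GB, GC, GD}"

definition form_degree :: "gen list \<Rightarrow> nat" where
  "form_degree w = length (filter (\<lambda>x. x \<notin> coord_gens) w)"

definition sl2_relations :: "complex \<Rightarrow> free_alg set" where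
  "sl2_relations q =
    {word [GB, GA] - scalar q * word [GA, GB],
     word [GC, GA] - scalar q * word [GA, GC],
     word [GD, GB] - scalar q * word [GB, GD],
     word [GD, GC] - scalar q * word [GC, GD],
     word [GB, GC] - word [GC, GB],
     word [GA, GD] - 1 - scalar (inverse q) * word [GB, GC],
     word [GD, GA] - 1 - scalar q * word [GB, GC]}"

definition bimodule_relations :: "complex \<Rightarrow> free_alg set" where
  "bimodule_relations q =
     (\<Union>x \<in> coord_gens.
       {word [EPlus, x] - scalar (q powi gdeg x) * word [x, EPlus],
        word [EMinus, x] - scalar (q powi gdeg x) * word [x, EMinus],
        word [EZero, x] - scalar (q powi (2 * gdeg x)) * word [x, EZero]})"

definition wedge_relations :: "complex \<Rightarrow> free_alg set" where
  "wedge_relations q =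
    {word [EPlus, EPlus], word [EMinus, EMinus], word [EZero, EZero],
     scalar (q^2) * word [EPlus, EMinus] + word [EMinus, EPlus],
     word [EZero, EPlus] + scalar (q powi 4) * word [EPlus, EZero],
     word [EZero, EMinus] + scalar (q powi (-4)) * word [EMinus, EZero]}"

definition free_ring :: "free_alg ring" where
  "free_ring = ring_of_type_algebra"

definition relation_ideal :: "complex \<Rightarrow> free_alg set" where
  "relation_ideal q =
     Idl\<^bsub>free_ring\<^esub> (sl2_relations q \<union> bimodule_relations q \<union> wedge_relations q)"

text \<open>The total algebra of forms; its product is the wedge product.  The relations move every
  one-form generator to the right and are homogeneous in each of these generators, so that
  the algebra is the free left module over its degree zero part on the eight ordered wedge monomials.\<close>

definition Forms :: "complex \<Rightarrow> free_alg set ring" where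
  "Forms q = free_ring Quot relation_ideal q"

definition cls :: "complex \<Rightarrow> free_alg \<Rightarrow> free_alg set" where
  "cls q x = relation_ideal q +>\<^bsub>free_ring\<^esub> x"

definition forms :: "complex \<Rightarrow> nat \<Rightarrow> free_alg set set" where
  "forms q k = cls q ` {x. \<forall>w \<in> Poly_Mapping.keys x. form_degree w = k}"

definition coord :: "complex \<Rightarrow> int \<Rightarrow> free_alg set set" where
  "coord q n = cls q ` {x. \<forall>w \<in> Poly_Mapping.keys x.
     set w \<subseteq> coord_gens \<and> sum_list (map gdeg w) = n}"

abbreviation e_plus where "e_plus q \<equiv> cls q (word [EPlus])"
abbreviation e_minus where "e_minus q \<equiv> cls q (word [EMinus])"
abbreviation e_zero where "e_zero q \<equiv> cls q (word [EZero])"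

fun d_gen :: "complex \<Rightarrow> gen \<Rightarrow> free_alg" where
  "d_gen q GA = word [GA, EZero] + scalar q * word [GB, EPlus]"
| "d_gen q GB = word [GA, EMinus] - scalar (q powi (-2)) * word [GB, EZero]"
| "d_gen q GC = word [GC, EZero] + scalar q * word [GD, EPlus]"
| "d_gen q GD = word [GC, EMinus] - scalar (q powi (-2)) * word [GD, EZero]"
| "d_gen q EZero = scalar (q^3) * word [EPlus, EMinus]"
| "d_gen q EPlus = - (scalar (q^2 * (1 + q powi (-2))) * word [EPlus, EZero])"
| "d_gen q EMinus = scalar (q powi (-2) * (1 + q powi (-2))) * word [EMinus, EZero]"

fun d_word :: "complex \<Rightarrow> gen list \<Rightarrow> free_alg" where
  "d_word q [] = 0"
| "d_word q (x # w) =
     d_gen q x * word w + (-1) ^ form_degree [x] * word [x] * d_word q w"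

definition d_free :: "complex \<Rightarrow> free_alg \<Rightarrow> free_alg" where
  "d_free q x = (\<Sum>w \<in> Poly_Mapping.keys x. scalar (Poly_Mapping.lookup x w) * d_word q w)"

text \<open>The exterior derivative: the graded derivation \<^const>\<open>d_free\<close> maps the relation ideal into
  itself and hence acts on cosets.\<close>

definition dif :: "complex \<Rightarrow> free_alg set \<Rightarrow> free_alg set" where
  "dif q \<xi> = the_elem ((\<lambda>x. cls q (d_free q x)) ` \<xi>)"

section \<open>The quantum sphere\<close>

abbreviation sphere :: "complex \<Rightarrow> free_alg set set" where
  "sphere q \<equiv> coord q 0"

definition b_zero where "b_zero q = cls q (word [GB, GC])"
definition b_plus where "b_plus q = cls q (word [GC, GD])"
definition b_minus where "b_minus q = cls q (word [GA, GB])"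

text \<open>No closure under negation or scalars is needed, as the scalars lie in \<^term>\<open>sphere q\<close>.\<close>

inductive_set sphere_exterior :: "complex \<Rightarrow> free_alg set set" for q where
  base: "x \<in> sphere q \<Longrightarrow> x \<in> sphere_exterior q"
| dif: "x \<in> sphere_exterior q \<Longrightarrow> dif q x \<in> sphere_exterior q"
| add: "\<lbrakk>x \<in> sphere_exterior q; y \<in> sphere_exterior q\<rbrakk> \<Longrightarrow> x \<oplus>\<^bsub>Forms q\<^esub> y \<in> sphere_exterior q"
| mult: "\<lbrakk>x \<in> sphere_exterior q; y \<in> sphere_exterior q\<rbrakk> \<Longrightarrow> x \<otimes>\<^bsub>Forms q\<^esub> y \<in> sphere_exterior q"

definition sphere_forms :: "complex \<Rightarrow> nat \<Rightarrow> free_alg set set" where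
  "sphere_forms q k = sphere_exterior q \<inter> forms q k"

abbreviation stensor where
  "stensor q M N \<equiv> tensor (Forms q) (sphere q) M N"

abbreviation stens where
  "stens q M N x y \<equiv> tens (Forms q) (sphere q) M N x y"

abbreviation T11 where "T11 q \<equiv> stensor q (sphere_forms q 1) (sphere_forms q 1)"
abbreviation T21 where "T21 q \<equiv> stensor q (sphere_forms q 2) (sphere_forms q 1)"
abbreviation tens11 where "tens11 q \<equiv> stens q (sphere_forms q 1) (sphere_forms q 1)"
abbreviation tens21 where "tens21 q \<equiv> stens q (sphere_forms q 2) (sphere_forms q 1)"

definition lact :: "complex \<Rightarrow> free_alg set \<Rightarrow>
    (free_alg set \<times> free_alg set \<Rightarrow>\<^sub>0 int) set \<Rightarrow> (free_alg set \<times> free_alg set \<Rightarrow>\<^sub>0 int) set" where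
  "lact q m = tensor_lift (T11 q) (\<lambda>(x, y). tens11 q (m \<otimes>\<^bsub>Forms q\<^esub> x) y)"

section \<open>The covariant derivative induced by the monopole connection\<close>

definition q_two :: "complex \<Rightarrow> complex" where
  "q_two q = q + inverse q"

text \<open>The bracket \<open>[n; q\<^sup>2]\<close>; at \<open>q\<^sup>2 = 1\<close> the quotient is read as its limit.\<close>

definition q_bracket :: "complex \<Rightarrow> int \<Rightarrow> complex" where
  "q_bracket q n = (if q^2 = 1 then of_int n else (1 - q powi (2 * n)) / (1 - q^2))"

definition monopole_form :: "complex \<Rightarrow> int \<Rightarrow> free_alg set" where
  "monopole_form q n = cls q (scalar (q_bracket q n) * word [EZero])"

text \<open>The sections of charge \<open>-n\<close> are \<^term>\<open>coord q n\<close>.\<close>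

definition monopole_D :: "complex \<Rightarrow> int \<Rightarrow> free_alg set \<Rightarrow> free_alg set" where
  "monopole_D q n \<sigma> = dif q \<sigma> \<ominus>\<^bsub>Forms q\<^esub> \<sigma> \<otimes>\<^bsub>Forms q\<^esub> monopole_form q n"

definition monopole_D_tensor ::
  "complex \<Rightarrow> int \<Rightarrow> free_alg set \<Rightarrow> (free_alg set \<times> free_alg set \<Rightarrow>\<^sub>0 int) set" where
  "monopole_D_tensor q n \<sigma> =
     (THE t. t \<in> carrier (stensor q (sphere_forms q 1) (coord q n)) \<and>
             tensor_mult (Forms q) t = monopole_D q n \<sigma>)"

definition frame_right :: "complex \<Rightarrow> free_alg set \<Rightarrow>
    (free_alg set \<times> free_alg set \<Rightarrow>\<^sub>0 int) set \<Rightarrow> (free_alg set \<times> free_alg set \<Rightarrow>\<^sub>0 int) set" where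
  "frame_right q e = tensor_lift (T11 q) (\<lambda>(\<tau>, \<sigma>). tens11 q \<tau> (\<sigma> \<otimes>\<^bsub>Forms q\<^esub> e))"

definition nabla ::
  "complex \<Rightarrow> free_alg set \<Rightarrow> (free_alg set \<times> free_alg set \<Rightarrow>\<^sub>0 int) set" where
  "nabla q \<tau> = (THE t. \<exists>f \<in> coord q 2. \<exists>h \<in> coord q (-2).
     \<tau> = f \<otimes>\<^bsub>Forms q\<^esub> e_minus q \<oplus>\<^bsub>Forms q\<^esub> h \<otimes>\<^bsub>Forms q\<^esub> e_plus q \<and>
     t = frame_right q (e_minus q) (monopole_D_tensor q 2 f)
         \<otimes>\<^bsub>T11 q\<^esub> frame_right q (e_plus q) (monopole_D_tensor q (-2) h))"

definition covariant_derivative ::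
  "complex \<Rightarrow> (free_alg set \<Rightarrow> (free_alg set \<times> free_alg set \<Rightarrow>\<^sub>0 int) set) \<Rightarrow> bool" where
  "covariant_derivative q N \<longleftrightarrow>
     N \<in> sphere_forms q 1 \<rightarrow> carrier (T11 q) \<and>
     (\<forall>\<tau> \<in> sphere_forms q 1. \<forall>\<eta> \<in> sphere_forms q 1.
        N (\<tau> \<oplus>\<^bsub>Forms q\<^esub> \<eta>) = N \<tau> \<otimes>\<^bsub>T11 q\<^esub> N \<eta>) \<and>
     (\<forall>m \<in> sphere q. \<forall>\<tau> \<in> sphere_forms q 1.
        N (m \<otimes>\<^bsub>Forms q\<^esub> \<tau>) = tens11 q (dif q m) \<tau> \<otimes>\<^bsub>T11 q\<^esub> lact q m (N \<tau>))"

text \<open>The displayed form of the metric as a formal sum of pairs; the two maps entering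
  the cotorsion are applied to this representative, since neither is well defined
  on tensors by itself.\<close>

definition metric_sum :: "complex \<Rightarrow> (free_alg set \<times> free_alg set \<Rightarrow>\<^sub>0 int)" where
  "metric_sum q =
     frag_of (cls q (scalar (q^2)) \<otimes>\<^bsub>Forms q\<^esub> dif q (b_minus q), dif q (b_plus q))
   + frag_of (dif q (b_plus q), dif q (b_minus q))
   + frag_of (cls q (scalar (- q_two q)) \<otimes>\<^bsub>Forms q\<^esub> dif q (b_zero q), dif q (b_zero q))"

definition metric :: "complex \<Rightarrow> (free_alg set \<times> free_alg set \<Rightarrow>\<^sub>0 int) set" where
  "metric q =
     tensor_class (Forms q) (sphere q) (sphere_forms q 1) (sphere_forms q 1) (metric_sum q)"

definition wedge_left :: "complex \<Rightarrow> free_alg set \<Rightarrow>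
    (free_alg set \<times> free_alg set \<Rightarrow>\<^sub>0 int) set \<Rightarrow> (free_alg set \<times> free_alg set \<Rightarrow>\<^sub>0 int) set" where
  "wedge_left q \<tau> = tensor_lift (T21 q) (\<lambda>(x, y). tens21 q (\<tau> \<otimes>\<^bsub>Forms q\<^esub> x) y)"

definition nabla_wedge_id where
  "nabla_wedge_id q =
     free_lift (T21 q) (\<lambda>(\<tau>, \<eta>). tens21 q (tensor_mult (Forms q) (nabla q \<tau>)) \<eta>)"

definition id_wedge_nabla where
  "id_wedge_nabla q = free_lift (T21 q) (\<lambda>(\<tau>, \<eta>). wedge_left q \<tau> (nabla q \<eta>))"

end

theory Submission
  imports Defs
begin

text \<open>
  Write \<open>A\<^sub>n\<close> for the component of degree \<open>n\<close> and \<open>db\<^sub>i = u\<^sub>i e\<^sup>- + v\<^sub>i e\<^sup>+\<close> for the differentials of the three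
  generators of the sphere.  Pairing the coefficients \<open>u\<close>, \<open>v\<close> with each other by the metric gives the
  constants \<open>0\<close>, \<open>q\<^sup>2\<close>, \<open>1\<close>, \<open>0\<close>.  These four identities show that \<open>1\<close> lies in \<open>A\<^sub>2 A\<^bsub>-2\<^esub>\<close> and in \<open>A\<^bsub>-2\<^esub> A\<^sub>2\<close>,
  that the one-forms of the sphere are \<open>A\<^sub>2 e\<^sup>- \<oplus> A\<^bsub>-2\<^esub> e\<^sup>+\<close>, and that the metric is \<open>q\<^sup>2 e\<^sup>- \<otimes> e\<^sup>+ + e\<^sup>+ \<otimes> e\<^sup>-\<close> in
  terms of the basis forms.  By the first of these, a tensor \<open>f e\<^sup>\<plusminus> \<otimes> \<sigma>\<close> only depends on the product \<open>f \<sigma>\<close>,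
  so that multiplication is injective on tensors of one-forms with sections and every tensor of two one-forms is
  given by four coefficients; the claims about \<open>\<nabla>\<close> become identities between these.  The second term of the
  cotorsion is \<open>\<theta> \<and> g\<close> with \<open>\<theta> = [2] (q\<^sup>2 db\<^sub>- b\<^sub>+ + db\<^sub>+ b\<^sub>- - [2] db\<^sub>0 b\<^sub>0 - db\<^sub>0) = 0\<close>, while the first one vanishes
  as \<open>\<nabla>\<close> is torsion-free.  That a form determines its coefficients follows from twisted derivations of the
  free algebra which preserve the ideal of relations.
\<close>

section \<open>Tensor products of bimodules in an ambient ring\<close>

text \<open>\<open>monopole_D_tensor\<close> and \<open>nabla\<close> are definite descriptions, so
  nothing can be computed before existence and uniqueness of the described tensor are settled;
  injectivity of multiplication therefore precedes the connection. The obstacle is that a quotient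
  of a free algebra supplies equations but no inequations. The one piece of linear independence in
  use is that of e^- and e^+ over the coordinates, and it is read off from maps defined on words.
  The constants q^2 and 1 are units for every q \<noteq> 0, so the argument also covers roots of
  unity, where [2] can vanish. The formulas for \<nabla> have a common source. Write c_i for the
  factor in front of g. The differential of u_i has no e^- part and that of v_i no e^+ part; the
  remaining parts are q^2 c_i e^+ and c_i e^-, next to multiples of e^0 which the monopole form
  removes. Moving the frame past sections of degree 2 and -2 turns q^2 and 1 into 1 and q^2, the
  coefficients of e^+ \<otimes> e^- and e^- \<otimes> e^+ in g.\<close>

lemma (in comm_group) free_lift_superset:
  assumes "\<phi> \<in> S \<rightarrow> carrier G" "finite A" "A \<subseteq> S" "Poly_Mapping.keys c \<subseteq> A"
  shows "free_lift G \<phi> c = finprod G (\<lambda>p. \<phi> p [^] Poly_Mapping.lookup c p) A"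
  unfolding free_lift_def
  by (rule finprod_mono_neutral_cong_left)
    (use assms in \<open>auto simp: in_keys_iff\<close>)

lemma (in comm_group) free_lift_hom:
  assumes "\<phi> \<in> S \<rightarrow> carrier G"
  shows "free_lift G \<phi> \<in> hom (free_Abelian_group S) G"
proof (rule homI)
  fix c assume "c \<in> carrier (free_Abelian_group S)"
  then show "free_lift G \<phi> c \<in> carrier G"
    using assms by (auto simp: free_lift_def intro!: finprod_closed)
next
  fix c c' assume "c \<in> carrier (free_Abelian_group S)" "c' \<in> carrier (free_Abelian_group S)"
  then have keys: "Poly_Mapping.keys c \<subseteq> S" "Poly_Mapping.keys c' \<subseteq> S"
    by auto
  let ?A = "Poly_Mapping.keys c \<union> Poly_Mapping.keys c'"
  have "free_lift G \<phi> (c + c') = finprod G (\<lambda>p. \<phi> p [^] Poly_Mapping.lookup (c + c') p) ?A"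
    by (rule free_lift_superset[OF assms]) (use keys Poly_Mapping.keys_add[of c c'] in auto)
  also have "\<dots> = finprod G (\<lambda>p. \<phi> p [^] Poly_Mapping.lookup c p \<otimes> \<phi> p [^] Poly_Mapping.lookup c' p) ?A"
    by (rule finprod_cong) (use assms keys in \<open>auto simp: lookup_add int_pow_mult simp_implies_def
          intro!: int_pow_mult\<close>)
  also have "\<dots> = finprod G (\<lambda>p. \<phi> p [^] Poly_Mapping.lookup c p) ?A \<otimes>
                  finprod G (\<lambda>p. \<phi> p [^] Poly_Mapping.lookup c' p) ?A"
    by (rule finprod_multf) (use assms keys in auto)
  also have "\<dots> = free_lift G \<phi> c \<otimes> free_lift G \<phi> c'"
    using free_lift_superset[OF assms, of ?A c] free_lift_superset[OF assms, of ?A c'] keys by simp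
  finally show "free_lift G \<phi> (c \<otimes>\<^bsub>free_Abelian_group S\<^esub> c') = free_lift G \<phi> c \<otimes> free_lift G \<phi> c'"
    by simp
qed

lemma (in comm_group) free_lift_frag_of:
  "\<phi> p \<in> carrier G \<Longrightarrow> free_lift G \<phi> (frag_of p) = \<phi> p"
  by (simp add: free_lift_def keys_frag_of)

text \<open>One clause for each kind of \<open>tensor_relators\<close>: these are the maps whose
  extension to formal sums vanishes on \<open>tensor_kernel\<close>.\<close>

definition balanced ::
  "('r, 'm) ring_scheme \<Rightarrow> 'r set \<Rightarrow> 'r set \<Rightarrow> 'r set \<Rightarrow> ('g, 'n) monoid_scheme \<Rightarrow> ('r \<times> 'r \<Rightarrow> 'g) \<Rightarrow> bool"
  where "balanced R B M N G \<phi> \<longleftrightarrow>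
    \<phi> \<in> M \<times> N \<rightarrow> carrier G \<and>
    (\<forall>x\<in>M. \<forall>x'\<in>M. \<forall>y\<in>N. \<phi> (x \<oplus>\<^bsub>R\<^esub> x', y) = \<phi> (x, y) \<otimes>\<^bsub>G\<^esub> \<phi> (x', y)) \<and>
    (\<forall>x\<in>M. \<forall>y\<in>N. \<forall>y'\<in>N. \<phi> (x, y \<oplus>\<^bsub>R\<^esub> y') = \<phi> (x, y) \<otimes>\<^bsub>G\<^esub> \<phi> (x, y')) \<and>
    (\<forall>x\<in>M. \<forall>b\<in>B. \<forall>y\<in>N. \<phi> (x \<otimes>\<^bsub>R\<^esub> b, y) = \<phi> (x, b \<otimes>\<^bsub>R\<^esub> y))"

locale tensor_product = ring R for R :: "('r, 'm) ring_scheme" (structure) +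
  fixes B M N :: "'r set"
  assumes subgroup_M: "subgroup M (add_monoid R)"
    and subgroup_N: "subgroup N (add_monoid R)"
    and B_carrier: "B \<subseteq> carrier R"
    and right_action: "\<lbrakk>x \<in> M; b \<in> B\<rbrakk> \<Longrightarrow> x \<otimes> b \<in> M"
    and left_action: "\<lbrakk>b \<in> B; y \<in> N\<rbrakk> \<Longrightarrow> b \<otimes> y \<in> N"
begin

abbreviation "F \<equiv> free_Abelian_group (M \<times> N)"
abbreviation "K \<equiv> tensor_kernel R B M N"
abbreviation "T \<equiv> tensor R B M N"

lemma M_closed [intro]: "x \<in> M \<Longrightarrow> x \<in> carrier R" "\<zero> \<in> M"
    "\<lbrakk>x \<in> M; x' \<in> M\<rbrakk> \<Longrightarrow> x \<oplus> x' \<in> M" "x \<in> M \<Longrightarrow> \<ominus> x \<in> M"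
  using subgroup.subset[OF subgroup_M] subgroup.one_closed[OF subgroup_M]
    subgroup.m_closed[OF subgroup_M] subgroup.m_inv_closed[OF subgroup_M]
  by (auto simp: a_inv_def)

lemma N_closed [intro]: "x \<in> N \<Longrightarrow> x \<in> carrier R" "\<zero> \<in> N"
    "\<lbrakk>x \<in> N; x' \<in> N\<rbrakk> \<Longrightarrow> x \<oplus> x' \<in> N" "x \<in> N \<Longrightarrow> \<ominus> x \<in> N"
  using subgroup.subset[OF subgroup_N] subgroup.one_closed[OF subgroup_N]
    subgroup.m_closed[OF subgroup_N] subgroup.m_inv_closed[OF subgroup_N]
  by (auto simp: a_inv_def)

lemma comm_group_F: "comm_group F"
  by (rule abelian_free_Abelian_group)

lemma keys_combination:
  "\<lbrakk>p \<in> S; p' \<in> S; p'' \<in> S\<rbrakk> \<Longrightarrow> Poly_Mapping.keys (frag_of p - frag_of p' - frag_of p'') \<subseteq> S"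
  "\<lbrakk>p \<in> S; p' \<in> S\<rbrakk> \<Longrightarrow> Poly_Mapping.keys (frag_of p - frag_of p') \<subseteq> S"
  using keys_diff[of "frag_of p - frag_of p'" "frag_of p''"] keys_diff[of "frag_of p" "frag_of p'"]
  by (auto simp: keys_frag_of)

lemma relators_closed: "tensor_relators R B M N \<subseteq> carrier F"
proof
  fix c assume "c \<in> tensor_relators R B M N"
  then have "Poly_Mapping.keys c \<subseteq> M \<times> N"
    by cases (simp_all add: right_action left_action M_closed N_closed keys_combination)
  then show "c \<in> carrier F"
    by simp
qed

lemma kernel_subgroup: "subgroup K F"
  unfolding tensor_kernel_def
  by (rule group.generate_is_subgroup[OF group_free_Abelian_group relators_closed])

lemma kernel_normal: "K \<lhd> F"
  using comm_group.normal_iff_subgroup[OF comm_group_F] kernel_subgroup by blast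

lemma comm_group_tensor: "comm_group T"
  unfolding tensor_def by (rule comm_group.abelian_FactGroup[OF comm_group_F kernel_subgroup])

sublocale tensors: comm_group T
  by (rule comm_group_tensor)

lemma tensor_class_hom: "tensor_class R B M N \<in> hom F T"
proof -
  have "tensor_class R B M N = (\<lambda>c. K #>\<^bsub>F\<^esub> c)"
    by (simp add: tensor_class_def fun_eq_iff)
  then show ?thesis
    using normal.r_coset_hom_Mod[OF kernel_normal] by (simp add: tensor_def)
qed

lemma tensor_class_add:
  "\<lbrakk>Poly_Mapping.keys c \<subseteq> M \<times> N; Poly_Mapping.keys c' \<subseteq> M \<times> N\<rbrakk> \<Longrightarrow>
    tensor_class R B M N (c + c') = tensor_class R B M N c \<otimes>\<^bsub>T\<^esub> tensor_class R B M N c'"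
  using hom_mult[OF tensor_class_hom, of c c'] by simp

lemma tensor_class_closed:
  "Poly_Mapping.keys c \<subseteq> M \<times> N \<Longrightarrow> tensor_class R B M N c \<in> carrier T"
  using hom_in_carrier[OF tensor_class_hom, of c] by simp

lemma tensor_class_zero: "tensor_class R B M N 0 = \<one>\<^bsub>T\<^esub>"
  using hom_one[OF tensor_class_hom] by (simp add: tensors.is_group)

lemma tens_closed [intro, simp]: "\<lbrakk>x \<in> M; y \<in> N\<rbrakk> \<Longrightarrow> tens R B M N x y \<in> carrier T"
  unfolding tens_def by (rule tensor_class_closed) (simp add: keys_frag_of)

lemma tensor_class_kernel:
  assumes "c \<in> K"
  shows "tensor_class R B M N c = \<one>\<^bsub>T\<^esub>"
  unfolding tensor_class_def tensor_def one_FactGroup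
  using group.coset_join2[OF group_free_Abelian_group _ kernel_subgroup assms]
    subgroup.mem_carrier[OF kernel_subgroup assms] by blast

lemma tensor_class_diff:
  assumes "Poly_Mapping.keys c \<subseteq> M \<times> N" "Poly_Mapping.keys c' \<subseteq> M \<times> N" "c - c' \<in> K"
  shows "tensor_class R B M N c = tensor_class R B M N c'"
proof -
  have "tensor_class R B M N ((c - c') + c') = tensor_class R B M N c'"
    using assms subgroup.mem_carrier[OF kernel_subgroup assms(3)]
    by (subst tensor_class_add) (simp_all add: tensor_class_kernel tensor_class_closed)
  then show ?thesis
    by simp
qed

lemma relator_in_kernel: "c \<in> tensor_relators R B M N \<Longrightarrow> c \<in> K"
  unfolding tensor_kernel_def by (rule generate.incl)

lemma keys_frag_sum: "\<lbrakk>p \<in> S; p' \<in> S\<rbrakk> \<Longrightarrow> Poly_Mapping.keys (frag_of p + frag_of p') \<subseteq> S"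
  using Poly_Mapping.keys_add[of "frag_of p" "frag_of p'"] by (auto simp: keys_frag_of)

lemma tens_add_left:
  assumes "x \<in> M" "x' \<in> M" "y \<in> N"
  shows "tens R B M N (x \<oplus> x') y = tens R B M N x y \<otimes>\<^bsub>T\<^esub> tens R B M N x' y"
proof -
  have "tensor_class R B M N (frag_of (x \<oplus> x', y))
      = tensor_class R B M N (frag_of (x, y) + frag_of (x', y))"
    using relator_in_kernel[OF tensor_relators.add_left[OF assms]] assms
    by (intro tensor_class_diff keys_frag_sum)
      (auto simp: keys_frag_of M_closed diff_diff_eq[symmetric])
  then show ?thesis
    using assms by (simp add: tens_def tensor_class_add keys_frag_of)
qed

lemma tens_add_right:
  assumes "x \<in> M" "y \<in> N" "y' \<in> N"
  shows "tens R B M N x (y \<oplus> y') = tens R B M N x y \<otimes>\<^bsub>T\<^esub> tens R B M N x y'"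
proof -
  have "tensor_class R B M N (frag_of (x, y \<oplus> y'))
      = tensor_class R B M N (frag_of (x, y) + frag_of (x, y'))"
    using relator_in_kernel[OF tensor_relators.add_right[OF assms]] assms
    by (intro tensor_class_diff keys_frag_sum)
      (auto simp: keys_frag_of N_closed diff_diff_eq[symmetric])
  then show ?thesis
    using assms by (simp add: tens_def tensor_class_add keys_frag_of)
qed

lemma tens_balance:
  assumes "x \<in> M" "b \<in> B" "y \<in> N"
  shows "tens R B M N (x \<otimes> b) y = tens R B M N x (b \<otimes> y)"
  unfolding tens_def
  using relator_in_kernel[OF tensor_relators.balance[OF assms]] assms right_action left_action
  by (intro tensor_class_diff) (auto simp: keys_frag_of)

lemma tens_zero_left: "y \<in> N \<Longrightarrow> tens R B M N \<zero> y = \<one>\<^bsub>T\<^esub>"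
  using tens_add_left[of \<zero> \<zero> y] by (metis M_closed(2) l_zero tens_closed tensors.l_cancel_one' zero_closed)

text \<open>There is no case for inverses, because -(x \<otimes> y) = (-x) \<otimes> y is again a
  pure tensor. Formal sums are generated under differences, so the induction treats a sum and its
  negative at once.\<close>

lemma tensor_induct [consumes 1, case_names zero tens add]:
  assumes "t \<in> carrier T"
    and zero: "P \<one>\<^bsub>T\<^esub>"
    and tens: "\<And>x y. \<lbrakk>x \<in> M; y \<in> N\<rbrakk> \<Longrightarrow> P (tens R B M N x y)"
    and add: "\<And>t t'. \<lbrakk>t \<in> carrier T; t' \<in> carrier T; P t; P t'\<rbrakk> \<Longrightarrow> P (t \<otimes>\<^bsub>T\<^esub> t')"
  shows "P t"
proof -
  obtain c where c: "t = tensor_class R B M N c" "Poly_Mapping.keys c \<subseteq> M \<times> N"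
    using assms(1) unfolding tensor_def tensor_class_def carrier_FactGroup by auto
  have "P (tensor_class R B M N c) \<and> P (tensor_class R B M N (- c))"
    using c(2)
  proof (rule free_Abelian_group_induct)
    show "P (tensor_class R B M N 0) \<and> P (tensor_class R B M N (- 0))" by (simp add: tensor_class_zero zero)
  next
    fix x y
    assume 2: "Poly_Mapping.keys x \<subseteq> M \<times> N" "Poly_Mapping.keys y \<subseteq> M \<times> N"
      "P (tensor_class R B M N x) \<and> P (tensor_class R B M N (- x))"
      "P (tensor_class R B M N y) \<and> P (tensor_class R B M N (- y))"
    have "tensor_class R B M N (x + - y) = tensor_class R B M N x \<otimes>\<^bsub>T\<^esub> tensor_class R B M N (- y)"
      "tensor_class R B M N (- x + y) = tensor_class R B M N (- x) \<otimes>\<^bsub>T\<^esub> tensor_class R B M N y"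
      by (rule tensor_class_add; simp add: 2)+
    then show "P (tensor_class R B M N (x - y)) \<and> P (tensor_class R B M N (- (x - y)))"
      using 2 by (auto intro!: add tensor_class_closed simp: add.commute[of "- x" y])
  next
    fix a assume 3: "a \<in> M \<times> N"
    obtain x y where a: "a = (x, y)" "x \<in> M" "y \<in> N"
      using 3 by auto
    have "tens R B M N (\<ominus> x) y \<otimes>\<^bsub>T\<^esub> tens R B M N x y = \<one>\<^bsub>T\<^esub>"
      using a tens_add_left[of "\<ominus> x" x y] tens_zero_left[of y] by (simp add: M_closed l_neg)
    moreover have "tensor_class R B M N (- frag_of a) \<otimes>\<^bsub>T\<^esub> tens R B M N x y = \<one>\<^bsub>T\<^esub>"
      using a tensor_class_add[of "- frag_of a" "frag_of a"]
      by (simp add: tens_def keys_frag_of tensor_class_zero)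
    ultimately have "tensor_class R B M N (- frag_of a) = tens R B M N (\<ominus> x) y"
      using a tensor_class_closed[of "- frag_of a"]
      by (metis M_closed(4) "3" keys_frag_of keys_minus empty_subsetI insert_subset tens_closed
          tensors.inv_equality)
    then show "P (tensor_class R B M N (frag_of a)) \<and> P (tensor_class R B M N (- frag_of a))"
      using a tens[of x y] tens[of "\<ominus> x" y] by (auto simp: M_closed tens_def)
  qed
  with c show ?thesis by simp
qed

section \<open>Homomorphisms out of a tensor product\<close>

context
  fixes G :: "('g, 'n) monoid_scheme" and \<phi>
  assumes G: "comm_group G" and bal: "balanced R B M N G \<phi>"
begin

interpretation G: comm_group G by (rule G)

lemma free_lift_kernel:
  assumes "c \<in> K"
  shows "free_lift G \<phi> c = \<one>\<^bsub>G\<^esub>"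
proof -
  have \<phi>: "\<phi> \<in> M \<times> N \<rightarrow> carrier G"
    using bal by (simp add: balanced_def)
  interpret h: group_hom F G "free_lift G \<phi>"
    using G.free_lift_hom[OF \<phi>]
    by (simp add: group_hom_def group_hom_axioms_def G.is_group)
  have lift: "free_lift G \<phi> (frag_of p) = \<phi> p" if "p \<in> M \<times> N" for p
    using that \<phi> by (intro G.free_lift_frag_of) auto
  have diff: "free_lift G \<phi> (c - c') = free_lift G \<phi> c \<otimes>\<^bsub>G\<^esub> inv\<^bsub>G\<^esub> free_lift G \<phi> c'"
    if "Poly_Mapping.keys c \<subseteq> M \<times> N" "Poly_Mapping.keys c' \<subseteq> M \<times> N" for c c'
    using that h.hom_mult[of c "- c'"] h.hom_inv[of c'] by simp
  have "tensor_relators R B M N \<subseteq> kernel F G (free_lift G \<phi>)"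
  proof
    fix c assume c: "c \<in> tensor_relators R B M N"
    then have "free_lift G \<phi> c = \<one>\<^bsub>G\<^esub>"
    proof cases
      case (add_left x x' y)
      then show ?thesis
        using bal \<phi> by (simp add: balanced_def diff lift M_closed keys_combination keys_frag_of Pi_iff
            G.m_assoc G.inv_mult G.m_comm[of "inv\<^bsub>G\<^esub> \<phi> (x, y)"])
          (simp add: G.m_assoc[symmetric] Pi_iff)
    next
      case (add_right x y y')
      then show ?thesis
        using bal \<phi> by (simp add: balanced_def diff lift N_closed keys_combination keys_frag_of Pi_iff
            G.m_assoc G.inv_mult G.m_comm[of "inv\<^bsub>G\<^esub> \<phi> (x, y)"])
          (simp add: G.m_assoc[symmetric] Pi_iff)
    next
      case (balance x b y)
      then show ?thesis
        using bal \<phi> left_action right_action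
        by (simp add: balanced_def diff lift keys_frag_of Pi_iff)
    qed
    then show "c \<in> kernel F G (free_lift G \<phi>)"
      using c relators_closed unfolding kernel_def by blast
  qed
  then have "K \<subseteq> kernel F G (free_lift G \<phi>)"
    unfolding tensor_kernel_def
    by (intro group.generate_subgroup_incl[OF group_free_Abelian_group _ h.subgroup_kernel])
  with assms show ?thesis
    by (auto simp: kernel_def)
qed

text \<open>\<open>tensor_lift\<close> applies \<open>the_elem\<close> to the values on all
  representatives of a coset. Two of these differ by an element of the kernel, on which the
  extension is trivial, so the set of values is a singleton.\<close>

lemma tensor_lift_class:
  assumes "Poly_Mapping.keys c \<subseteq> M \<times> N"
  shows "tensor_lift G \<phi> (tensor_class R B M N c) = free_lift G \<phi> c"
proof -
  have \<phi>: "\<phi> \<in> M \<times> N \<rightarrow> carrier G"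
    using bal by (simp add: balanced_def)
  note hom = G.free_lift_hom[OF \<phi>]
  have "free_lift G \<phi> c' = free_lift G \<phi> c" if c': "c' \<in> tensor_class R B M N c" for c'
  proof -
    obtain k where k: "k \<in> K" "c' = k + c"
      using c' unfolding tensor_class_def r_coset_def mult_free_Abelian_group by blast
    then show ?thesis
      using hom_mult[OF hom, of k c] hom_in_carrier[OF hom, of c] assms
        subgroup.mem_carrier[OF kernel_subgroup k(1)] free_lift_kernel[OF k(1)] by simp
  qed
  moreover have "c \<in> tensor_class R B M N c"
    unfolding tensor_class_def using assms
    by (intro group.rcos_self[OF group_free_Abelian_group _ kernel_subgroup]) simp
  ultimately show ?thesis
    unfolding tensor_lift_def by (intro the_elem_image_unique) blast+
qed

lemma tensor_lift_tens:
  "\<lbrakk>x \<in> M; y \<in> N\<rbrakk> \<Longrightarrow> tensor_lift G \<phi> (tens R B M N x y) = \<phi> (x, y)"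
  unfolding tens_def using bal
  by (subst tensor_lift_class) (auto simp: keys_frag_of balanced_def intro!: G.free_lift_frag_of)

lemma tensor_lift_hom: "tensor_lift G \<phi> \<in> hom T G"
proof (rule homI)
  have hom: "free_lift G \<phi> \<in> hom F G"
    using bal by (intro G.free_lift_hom) (simp add: balanced_def)
  have rep: "\<exists>c. t = tensor_class R B M N c \<and> Poly_Mapping.keys c \<subseteq> M \<times> N" if "t \<in> carrier T" for t
    using that unfolding tensor_def tensor_class_def carrier_FactGroup by auto
  show "tensor_lift G \<phi> t \<in> carrier G" if "t \<in> carrier T" for t
    using rep[OF that] hom_in_carrier[OF hom] by (auto simp: tensor_lift_class)
  show "tensor_lift G \<phi> (t \<otimes>\<^bsub>T\<^esub> t') = tensor_lift G \<phi> t \<otimes>\<^bsub>G\<^esub> tensor_lift G \<phi> t'"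
    if t: "t \<in> carrier T" "t' \<in> carrier T" for t t'
  proof -
    obtain c c' where c: "t = tensor_class R B M N c" "Poly_Mapping.keys c \<subseteq> M \<times> N"
        "t' = tensor_class R B M N c'" "Poly_Mapping.keys c' \<subseteq> M \<times> N"
      using rep t by meson
    then have "Poly_Mapping.keys (c + c') \<subseteq> M \<times> N"
      using Poly_Mapping.keys_add[of c c'] by blast
    then show ?thesis
      using c hom_mult[OF hom, of c c']
      by (simp add: tensor_lift_class flip: tensor_class_add)
  qed
qed

end

lemma tensor_mult_balanced: "balanced R B M N (add_monoid R) (\<lambda>(x, y). x \<otimes> y)"
  unfolding balanced_def
  by (auto simp: M_closed(1) N_closed(1) subsetD[OF B_carrier] l_distr r_distr m_assoc)

lemma tensor_mult_hom: "tensor_mult R \<in> hom T (add_monoid R)"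
  unfolding tensor_mult_def by (rule tensor_lift_hom[OF a_comm_group tensor_mult_balanced])

lemma tensor_mult_tens: "\<lbrakk>x \<in> M; y \<in> N\<rbrakk> \<Longrightarrow> tensor_mult R (tens R B M N x y) = x \<otimes> y"
  unfolding tensor_mult_def by (simp add: tensor_lift_tens[OF a_comm_group tensor_mult_balanced])

lemma tensor_mult_add:
  "\<lbrakk>t \<in> carrier T; t' \<in> carrier T\<rbrakk> \<Longrightarrow> tensor_mult R (t \<otimes>\<^bsub>T\<^esub> t') = tensor_mult R t \<oplus> tensor_mult R t'"
  using hom_mult[OF tensor_mult_hom] by simp

lemma tensor_mult_zero: "tensor_mult R \<one>\<^bsub>T\<^esub> = \<zero>"
  using hom_one[OF tensor_mult_hom tensors.is_group] a_comm_group by (simp add: comm_group_def)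

lemma tensor_mult_closed: "t \<in> carrier T \<Longrightarrow> tensor_mult R t \<in> carrier R"
  using hom_in_carrier[OF tensor_mult_hom] by simp

end

section \<open>Embedding a ring with carrier into a type of class ring\<close>

text \<open>
  Membership in the carrier obstructs the simplifier, in particular the cancellation procedures for
  abelian groups.  The following type is the product of all rings over a given type; a ring \<open>R\<close> sits
  in it as one of the factors, so that identities in \<open>R\<close> are identities in a type of class \<open>ring\<close>.
  The unit of \<open>R\<close> becomes an idempotent, which is why the type is not used as one of class \<open>ring_1\<close>.
\<close>

typedef 'r ring_family =
  "{f :: 'r ring \<Rightarrow> 'r. \<forall>R. (ring R \<longrightarrow> f R \<in> carrier R) \<and> (\<not> ring R \<longrightarrow> f R = undefined)}"
  by (rule exI[of _ "\<lambda>R. if ring R then \<zero>\<^bsub>R\<^esub> else undefined"])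
    (auto intro: ring.ring_simprules)

setup_lifting type_definition_ring_family

instantiation ring_family :: (type) Rings.ring
begin

lift_definition zero_ring_family :: "'a ring_family" is
  "\<lambda>R. if ring R then \<zero>\<^bsub>R\<^esub> else undefined"
  by (auto intro: ring.ring_simprules)

lift_definition plus_ring_family :: "'a ring_family \<Rightarrow> 'a ring_family \<Rightarrow> 'a ring_family" is
  "\<lambda>f g R. if ring R then f R \<oplus>\<^bsub>R\<^esub> g R else undefined"
  by (auto intro: ring.ring_simprules)

lift_definition uminus_ring_family :: "'a ring_family \<Rightarrow> 'a ring_family" is
  "\<lambda>f R. if ring R then \<ominus>\<^bsub>R\<^esub> f R else undefined"
  by (auto intro: ring.ring_simprules)

lift_definition minus_ring_family :: "'a ring_family \<Rightarrow> 'a ring_family \<Rightarrow> 'a ring_family" is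
  "\<lambda>f g R. if ring R then f R \<ominus>\<^bsub>R\<^esub> g R else undefined"
  by (auto intro: ring.ring_simprules)

lift_definition times_ring_family :: "'a ring_family \<Rightarrow> 'a ring_family \<Rightarrow> 'a ring_family" is
  "\<lambda>f g R. if ring R then f R \<otimes>\<^bsub>R\<^esub> g R else undefined"
  by (auto intro: ring.ring_simprules)

instance
proof
  fix f g h :: "'a ring_family"
  show "f + g + h = f + (g + h)"
    by transfer (auto simp: fun_eq_iff intro: ring.ring_simprules)
  show "f + g = g + f"
    by transfer (auto simp: fun_eq_iff intro: ring.ring_simprules)
  show "0 + f = f"
    by transfer (auto simp: fun_eq_iff ring.ring_simprules)
  show "- f + f = 0"
    by transfer (auto simp: fun_eq_iff intro: ring.ring_simprules)
  show "f - g = f + - g"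
    by transfer (auto simp: fun_eq_iff a_minus_def)
  show "f * g * h = f * (g * h)"
    by transfer (auto simp: fun_eq_iff intro: ring.ring_simprules)
  show "(f + g) * h = f * h + g * h"
    by transfer (auto simp: fun_eq_iff intro: ring.ring_simprules)
  show "f * (g + h) = f * g + f * h"
    by transfer (auto simp: fun_eq_iff intro: ring.ring_simprules)
qed

end

definition emb :: "'r ring \<Rightarrow> 'r \<Rightarrow> 'r ring_family" where
  "emb R x = Abs_ring_family (\<lambda>S. if S = R then x else if ring S then \<zero>\<^bsub>S\<^esub> else undefined)"

lemma Rep_emb:
  assumes "ring (R :: 'r ring)" "x \<in> carrier R"
  shows "Rep_ring_family (emb R x) = (\<lambda>S. if S = R then x else if ring S then \<zero>\<^bsub>S\<^esub> else undefined)"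
  unfolding emb_def
  by (rule Abs_ring_family_inverse) (use assms in \<open>auto intro: ring.ring_simprules\<close>)

lemma
  assumes R: "ring (R :: 'r ring)" and x: "x \<in> carrier R" and y: "y \<in> carrier R"
  shows emb_add: "emb R (x \<oplus>\<^bsub>R\<^esub> y) = emb R x + emb R y"
    and emb_mult: "emb R (x \<otimes>\<^bsub>R\<^esub> y) = emb R x * emb R y"
    and emb_eq_iff: "emb R x = emb R y \<longleftrightarrow> x = y"
proof -
  note [simp] = Rep_emb[OF R] ring.ring_simprules[OF R] x y R
  show "emb R (x \<oplus>\<^bsub>R\<^esub> y) = emb R x + emb R y"
    by (simp add: plus_ring_family.rep_eq fun_eq_iff ring.ring_simprules flip: Rep_ring_family_inject)
  show "emb R (x \<otimes>\<^bsub>R\<^esub> y) = emb R x * emb R y"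
    by (simp add: times_ring_family.rep_eq fun_eq_iff ring.ring_simprules flip: Rep_ring_family_inject)
  show "emb R x = emb R y \<longleftrightarrow> x = y"
  proof
    assume "emb R x = emb R y"
    from arg_cong[OF this, of "\<lambda>f. Rep_ring_family f R"] show "x = y"
      unfolding Rep_emb[OF R x] Rep_emb[OF R y] by simp
  qed simp
qed

section \<open>Linear maps, endomorphisms and derivations of the free algebra\<close>

lemma scalar_add: "scalar (x + y) = scalar x + scalar y"
  and scalar_mult: "scalar (x * y) = scalar x * scalar y"
  and scalar_uminus: "scalar (- x) = - scalar x"
  and scalar_0 [simp]: "scalar 0 = 0"
  and scalar_1 [simp]: "scalar 1 = 1"
  and word_Nil [simp]: "word [] = 1"
  and word_append: "word (u @ v) = word u * word v"
  and single_eq_scalar: "Poly_Mapping.single w z = scalar z * word w"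
  by (simp_all add: scalar_def word_def single_add mult_single single_uminus
      flip: zero_list_def plus_list_def)

lemma scalar_diff: "scalar (x - y) = scalar x - scalar y"
  using scalar_add[of x "- y"] by (simp add: scalar_uminus)

lemma word_Cons_Cons: "word (x # y # w) = word [x] * word (y # w)"
  using word_append[of "[x]" "y # w"] by simp

lemma word_Cons: "word (x # w) = word [x] * word w"
  using word_append[of "[x]" w] by simp

lemma free_alg_expansion:
  "(x :: free_alg) = (\<Sum>w\<in>Poly_Mapping.keys x. scalar (Poly_Mapping.lookup x w) * word w)"
  by (rule poly_mapping_eqI)
    (auto simp: lookup_sum lookup_single when_def in_keys_iff simp flip: single_eq_scalar)

lemma free_alg_induct [case_names monomial add]:
  assumes "\<And>w z. P (scalar z * word w)" "\<And>x y. P x \<Longrightarrow> P y \<Longrightarrow> P (x + y)"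
  shows "P (x :: free_alg)"
proof -
  have zero: "P 0" using assms(1)[of 0] by simp
  have "P (\<Sum>w\<in>A. scalar (Poly_Mapping.lookup x w) * word w)" if "finite A" for A
    using that by (induction rule: finite_induct) (simp_all add: assms zero)
  from this[of "Poly_Mapping.keys x"] show ?thesis
    by (simp flip: free_alg_expansion)
qed

lemma scalar_commute: "x * scalar z = scalar z * x"
  by (induction x rule: free_alg_induct)
    (simp_all add: algebra_simps scalar_def word_def mult_single mult.commute flip: zero_list_def)

lemma monomial_mult: "scalar z * x * (scalar z' * y) = scalar (z * z') * (x * y)"
proof -
  have "scalar z * x * (scalar z' * y) = scalar z * (x * scalar z') * y"
    by (simp only: mult.assoc)
  also have "\<dots> = scalar z * (scalar z' * x) * y"
    by (simp only: scalar_commute[of x z'])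
  finally show ?thesis
    by (simp only: scalar_mult mult.assoc)
qed

text \<open>The same summation as in \<open>d_free\<close>, which becomes an instance once
  \<open>d_word\<close> is recognised as a \<open>der_word\<close>.\<close>

definition linext :: "(gen list \<Rightarrow> free_alg) \<Rightarrow> free_alg \<Rightarrow> free_alg" where
  "linext f x = (\<Sum>w \<in> Poly_Mapping.keys x. scalar (Poly_Mapping.lookup x w) * f w)"

lemma linext_superset:
  assumes "finite A" "Poly_Mapping.keys x \<subseteq> A"
  shows "linext f x = (\<Sum>w \<in> A. scalar (Poly_Mapping.lookup x w) * f w)"
  unfolding linext_def by (rule sum.mono_neutral_left) (use assms in \<open>auto simp: in_keys_iff\<close>)

lemma linext_add: "linext f (x + y) = linext f x + linext f y"
proof -
  let ?A = "Poly_Mapping.keys x \<union> Poly_Mapping.keys y"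
  have "linext f z = (\<Sum>w \<in> ?A. scalar (Poly_Mapping.lookup z w) * f w)"
    if "Poly_Mapping.keys z \<subseteq> ?A" for z
    using that by (intro linext_superset) auto
  then show ?thesis
    using Poly_Mapping.keys_add[of x y]
    by (simp add: lookup_add scalar_add distrib_right sum.distrib)
qed

lemma linext_0 [simp]: "linext f 0 = 0"
  by (simp add: linext_def)

lemma linext_uminus: "linext f (- x) = - linext f x"
  using linext_add[of f x "- x"] by (simp add: eq_neg_iff_add_eq_0 add.commute)

lemma linext_diff: "linext f (x - y) = linext f x - linext f y"
  using linext_add[of f x "- y"] by (simp add: linext_uminus)

lemma linext_monomial: "linext f (scalar z * word w) = scalar z * f w"
  by (simp add: linext_def flip: single_eq_scalar)

lemma linext_word: "linext f (word w) = f w"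
  using linext_monomial[of f 1 w] by simp

lemma linext_scalar: "linext f (scalar z) = scalar z * f []"
  using linext_monomial[of f z "[]"] by simp

lemma linext_scalar_mult: "linext f (scalar z * x) = scalar z * linext f x"
proof (induction x rule: free_alg_induct)
  case (monomial w z')
  then show ?case
    using linext_monomial[of f "z * z'" w] by (simp add: linext_monomial scalar_mult mult.assoc)
qed (simp add: linext_add distrib_left)

definition endo :: "(gen \<Rightarrow> free_alg) \<Rightarrow> free_alg \<Rightarrow> free_alg" where
  "endo \<phi> = linext (\<lambda>w. prod_list (map \<phi> w))"

lemma endo_simps:
  "endo \<phi> (x + y) = endo \<phi> x + endo \<phi> y" "endo \<phi> (x - y) = endo \<phi> x - endo \<phi> y"
  "endo \<phi> (- x) = - endo \<phi> x" "endo \<phi> 0 = 0" "endo \<phi> 1 = 1" "endo \<phi> (scalar z) = scalar z"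
  "endo \<phi> (word w) = prod_list (map \<phi> w)"
  using linext_word[of _ "[]"]
  by (simp_all add: endo_def linext_add linext_diff linext_uminus linext_word linext_scalar)

lemma endo_mult: "endo \<phi> (x * y) = endo \<phi> x * endo \<phi> y"
proof (induction x rule: free_alg_induct)
  case (monomial u z)
  show ?case
  proof (induction y rule: free_alg_induct)
    case (monomial v z')
    have "endo \<phi> (scalar z * word u * (scalar z' * word v)) = endo \<phi> (scalar (z * z') * word (u @ v))"
      by (simp only: monomial_mult word_append)
    then show ?case
      by (simp add: endo_def linext_monomial monomial_mult)
  qed (simp add: endo_simps distrib_left)
qed (simp add: endo_simps distrib_right)

text \<open>The \<open>(\<alpha>, \<beta>)\<close>-derivations, characterized by \<open>D (x y) = D x \<cdot> \<beta> y + \<alpha> x \<cdot> D y\<close>, comprise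
  the exterior derivative, the projection to one-forms and the coefficient maps of one-forms.\<close>

fun der_word :: "(gen \<Rightarrow> free_alg) \<Rightarrow> (gen \<Rightarrow> free_alg) \<Rightarrow> (gen \<Rightarrow> free_alg) \<Rightarrow> gen list \<Rightarrow> free_alg" where
  "der_word \<alpha> \<beta> \<delta> [] = 0"
| "der_word \<alpha> \<beta> \<delta> (x # w) = \<delta> x * prod_list (map \<beta> w) + \<alpha> x * der_word \<alpha> \<beta> \<delta> w"

definition der :: "(gen \<Rightarrow> free_alg) \<Rightarrow> (gen \<Rightarrow> free_alg) \<Rightarrow> (gen \<Rightarrow> free_alg) \<Rightarrow> free_alg \<Rightarrow> free_alg" where
  "der \<alpha> \<beta> \<delta> = linext (der_word \<alpha> \<beta> \<delta>)"

lemma der_simps: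
  "der \<alpha> \<beta> \<delta> (x + y) = der \<alpha> \<beta> \<delta> x + der \<alpha> \<beta> \<delta> y"
  "der \<alpha> \<beta> \<delta> (x - y) = der \<alpha> \<beta> \<delta> x - der \<alpha> \<beta> \<delta> y"
  "der \<alpha> \<beta> \<delta> (- x) = - der \<alpha> \<beta> \<delta> x" "der \<alpha> \<beta> \<delta> 0 = 0" "der \<alpha> \<beta> \<delta> 1 = 0"
  "der \<alpha> \<beta> \<delta> (scalar z) = 0" "der \<alpha> \<beta> \<delta> (word w) = der_word \<alpha> \<beta> \<delta> w"
  "der \<alpha> \<beta> \<delta> (scalar z * x) = scalar z * der \<alpha> \<beta> \<delta> x"
  using linext_word[of _ "[]"]
  by (simp_all add: der_def linext_add linext_diff linext_uminus linext_word linext_scalar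
      linext_scalar_mult)

lemma der_word_append:
  "der_word \<alpha> \<beta> \<delta> (u @ v) = der_word \<alpha> \<beta> \<delta> u * prod_list (map \<beta> v) + prod_list (map \<alpha> u) * der_word \<alpha> \<beta> \<delta> v"
  by (induction u) (simp_all add: algebra_simps)

lemma der_mult: "der \<alpha> \<beta> \<delta> (x * y) = der \<alpha> \<beta> \<delta> x * endo \<beta> y + endo \<alpha> x * der \<alpha> \<beta> \<delta> y"
proof (induction x rule: free_alg_induct)
  case (monomial u z)
  show ?case
  proof (induction y rule: free_alg_induct)
    case (monomial v z')
    have endo: "endo \<phi> (scalar z * word w) = scalar z * prod_list (map \<phi> w)" for \<phi> z w
      by (simp add: endo_def linext_monomial)
    have "der \<alpha> \<beta> \<delta> (scalar z * word u * (scalar z' * word v)) = der \<alpha> \<beta> \<delta> (scalar (z * z') * word (u @ v))"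
      by (simp only: monomial_mult word_append)
    then show ?case
      by (simp add: der_simps(7,8) endo der_word_append monomial_mult distrib_left)
  qed (simp add: endo_simps der_simps distrib_left distrib_right algebra_simps)
qed (simp add: endo_simps der_simps distrib_left distrib_right algebra_simps)

section \<open>The algebra of forms\<close>

lemma free_ring_simps [simp]:
  "carrier free_ring = UNIV" "x \<otimes>\<^bsub>free_ring\<^esub> y = x * y" "x \<oplus>\<^bsub>free_ring\<^esub> y = x + y"
  "\<one>\<^bsub>free_ring\<^esub> = 1" "\<zero>\<^bsub>free_ring\<^esub> = 0"
  by (simp_all add: free_ring_def ring_of_type_algebra_def)

lemma ring_free_ring: "ring free_ring"
proof (rule ringI)
  show "abelian_group free_ring"
    by (rule abelian_groupI) (auto simp: add.assoc add.commute intro: exI[of _ "- x" for x])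
  show "Group.monoid free_ring"
    by (rule monoidI) (auto simp: mult.assoc)
qed (auto simp: algebra_simps)

abbreviation relations :: "complex \<Rightarrow> free_alg set" where
  "relations q \<equiv> sl2_relations q \<union> bimodule_relations q \<union> wedge_relations q"

lemma ideal_relation_ideal: "ideal (relation_ideal q) free_ring"
  unfolding relation_ideal_def by (rule ring.genideal_ideal[OF ring_free_ring]) simp

lemma relations_in_ideal: "r \<in> relations q \<Longrightarrow> r \<in> relation_ideal q"
  unfolding relation_ideal_def using ring.genideal_self[OF ring_free_ring, of "relations q"] by auto

lemma relation_ideal_induct [consumes 1, case_names relation zero add left right]:
  assumes "x \<in> relation_ideal q"
    and "\<And>r. r \<in> relations q \<Longrightarrow> P r" "P 0" "\<And>x y. P x \<Longrightarrow> P y \<Longrightarrow> P (x + y)"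
    and left: "\<And>x y. P x \<Longrightarrow> P (y * x)" and "\<And>x y. P x \<Longrightarrow> P (x * y)"
  shows "P x"
proof -
  interpret free: ring free_ring by (rule ring_free_ring)
  \<comment> \<open>An ideal must contain additive inverses; here -x is the multiple of x by
    -1.\<close>
  have neg: "P (- x)" if "P x" for x
    using left[OF that, of "- 1"] by simp
  have inv: "\<ominus>\<^bsub>free_ring\<^esub> x = - x" for x
    by (rule free.minus_equality) simp_all
  have "subgroup {x. P x} (add_monoid free_ring)"
    by (rule free.add.subgroupI) (auto simp: assms neg inv intro: exI[of _ 0] assms(3))
  then have "ideal {x. P x} free_ring"
    by (rule idealI[OF ring_free_ring]) (auto simp: assms)
  then have "relation_ideal q \<subseteq> {x. P x}"
    unfolding relation_ideal_def using assms(2) by (intro free.genideal_minimal) auto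
  with assms(1) show ?thesis by auto
qed

lemma relation_ideal_closed:
  "0 \<in> relation_ideal q"
  "\<lbrakk>x \<in> relation_ideal q; y \<in> relation_ideal q\<rbrakk> \<Longrightarrow> x + y \<in> relation_ideal q"
  "x \<in> relation_ideal q \<Longrightarrow> y * x \<in> relation_ideal q"
  "x \<in> relation_ideal q \<Longrightarrow> x * y \<in> relation_ideal q"
  using ideal.I_l_closed[OF ideal_relation_ideal] ideal.I_r_closed[OF ideal_relation_ideal]
    additive_subgroup.zero_closed[OF ideal.axioms(1)[OF ideal_relation_ideal]]
    additive_subgroup.a_closed[OF ideal.axioms(1)[OF ideal_relation_ideal]]
  by simp_all

lemma endo_relation_ideal:
  assumes "\<And>r. r \<in> relations q \<Longrightarrow> endo \<phi> r \<in> relation_ideal q" "x \<in> relation_ideal q"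
  shows "endo \<phi> x \<in> relation_ideal q"
  using assms(2)
  by (induction rule: relation_ideal_induct)
    (simp_all add: assms(1) endo_simps endo_mult relation_ideal_closed)

lemma der_relation_ideal:
  assumes "\<And>x. x \<in> relation_ideal q \<Longrightarrow> endo \<alpha> x \<in> relation_ideal q"
    and "\<And>x. x \<in> relation_ideal q \<Longrightarrow> endo \<beta> x \<in> relation_ideal q"
    and "\<And>r. r \<in> relations q \<Longrightarrow> der \<alpha> \<beta> \<delta> r \<in> relation_ideal q"
    and "x \<in> relation_ideal q"
  shows "der \<alpha> \<beta> \<delta> x \<in> relation_ideal q"
proof -
  \<comment> \<open>Membership of x is carried along: the product rule also produces
    \<open>endo \<alpha> x\<close> and \<open>endo \<beta> x\<close>, which lie in the ideal because
    x does.\<close>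
  from assms(4) have "x \<in> relation_ideal q \<and> der \<alpha> \<beta> \<delta> x \<in> relation_ideal q"
    by (induction rule: relation_ideal_induct)
      (simp_all add: assms(1-3) relations_in_ideal der_simps der_mult relation_ideal_closed)
  then show ?thesis ..
qed

lemma ring_Forms: "ring (Forms q)"
  unfolding Forms_def by (rule ideal.quotient_is_ring[OF ideal_relation_ideal])

lemma cls_ring_hom: "cls q \<in> ring_hom free_ring (Forms q)"
proof -
  have "cls q = (\<lambda>x. relation_ideal q +>\<^bsub>free_ring\<^esub> x)"
    by (simp add: fun_eq_iff cls_def)
  then show ?thesis
    using ideal.rcos_ring_hom[OF ideal_relation_ideal] by (simp add: Forms_def)
qed

lemma cls_closed [simp]: "cls q x \<in> carrier (Forms q)"
  using ring_hom_closed[OF cls_ring_hom] by simp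

lemma cls_add: "cls q (x + y) = cls q x \<oplus>\<^bsub>Forms q\<^esub> cls q y"
  and cls_mult: "cls q (x * y) = cls q x \<otimes>\<^bsub>Forms q\<^esub> cls q y"
  and cls_one: "cls q 1 = \<one>\<^bsub>Forms q\<^esub>"
  using ring_hom_add[OF cls_ring_hom, of x y] ring_hom_mult[OF cls_ring_hom, of x y]
    ring_hom_one[OF cls_ring_hom] by simp_all

lemma cls_zero: "cls q 0 = \<zero>\<^bsub>Forms q\<^esub>"
  using ring_hom_zero[OF cls_ring_hom ring_free_ring ring_Forms] by simp

lemma cls_uminus: "cls q (- x) = \<ominus>\<^bsub>Forms q\<^esub> cls q x"
  using cls_add[of q "- x" x]
  by (intro abelian_group.minus_equality[OF ring.is_abelian_group[OF ring_Forms], symmetric]) (simp_all add: cls_zero)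

lemma carrier_Forms: "carrier (Forms q) = range (cls q)"
  by (auto simp: Forms_def FactRing_def A_RCOSETS_def RCOSETS_def cls_def a_r_coset_def)

lemma mem_cls_iff: "y \<in> cls q x \<longleftrightarrow> y - x \<in> relation_ideal q"
  by (auto simp: cls_def a_r_coset_def r_coset_def) (metis diff_add_cancel)

lemma cls_eq_iff: "cls q x = cls q y \<longleftrightarrow> x - y \<in> relation_ideal q"
proof
  assume "cls q x = cls q y"
  moreover have "x \<in> cls q x"
    by (simp add: mem_cls_iff relation_ideal_closed)
  ultimately show "x - y \<in> relation_ideal q"
    by (simp add: mem_cls_iff)
next
  assume xy: "x - y \<in> relation_ideal q"
  have "y - x \<in> relation_ideal q"
    using relation_ideal_closed(3)[OF xy, of "- 1"] by simp
  have "z - x \<in> relation_ideal q \<longleftrightarrow> z - y \<in> relation_ideal q" for z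
    using relation_ideal_closed(2)[OF _ xy, of "z - x"]
      relation_ideal_closed(2)[OF _ \<open>y - x \<in> relation_ideal q\<close>, of "z - y"] by auto
  then show "cls q x = cls q y"
    by (auto simp: mem_cls_iff)
qed

text \<open>Equality of cosets becomes an equation in a type of class ring, where associativity and
  cancellation hold without side conditions. The image of 1 is only an idempotent there;
  \<open>em_one\<close> absorbs it into neighbouring images.\<close>

definition em :: "complex \<Rightarrow> free_alg \<Rightarrow> free_alg set ring_family" where
  "em q x = emb (Forms q) (cls q x)"

lemma em_add: "em q (x + y) = em q x + em q y"
  and em_mult: "em q (x * y) = em q x * em q y"
  by (simp_all add: em_def cls_add cls_mult emb_add emb_mult ring_Forms)

lemma em_0: "em q 0 = 0"
  using em_add[of q 0 0] by simp

lemma em_uminus: "em q (- x) = - em q x"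
  using em_add[of q x "- x"] by (simp add: em_0 eq_neg_iff_add_eq_0 add.commute)

lemma em_diff: "em q (x - y) = em q x - em q y"
  using em_add[of q x "- y"] by (simp add: em_uminus)

lemma em_eq_iff: "em q x = em q y \<longleftrightarrow> cls q x = cls q y"
  by (simp add: em_def emb_eq_iff ring_Forms)

lemma relation_ideal_iff: "x \<in> relation_ideal q \<longleftrightarrow> em q x = 0"
  using em_eq_iff[of q x 0] by (simp add: cls_eq_iff em_0)

lemma em_one: "em q 1 * em q x = em q x" "em q 1 * (em q x * y) = em q x * y"
    "em q x * em q 1 = em q x"
  by (simp_all flip: mult.assoc em_mult)

lemma em_scalar_commute:
  "em q (word w) * em q (scalar z) = em q (scalar z) * em q (word w)"
  "em q (word w) * (em q (scalar z) * y) = em q (scalar z) * (em q (word w) * y)"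
  by (simp_all flip: mult.assoc em_mult add: scalar_commute)

lemma relations_ball:
  "(\<forall>r\<in>relations q. P r) \<longleftrightarrow>
    (\<forall>r\<in>sl2_relations q. P r) \<and> (\<forall>r\<in>wedge_relations q. P r) \<and>
    (\<forall>x\<in>coord_gens.
       P (word [EPlus, x] - scalar (q powi gdeg x) * word [x, EPlus]) \<and>
       P (word [EMinus, x] - scalar (q powi gdeg x) * word [x, EMinus]) \<and>
       P (word [EZero, x] - scalar (q powi (2 * gdeg x)) * word [x, EZero]))"
  by (auto simp: bimodule_relations_def)

lemma em_relation:
  "\<forall>r\<in>relations q. em q r = 0" "\<forall>r\<in>sl2_relations q. em q r = 0" "\<forall>r\<in>wedge_relations q. em q r = 0"
  using relations_in_ideal[of _ q] unfolding relation_ideal_iff by blast+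

text \<open>Powers are broken into single factors q and inverse q, the two scalars that
  \<open>em_scalar_inverse\<close> cancels.\<close>

lemma laurent:
  fixes q :: complex
  shows "q\<^sup>2 = q * q" "q ^ 3 = q * (q * q)" "q powi 2 = q * q" "q ^ 4 = q * (q * (q * q))" "q powi 4 = q * (q * (q * q))"
    "q powi (- 1) = inverse q" "q powi (- 2) = inverse q * inverse q"
    "q powi (- 4) = inverse q * (inverse q * (inverse q * inverse q))"
  by (simp_all add: power_int_def eval_nat_numeral)

text \<open>Products are nested to the right, so a relation for x * y must also be available in
  front of a further factor.\<close>

lemma mult_context: "x * y = z \<Longrightarrow> x * (y * w) = z * (w :: 'a :: semigroup_mult)"
  by (simp flip: mult.assoc)

lemma em_scalar_inverse:
  assumes "q \<noteq> 0"
  shows "em q (scalar q) * em q (scalar (inverse q)) = em q 1"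
    "em q (scalar (inverse q)) * em q (scalar q) = em q 1"
  using assms by (simp_all flip: em_mult scalar_mult)

text \<open>The relations are oriented towards the normal form: scalars, then \<open>b\<close> and \<open>c\<close>, then powers of \<open>a\<close> or of \<open>d\<close>, then forms.\<close>

lemma em_commute:
  assumes "q \<noteq> 0"
  shows
    "em q (word [GA]) * em q (word [GB]) = em q (scalar (inverse q)) * (em q (word [GB]) * em q (word [GA]))"
    "em q (word [GA]) * em q (word [GC]) = em q (scalar (inverse q)) * (em q (word [GC]) * em q (word [GA]))"
    "em q (word [GD]) * em q (word [GB]) = em q (scalar q) * (em q (word [GB]) * em q (word [GD]))"
    "em q (word [GD]) * em q (word [GC]) = em q (scalar q) * (em q (word [GC]) * em q (word [GD]))"
    "em q (word [GC]) * em q (word [GB]) = em q (word [GB]) * em q (word [GC])"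
    "em q (word [GA]) * em q (word [GD]) =
      em q 1 + em q (scalar (inverse q)) * (em q (word [GB]) * em q (word [GC]))"
    "em q (word [GD]) * em q (word [GA]) = em q 1 + em q (scalar q) * (em q (word [GB]) * em q (word [GC]))"
  using em_relation(2)[of q]
  by (simp_all add: sl2_relations_def word_Cons_Cons em_mult em_add em_diff em_one algebra_simps
      mult_context[OF em_scalar_inverse(2)[OF assms]])

lemma em_form_commute:
  assumes "q \<noteq> 0"
  shows
    "em q (word [EPlus]) * em q (word [GA]) = em q (scalar q) * (em q (word [GA]) * em q (word [EPlus]))"
    "em q (word [EPlus]) * em q (word [GB]) = em q (scalar (inverse q)) * (em q (word [GB]) * em q (word [EPlus]))"
    "em q (word [EPlus]) * em q (word [GC]) = em q (scalar q) * (em q (word [GC]) * em q (word [EPlus]))"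
    "em q (word [EPlus]) * em q (word [GD]) = em q (scalar (inverse q)) * (em q (word [GD]) * em q (word [EPlus]))"
    "em q (word [EMinus]) * em q (word [GA]) = em q (scalar q) * (em q (word [GA]) * em q (word [EMinus]))"
    "em q (word [EMinus]) * em q (word [GB]) = em q (scalar (inverse q)) * (em q (word [GB]) * em q (word [EMinus]))"
    "em q (word [EMinus]) * em q (word [GC]) = em q (scalar q) * (em q (word [GC]) * em q (word [EMinus]))"
    "em q (word [EMinus]) * em q (word [GD]) = em q (scalar (inverse q)) * (em q (word [GD]) * em q (word [EMinus]))"
    "em q (word [EZero]) * em q (word [GA]) = em q (scalar q) * (em q (scalar q) * (em q (word [GA]) * em q (word [EZero])))"
    "em q (word [EZero]) * em q (word [GB]) = em q (scalar (inverse q)) * (em q (scalar (inverse q)) * (em q (word [GB]) * em q (word [EZero])))"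
    "em q (word [EZero]) * em q (word [GC]) = em q (scalar q) * (em q (scalar q) * (em q (word [GC]) * em q (word [EZero])))"
    "em q (word [EZero]) * em q (word [GD]) = em q (scalar (inverse q)) * (em q (scalar (inverse q)) * (em q (word [GD]) * em q (word [EZero])))"
  using em_relation(1)[of q] unfolding relations_ball coord_gens_def
  by (simp_all add: word_Cons_Cons em_mult em_diff laurent scalar_mult mult.assoc)

lemma em_wedge:
  "em q (word [EPlus]) * em q (word [EPlus]) = 0"
  "em q (word [EMinus]) * em q (word [EMinus]) = 0"
  "em q (word [EZero]) * em q (word [EZero]) = 0"
  "em q (word [EMinus]) * em q (word [EPlus]) =
    - (em q (scalar q) * (em q (scalar q) * (em q (word [EPlus]) * em q (word [EMinus]))))"
  "em q (word [EZero]) * em q (word [EPlus]) =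
    - (em q (scalar q) * (em q (scalar q) * (em q (scalar q) * (em q (scalar q) *
        (em q (word [EPlus]) * em q (word [EZero]))))))"
  "em q (word [EZero]) * em q (word [EMinus]) =
    - (em q (scalar (inverse q)) * (em q (scalar (inverse q)) * (em q (scalar (inverse q)) *
        (em q (scalar (inverse q)) * (em q (word [EMinus]) * em q (word [EZero]))))))"
  using em_relation(3)[of q]
  by (simp_all add: wedge_relations_def word_Cons_Cons em_mult em_add laurent scalar_mult mult.assoc
      eq_neg_iff_add_eq_0 add.commute)

lemmas em_hom = word_Cons_Cons em_mult em_add em_diff em_uminus em_0
  scalar_add scalar_mult scalar_uminus laurent

lemmas em_rules = em_commute em_form_commute em_scalar_inverse

text \<open>Both sides of an identity are brought to the same ordered expression. The finite checks
  on relations and generators below are settled in this way.\<close>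

lemmas em_normal = em_hom em_one em_scalar_commute em_rules em_rules[THEN mult_context]
  em_wedge em_wedge[THEN mult_context] algebra_simps

section \<open>The exterior derivative on the quotient\<close>

text \<open>The sign automorphism given by the form degree; with it the graded Leibniz rule d (x y)
  = dx y + (parity x) dy is that of a twisted derivation.\<close>

definition parity :: "gen \<Rightarrow> free_alg" where
  "parity x = (if x \<in> coord_gens then word [x] else - word [x])"

lemma prod_list_word: "prod_list (map (\<lambda>x. word [x]) w) = word w"
proof (induction w)
  case (Cons x w)
  then show ?case
    by (simp add: word_Cons[of x w])
qed simp

lemma d_free_der: "d_free q = der parity (\<lambda>x. word [x]) (d_gen q)"
proof -
  have "d_word q w = der_word parity (\<lambda>x. word [x]) (d_gen q) w" for w
    by (induction w) (simp_all add: parity_def form_degree_def prod_list_word)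
  then show ?thesis
    by (simp add: fun_eq_iff d_free_def der_def linext_def)
qed

lemma endo_word: "endo (\<lambda>x. word [x]) x = x"
  by (induction x rule: free_alg_induct)
    (simp_all add: endo_simps endo_mult prod_list_word)

text \<open>The value z = 1 gives the projection to form degree zero. The value z = q also records
  the factor q^(deg x) that arises when e^+ or e^- passes x.\<close>

definition twist :: "complex \<Rightarrow> gen \<Rightarrow> free_alg" where
  "twist z x = (if x \<in> coord_gens then scalar (z powi gdeg x) * word [x] else 0)"

context
  fixes q :: complex
  assumes q: "q \<noteq> 0"
begin

lemma endo_parity_ideal: "x \<in> relation_ideal q \<Longrightarrow> endo parity x \<in> relation_ideal q"
proof (rule endo_relation_ideal)
  have "\<forall>r\<in>relations q. em q (endo parity r) = 0"
    unfolding relations_ball unfolding sl2_relations_def wedge_relations_def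
    by (simp add: coord_gens_def parity_def endo_simps endo_mult em_normal q)
  then show "r \<in> relations q \<Longrightarrow> endo parity r \<in> relation_ideal q" for r
    by (simp add: relation_ideal_iff)
qed

text \<open>The relations between coordinates are homogeneous for the grading, so rescaling by
  degree preserves them; in the other relations every term contains a form generator and is sent to
  zero.\<close>

lemma endo_twist_ideal:
  assumes "z = 1 \<or> z = q"
  shows "x \<in> relation_ideal q \<Longrightarrow> endo (twist z) x \<in> relation_ideal q"
proof (rule endo_relation_ideal)
  have "\<forall>r\<in>relations q. em q (endo (twist z) r) = 0"
    using assms unfolding relations_ball unfolding sl2_relations_def wedge_relations_def
    by (auto simp add: coord_gens_def twist_def endo_simps endo_mult em_normal q)
  then show "r \<in> relations q \<Longrightarrow> endo (twist z) r \<in> relation_ideal q" for r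
    by (simp add: relation_ideal_iff)
qed

text \<open>Well-definedness of d on the quotient reduces, by the product rule, to a check on the
  defining relations.\<close>

lemma d_free_ideal:
  assumes "x \<in> relation_ideal q"
  shows "d_free q x \<in> relation_ideal q"
proof -
  have "\<forall>r\<in>relations q. em q (der parity (\<lambda>x. word [x]) (d_gen q) r) = 0"
    unfolding relations_ball unfolding sl2_relations_def wedge_relations_def
    by (simp add: coord_gens_def parity_def der_simps der_mult endo_simps endo_mult em_normal q)
  then have relators: "der parity (\<lambda>x. word [x]) (d_gen q) r \<in> relation_ideal q" if "r \<in> relations q" for r
    using that unfolding relation_ideal_iff by blast
  have id: "endo (\<lambda>x. word [x]) y \<in> relation_ideal q" if "y \<in> relation_ideal q" for y
    unfolding endo_word by (rule that)
  show ?thesis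
    unfolding d_free_der
    by (rule der_relation_ideal[OF endo_parity_ideal id relators assms])
qed

end

section \<open>Homogeneous coordinates\<close>

definition coord_rep :: "int \<Rightarrow> free_alg set" where
  "coord_rep n = {x. \<forall>w \<in> Poly_Mapping.keys x. set w \<subseteq> coord_gens \<and> sum_list (map gdeg w) = n}"

definition forms_rep :: "nat \<Rightarrow> free_alg set" where
  "forms_rep k = {x. \<forall>w \<in> Poly_Mapping.keys x. form_degree w = k}"

lemma coord_eq: "coord q n = cls q ` coord_rep n"
  and forms_eq: "forms q k = cls q ` forms_rep k"
  by (simp_all add: coord_def coord_rep_def forms_def forms_rep_def)

lemma form_degree_append: "form_degree (u @ v) = form_degree u + form_degree v"
  by (simp add: form_degree_def)

lemma keys_closed_add:
  assumes "\<forall>w\<in>Poly_Mapping.keys x. P w" "\<forall>w\<in>Poly_Mapping.keys y. P w"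
  shows "\<forall>w\<in>Poly_Mapping.keys (x + y :: free_alg). P w"
  using assms Poly_Mapping.keys_add[of x y] by blast

lemma keys_closed_mult:
  assumes "\<forall>w\<in>Poly_Mapping.keys x. P w" "\<forall>w\<in>Poly_Mapping.keys y. Q w"
    and "\<And>u v. P u \<Longrightarrow> Q v \<Longrightarrow> S (u @ v)"
  shows "\<forall>w\<in>Poly_Mapping.keys (x * y :: free_alg). S w"
  using assms keys_mult[of x y] by (fastforce simp: plus_list_def)

lemma coord_rep_add: "\<lbrakk>x \<in> coord_rep n; y \<in> coord_rep n\<rbrakk> \<Longrightarrow> x + y \<in> coord_rep n"
  unfolding coord_rep_def mem_Collect_eq by (rule keys_closed_add)

lemma forms_rep_add: "\<lbrakk>x \<in> forms_rep n; y \<in> forms_rep n\<rbrakk> \<Longrightarrow> x + y \<in> forms_rep n"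
  unfolding forms_rep_def mem_Collect_eq by (rule keys_closed_add)

lemma coord_rep_mult: "\<lbrakk>x \<in> coord_rep m; y \<in> coord_rep n\<rbrakk> \<Longrightarrow> x * y \<in> coord_rep (m + n)"
  unfolding coord_rep_def mem_Collect_eq by (erule (1) keys_closed_mult) auto

lemma forms_rep_mult: "\<lbrakk>x \<in> forms_rep m; y \<in> forms_rep n\<rbrakk> \<Longrightarrow> x * y \<in> forms_rep (m + n)"
  unfolding forms_rep_def mem_Collect_eq by (erule (1) keys_closed_mult) (simp add: form_degree_append)

lemma coord_rep_monomial:
  "\<lbrakk>set w \<subseteq> coord_gens; sum_list (map gdeg w) = n\<rbrakk> \<Longrightarrow> scalar z * word w \<in> coord_rep n"
  by (simp add: coord_rep_def flip: single_eq_scalar)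

lemma coord_rep_word:
  "\<lbrakk>set w \<subseteq> coord_gens; sum_list (map gdeg w) = n\<rbrakk> \<Longrightarrow> word w \<in> coord_rep n"
  using coord_rep_monomial[of w n 1] by simp

lemma coord_rep_scalar: "scalar z \<in> coord_rep 0"
  using coord_rep_monomial[of "[]" 0 z] by simp

lemma coord_rep_0: "0 \<in> coord_rep n"
  by (simp add: coord_rep_def)

lemma coord_rep_scalar_mult: "x \<in> coord_rep n \<Longrightarrow> scalar z * x \<in> coord_rep n"
  using coord_rep_mult[OF coord_rep_scalar, of x n z] by simp

lemma coord_rep_uminus: "x \<in> coord_rep n \<Longrightarrow> - x \<in> coord_rep n"
  by (simp add: coord_rep_def)

lemma forms_rep_word: "form_degree w = k \<Longrightarrow> word w \<in> forms_rep k"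
  by (simp add: forms_rep_def word_def)

lemma coord_rep_forms_rep: "x \<in> coord_rep n \<Longrightarrow> x \<in> forms_rep 0"
  by (auto simp: coord_rep_def forms_rep_def form_degree_def filter_empty_conv)

lemma keys_induct [consumes 1, case_names zero monomial add]:
  assumes "\<forall>w\<in>Poly_Mapping.keys x. Q w" "P 0"
    and "\<And>w z. Q w \<Longrightarrow> P (scalar z * word w)" "\<And>x y. P x \<Longrightarrow> P y \<Longrightarrow> P (x + y)"
  shows "P (x :: free_alg)"
proof -
  have "P (\<Sum>w\<in>A. scalar (Poly_Mapping.lookup x w) * word w)" if "A \<subseteq> Poly_Mapping.keys x" for A
    using finite_subset[OF that finite_keys] that assms(1)
    by (induction A rule: finite_induct) (simp_all add: assms(2-))
  from this[of "Poly_Mapping.keys x"] show ?thesis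
    by (simp flip: free_alg_expansion)
qed

lemma coord_rep_induct [consumes 1, case_names zero monomial add]:
  assumes "x \<in> coord_rep n" "P 0"
    and "\<And>w z. set w \<subseteq> coord_gens \<Longrightarrow> sum_list (map gdeg w) = n \<Longrightarrow> P (scalar z * word w)"
    and "\<And>x y. P x \<Longrightarrow> P y \<Longrightarrow> P (x + y)"
  shows "P x"
  using assms(1) unfolding coord_rep_def mem_Collect_eq
  by (rule keys_induct) (use assms(2-) in auto)

lemma prod_list_twist:
  assumes "z \<noteq> 0" "set w \<subseteq> coord_gens"
  shows "prod_list (map (twist z) w) = scalar (z powi sum_list (map gdeg w)) * word w"
  using assms(2)
proof (induction w)
  case (Cons x w)
  then show ?case
    using monomial_mult[of "z powi gdeg x" "word [x]" "z powi sum_list (map gdeg w)" "word w"] assms(1)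
    by (simp add: twist_def power_int_add word_Cons[of x w])
qed simp

lemma endo_twist_coord:
  assumes "x \<in> coord_rep n" "z \<noteq> 0"
  shows "endo (twist z) x = scalar (z powi n) * x"
  using assms(1)
proof (induction rule: coord_rep_induct)
  case (monomial w c)
  then show ?case
    using monomial_mult[of c "1" "z powi n" "word w"] monomial_mult[of "z powi n" "1" c "word w"] assms(2)
    by (simp add: endo_simps endo_mult prod_list_twist mult.commute)
qed (simp_all add: endo_simps distrib_left)

lemma endo_parity_coord:
  assumes "x \<in> coord_rep n"
  shows "endo parity x = x"
  using assms
proof (induction rule: coord_rep_induct)
  case (monomial w z)
  then have "map parity w = map (\<lambda>x. word [x]) w"
    by (auto simp: parity_def)
  then show ?case
    by (simp add: endo_simps endo_mult prod_list_word del: map_eq_conv)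
qed (simp_all add: endo_simps)

lemma der_coord:
  assumes "x \<in> coord_rep n" "\<And>g. g \<in> coord_gens \<Longrightarrow> \<delta> g = 0"
  shows "der \<alpha> \<beta> \<delta> x = 0"
  using assms(1)
proof (induction rule: coord_rep_induct)
  case (monomial w z)
  from monomial(1) have "der_word \<alpha> \<beta> \<delta> w = 0"
    by (induction w) (simp_all add: assms(2))
  then show ?case
    by (simp add: der_simps)
qed (simp_all add: der_simps)

section \<open>Projections and coefficients of forms\<close>

abbreviation proj0 :: "free_alg \<Rightarrow> free_alg" where
  "proj0 \<equiv> endo (twist 1)"

text \<open>The component of form degree one: \<open>twist 1\<close> kills forms on both sides of
  the distinguished letter, so only words with exactly one form generator survive.\<close>

definition proj1 :: "free_alg \<Rightarrow> free_alg" where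
  "proj1 = der (twist 1) (twist 1) (\<lambda>x. if x \<in> coord_gens then 0 else word [x])"

text \<open>The left coefficient of e. In the quotient a word u e v, with coordinate words u and v
  and e one of e^+ and e^-, equals q^(deg v) u v e; hence the plain projection to the left of e and
  \<open>twist q\<close> to its right.\<close>

definition form_coeff :: "complex \<Rightarrow> gen \<Rightarrow> free_alg \<Rightarrow> free_alg" where
  "form_coeff q e = der (twist 1) (twist q) (\<lambda>x. if x = e then 1 else 0)"

lemma prod_list_twist_1: "prod_list (map (twist 1) w) = (if form_degree w = 0 then word w else 0)"
proof (induction w)
  case (Cons x w)
  then show ?case
    by (auto simp: twist_def form_degree_def word_Cons[of x w])
qed (simp add: form_degree_def)

lemma proj1_simps:
  "proj1 (x + y) = proj1 x + proj1 y" "proj1 (x - y) = proj1 x - proj1 y" "proj1 (- x) = - proj1 x"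
  "proj1 0 = 0" "proj1 1 = 0" "proj1 (scalar z * x) = scalar z * proj1 x"
  "proj1 (word [g]) = (if g \<in> coord_gens then 0 else word [g])"
  "proj1 (x * y) = proj1 x * proj0 y + proj0 x * proj1 y" "proj1 (scalar z) = 0"
  by (simp_all add: proj1_def der_simps der_mult endo_simps)

lemma proj1_word: "proj1 (word w) = (if form_degree w = 1 then word w else 0)"
proof -
  have "der_word (twist 1) (twist 1) (\<lambda>x. if x \<in> coord_gens then 0 else word [x]) w
      = (if form_degree w = 1 then word w else 0)"
  proof (induction w)
    case (Cons x w)
    then show ?case
      by (auto simp: prod_list_twist_1 word_Cons[of x w] form_degree_def twist_def[of 1 x])
  qed (simp add: form_degree_def)
  then show ?thesis
    by (simp add: proj1_def der_simps)
qed

lemma proj1_forms: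
  assumes "x \<in> forms_rep 1"
  shows "proj1 x = x"
proof -
  have "\<forall>w\<in>Poly_Mapping.keys x. form_degree w = 1"
    using assms by (simp add: forms_rep_def)
  then show ?thesis
    by (induction rule: keys_induct) (simp_all add: proj1_simps(1,4,6) proj1_word)
qed

lemma d_free_mult: "d_free q (x * y) = d_free q x * y + endo parity x * d_free q y"
  by (simp add: d_free_der der_mult endo_word)

lemma d_free_simps:
  "d_free q (x + y) = d_free q x + d_free q y" "d_free q (x - y) = d_free q x - d_free q y"
  "d_free q (- x) = - d_free q x" "d_free q 0 = 0" "d_free q 1 = 0"
  "d_free q (scalar z) = 0" "d_free q (word [g]) = d_gen q g"
  "d_free q (scalar z * x) = scalar z * d_free q x"
  by (simp_all add: d_free_der der_simps)

lemma proj0_d_free: "proj0 (d_free q x) = 0"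
proof (induction x rule: free_alg_induct)
  case (monomial w z)
  have gen: "proj0 (d_gen q g) = 0" for g
    by (cases g) (simp_all add: endo_simps endo_mult twist_def coord_gens_def)
  have "proj0 (d_free q (word w)) = 0"
  proof (induction w)
    case (Cons g w)
    then show ?case
      by (simp add: word_Cons[of g w] d_free_mult d_free_simps endo_simps(1) endo_mult gen)
  qed (simp add: d_free_simps endo_simps)
  then show ?case
    by (simp add: d_free_simps endo_simps(6) endo_mult)
qed (simp add: d_free_simps endo_simps)

text \<open>The exterior derivative raises the form degree by exactly one already on words:
  \<open>d_gen\<close> of a coordinate has degree one, \<open>d_gen\<close> of a form generator
  degree two.\<close>

lemma proj1_d_free: "proj1 (d_free q x) = d_free q (proj0 x)"
proof (induction x rule: free_alg_induct)
  case (monomial w z)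
  have gen: "proj1 (d_gen q g) = d_free q (twist 1 g)" for g
    by (cases g) (simp_all add: twist_def coord_gens_def d_free_simps proj1_simps word_Cons_Cons
        endo_simps endo_mult)
  have gen0: "proj0 (d_gen q g) = 0" for g
    using proj0_d_free[of q "word [g]"] by (simp add: d_free_simps)
  have parity: "proj0 (endo parity (word [g])) = twist 1 g" "endo parity (twist 1 g) = twist 1 g" for g
    by (simp_all add: endo_simps endo_mult parity_def twist_def)
  have "proj1 (d_free q (word w)) = d_free q (proj0 (word w))"
  proof (induction w)
    case (Cons g w)
    have "proj1 (d_free q (word (g # w))) = d_free q (twist 1 g) * proj0 (word w)
        + twist 1 g * d_free q (proj0 (word w))"
      by (simp add: word_Cons[of g w] d_free_mult d_free_simps proj1_simps(1,8) gen gen0 proj0_d_free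
          parity Cons)
    also have "\<dots> = d_free q (proj0 (word (g # w)))"
      by (simp add: word_Cons[of g w] endo_mult d_free_mult endo_simps parity)
    finally show ?case .
  qed (simp add: d_free_simps endo_simps proj1_simps)
  then show ?case
    by (simp add: d_free_simps endo_simps(6) endo_mult proj1_simps(6))
qed (simp add: d_free_simps endo_simps proj1_simps)

lemma form_coeff_mult_form:
  assumes "x \<in> coord_rep n" "e \<notin> coord_gens" "e' \<notin> coord_gens"
  shows "form_coeff q e (x * word [e']) = (if e' = e then x else 0)"
proof -
  have "der \<alpha> \<beta> (\<lambda>x. if x = e then 1 else 0) x = 0" for \<alpha> \<beta>
    by (rule der_coord[OF assms(1)]) (use assms in auto)
  then show ?thesis
    using endo_twist_coord[OF assms(1), of 1] by (simp add: form_coeff_def der_mult der_simps)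
qed

section \<open>The calculus on the quantum sphere\<close>

text \<open>The rule for the e^0 coefficient of d (x y) with deg x = m and deg y = n: the factor
  q^(2 n) arises when the e^0 of dx passes y.\<close>

lemma q_bracket_add:
  assumes "q \<noteq> 0"
  shows "q_bracket q (m + n) = q powi (2 * n) * q_bracket q m + q_bracket q n"
proof (cases "q\<^sup>2 = 1")
  case True
  then have "q powi (2 * n) = 1"
    by (simp add: power_int_mult)
  with True show ?thesis
    by (simp add: q_bracket_def)
next
  case False
  have "q powi (2 * (m + n)) = q powi (2 * n) * q powi (2 * m)"
    using assms by (simp add: distrib_left power_int_add)
  with False show ?thesis
    by (simp add: q_bracket_def field_simps)
qed

text \<open>The values at -1, 2 and -2 come from additivity, so that q^2 = 1 requires no separate
  treatment there.\<close>

lemma q_bracket_values: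
  assumes "q \<noteq> 0"
  shows "q_bracket q 0 = 0" "q_bracket q 1 = 1" "q_bracket q (- 1) = - (q powi (- 2))"
    "q_bracket q 2 = q\<^sup>2 + 1" "q_bracket q (- 2) = - (q powi (- 2)) - q powi (- 4)"
proof -
  show *: "q_bracket q 0 = 0" "q_bracket q 1 = 1"
    by (simp_all add: q_bracket_def)
  show **: "q_bracket q (- 1) = - (q powi (- 2))"
    using q_bracket_add[OF assms, of 1 "- 1"] * by (simp add: add_eq_0_iff)
  show "q_bracket q 2 = q\<^sup>2 + 1"
    using q_bracket_add[OF assms, of 1 1] * by simp
  have "q powi (- 2) * q powi (- 2) = q powi (- 4)"
    using assms by (simp flip: power_int_add)
  then show "q_bracket q (- 2) = - (q powi (- 2)) - q powi (- 4)"
    using q_bracket_add[OF assms, of "- 1" "- 1"] ** by simp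
qed

lemma em_central: "em q x * (em q (scalar z) * y) = em q (scalar z) * (em q x * y)"
  by (simp add: scalar_commute flip: mult.assoc em_mult)

text \<open>The exponent in \<open>e x = q\<^bsup>form_weight e \<cdot> deg x\<^esup> x e\<close>.\<close>

definition form_weight :: "gen \<Rightarrow> int" where
  "form_weight e = (if e = EZero then 2 else 1)"

lemma em_form_coord:
  assumes "x \<in> coord_rep n" "e \<notin> coord_gens" "q \<noteq> 0"
  shows "em q (word [e]) * em q x = em q (scalar (q powi (form_weight e * n))) * (em q x * em q (word [e]))"
    (is "?P x n")
proof -
  have gen: "?P (word [g]) (gdeg g)" if "g \<in> coord_gens" for g
    using em_relation(1)[of q] that assms(2) unfolding relations_ball
    by (cases e) (auto simp: coord_gens_def form_weight_def word_Cons_Cons em_diff em_mult)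
  have word: "?P (word w) (sum_list (map gdeg w))" if "set w \<subseteq> coord_gens" for w
    using that
  proof (induction w)
    case (Cons g w)
    let ?s = "\<lambda>n. em q (scalar (q powi (form_weight e * n)))"
    have "em q (word [e]) * em q (word (g # w)) = ?s (gdeg g) * (em q (word [g]) * (em q (word [e]) * em q (word w)))"
      using Cons by (simp add: word_Cons[of g w] em_mult mult_context[OF gen] mult.assoc)
    also have "\<dots> = ?s (gdeg g) * (?s (sum_list (map gdeg w)) * (em q (word [g]) * (em q (word w) * em q (word [e]))))"
      using Cons by (simp add: em_scalar_commute)
    also have "\<dots> = ?s (gdeg g + sum_list (map gdeg w)) * (em q (word (g # w)) * em q (word [e]))"
      using assms(3) by (simp add: word_Cons[of g w] em_mult distrib_left power_int_add scalar_mult mult.assoc)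
    finally show ?case by simp
  qed (simp add: em_one)
  from assms(1) show ?thesis
  proof (induction rule: coord_rep_induct)
    case (monomial w z)
    with word[of w] show ?case
      by (simp add: em_mult em_scalar_commute mult.assoc em_central[of q "scalar z"])
  qed (simp_all add: em_0 em_add distrib_left distrib_right)
qed

locale quantum_sphere =
  fixes q :: complex
  assumes q: "q \<noteq> 0"
begin

abbreviation add_forms (infixl "\<^bold>+" 65) where "V \<^bold>+ W \<equiv> V \<oplus>\<^bsub>Forms q\<^esub> W"
abbreviation mult_forms (infixl "\<^bold>*" 70) where "V \<^bold>* W \<equiv> V \<otimes>\<^bsub>Forms q\<^esub> W"
abbreviation "scal z \<equiv> cls q (scalar z)"

sublocale ring "Forms q"
  by (rule ring_Forms)

lemma coordE:
  assumes "V \<in> coord q n"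
  obtains x where "x \<in> coord_rep n" "V = cls q x"
  using assms by (auto simp: coord_eq)

lemma FormsE:
  assumes "V \<in> carrier (Forms q)"
  obtains x where "V = cls q x"
  using assms by (auto simp: carrier_Forms)

lemma coord_carrier [simp]: "V \<in> coord q n \<Longrightarrow> V \<in> carrier (Forms q)"
  by (auto simp: coord_eq)

lemma coord_add: "\<lbrakk>V \<in> coord q n; W \<in> coord q n\<rbrakk> \<Longrightarrow> V \<^bold>+ W \<in> coord q n"
  by (elim coordE) (auto simp: coord_eq coord_rep_add simp flip: cls_add)

lemma coord_mult: "\<lbrakk>V \<in> coord q m; W \<in> coord q n; m + n = k\<rbrakk> \<Longrightarrow> V \<^bold>* W \<in> coord q k"
  by (elim coordE) (auto simp: coord_eq coord_rep_mult simp flip: cls_mult)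

lemma coord_uminus: "V \<in> coord q n \<Longrightarrow> \<ominus>\<^bsub>Forms q\<^esub> V \<in> coord q n"
  by (elim coordE) (auto simp: coord_eq coord_rep_uminus simp flip: cls_uminus)

lemma coord_zero: "\<zero>\<^bsub>Forms q\<^esub> \<in> coord q n"
  unfolding coord_eq cls_zero[symmetric] using coord_rep_0 by blast

lemma coord_scal: "scal z \<in> coord q 0"
  by (simp add: coord_eq coord_rep_scalar)

lemma coord_one: "\<one>\<^bsub>Forms q\<^esub> \<in> coord q 0"
  using coord_scal[of 1] by (simp add: cls_one)

lemma coord_word: "\<lbrakk>set w \<subseteq> coord_gens; sum_list (map gdeg w) = n\<rbrakk> \<Longrightarrow> cls q (word w) \<in> coord q n"
  by (simp add: coord_eq coord_rep_word)

lemma scal_commute: "V \<in> carrier (Forms q) \<Longrightarrow> V \<^bold>* scal z = scal z \<^bold>* V"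
  by (elim FormsE) (simp add: scalar_commute flip: cls_mult)

lemma cls_eqI: "em q x = em q y \<Longrightarrow> cls q x = cls q y"
  by (simp add: em_eq_iff)

lemma form_commute:
  assumes "V \<in> coord q n" "e \<notin> coord_gens"
  shows "cls q (word [e]) \<^bold>* V = scal (q powi (form_weight e * n)) \<^bold>* (V \<^bold>* cls q (word [e]))"
  using assms(1)
proof (rule coordE)
  fix x assume "x \<in> coord_rep n" "V = cls q x"
  then show ?thesis
    using em_form_coord[OF _ assms(2) q]
    by (auto simp: em_mult intro!: cls_eqI simp flip: cls_mult)
qed

lemma dif_cls: "dif q (cls q x) = cls q (d_free q x)"
  unfolding dif_def
proof (intro the_elem_image_unique)
  show "cls q x \<noteq> {}"
    using mem_cls_iff[of x q x] relation_ideal_closed(1) by auto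
  show "cls q (d_free q y) = cls q (d_free q x)" if "y \<in> cls q x" for y
    using d_free_ideal[OF q] that by (simp add: mem_cls_iff cls_eq_iff flip: d_free_simps)
qed

lemma dif_closed [simp]: "V \<in> carrier (Forms q) \<Longrightarrow> dif q V \<in> carrier (Forms q)"
  by (elim FormsE) (simp add: dif_cls)

lemma dif_add:
  "\<lbrakk>V \<in> carrier (Forms q); W \<in> carrier (Forms q)\<rbrakk> \<Longrightarrow> dif q (V \<^bold>+ W) = dif q V \<^bold>+ dif q W"
  by (elim FormsE) (simp add: dif_cls d_free_simps flip: cls_add)

lemma dif_coord_mult:
  "\<lbrakk>V \<in> coord q n; W \<in> carrier (Forms q)\<rbrakk> \<Longrightarrow> dif q (V \<^bold>* W) = dif q V \<^bold>* W \<^bold>+ V \<^bold>* dif q W"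
  by (elim FormsE coordE) (simp add: dif_cls d_free_mult endo_parity_coord flip: cls_add cls_mult)

lemma dif_scal_mult: "W \<in> carrier (Forms q) \<Longrightarrow> dif q (scal z \<^bold>* W) = scal z \<^bold>* dif q W"
  by (elim FormsE) (simp add: dif_cls d_free_simps flip: cls_mult)

text \<open>The e^0 part of dx is x e^0 up to a scalar fixed by the degree of x, and this is what
  the monopole form subtracts. The other two coefficients preserve the total degree if e^- and e^+
  are given degrees -2 and 2.\<close>

lemma em_d_coord:
  assumes "x \<in> coord_rep n"
  shows "\<exists>f\<in>coord_rep (n + 2). \<exists>h\<in>coord_rep (n - 2).
    em q (d_free q x) = em q f * em q (word [EMinus]) + em q h * em q (word [EPlus])
      + em q (scalar (q_bracket q n)) * (em q x * em q (word [EZero]))" (is "?P x n")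
proof -
  have "?P (word [GA]) 1"
    by (rule bexI[of _ "0"], rule bexI[of _ "scalar q * word [GB]"])
      (simp_all add: d_free_simps q_bracket_values q em_hom em_one coord_rep_0 coord_rep_word
        coord_rep_scalar_mult coord_gens_def mult.assoc)
  moreover have "?P (word [GB]) (- 1)"
    by (rule bexI[of _ "word [GA]"], rule bexI[of _ "0"])
      (simp_all add: d_free_simps q_bracket_values q em_hom em_one coord_rep_0 coord_rep_word
        coord_rep_scalar_mult coord_gens_def mult.assoc)
  moreover have "?P (word [GC]) 1"
    by (rule bexI[of _ "0"], rule bexI[of _ "scalar q * word [GD]"])
      (simp_all add: d_free_simps q_bracket_values q em_hom em_one coord_rep_0 coord_rep_word
        coord_rep_scalar_mult coord_gens_def mult.assoc)
  moreover have "?P (word [GD]) (- 1)"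
    by (rule bexI[of _ "word [GC]"], rule bexI[of _ "0"])
      (simp_all add: d_free_simps q_bracket_values q em_hom em_one coord_rep_0 coord_rep_word
        coord_rep_scalar_mult coord_gens_def mult.assoc)
  ultimately have gen: "?P (word [g]) (gdeg g)" if "g \<in> coord_gens" for g
    using that unfolding coord_gens_def by (elim insertE emptyE) (simp_all only: gdeg.simps)
  have word: "?P (word w) (sum_list (map gdeg w))" if "set w \<subseteq> coord_gens" for w
    using that
  proof (induction w)
    case Nil
    show ?case
      using coord_rep_0[of 2] coord_rep_0[of "- 2"]
      by (intro bexI[of _ 0]) (simp_all add: d_free_simps q_bracket_values q em_0)
  next
    case (Cons g w)
    let ?n = "sum_list (map gdeg w)"
    obtain f h where w: "f \<in> coord_rep (?n + 2)" "h \<in> coord_rep (?n - 2)"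
      "em q (d_free q (word w)) = em q f * em q (word [EMinus]) + em q h * em q (word [EPlus])
        + em q (scalar (q_bracket q ?n)) * (em q (word w) * em q (word [EZero]))"
      using Cons by auto
    obtain f' h' where g: "f' \<in> coord_rep (gdeg g + 2)" "h' \<in> coord_rep (gdeg g - 2)"
      "em q (d_free q (word [g])) = em q f' * em q (word [EMinus]) + em q h' * em q (word [EPlus])
        + em q (scalar (q_bracket q (gdeg g))) * (em q (word [g]) * em q (word [EZero]))"
      using gen[of g] Cons by auto
    have word: "word w \<in> coord_rep ?n" "word [g] \<in> coord_rep (gdeg g)"
      using Cons by (simp_all add: coord_rep_word)
    have "parity g = word [g]"
      using Cons by (simp add: parity_def)
    \<comment> \<open>In the Leibniz rule the e^- and e^+ of the differential of the letter pass the
      word w of degree \<open>?n\<close>, whence the scalar.\<close>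
    let ?f = "scalar (q powi ?n) * (f' * word w) + word [g] * f"
    let ?h = "scalar (q powi ?n) * (h' * word w) + word [g] * h"
    have "?f \<in> coord_rep (gdeg g + ?n + 2)"
      using coord_rep_mult[OF g(1) word(1)] coord_rep_mult[OF word(2) w(1)]
      by (auto intro!: coord_rep_add coord_rep_scalar_mult simp: algebra_simps)
    moreover have "?h \<in> coord_rep (gdeg g + ?n - 2)"
      using coord_rep_mult[OF g(2) word(1)] coord_rep_mult[OF word(2) w(2)]
      by (auto intro!: coord_rep_add coord_rep_scalar_mult simp: algebra_simps)
    moreover have "em q (d_free q (word (g # w)))
      = em q ?f * em q (word [EMinus]) + em q ?h * em q (word [EPlus])
        + em q (scalar (q_bracket q (gdeg g + ?n))) * (em q (word (g # w)) * em q (word [EZero]))"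
    proof -
      have bracket: "q_bracket q (gdeg g + ?n) = q_bracket q (gdeg g) * q powi (2 * ?n) + q_bracket q ?n"
        using q_bracket_add[OF q, of "gdeg g" ?n] by simp
      show ?thesis
        using \<open>parity g = word [g]\<close> em_form_coord[OF word(1) _ q, of EMinus]
          em_form_coord[OF word(1) _ q, of EPlus] em_form_coord[OF word(1) _ q, of EZero]
        by (simp add: word_Cons[of g w] d_free_mult endo_simps em_mult em_add w(3) g(3) distrib_left
            distrib_right mult.assoc coord_gens_def form_weight_def bracket scalar_add scalar_mult
            em_central[of q "word [g]"] em_central[of q f'] em_central[of q h'] add_ac)
    qed
    ultimately show ?case
      unfolding list.map sum_list.Cons by blast
  qed
  from assms show ?thesis
  proof (induction rule: coord_rep_induct)
    case zero
    show ?case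
      by (intro bexI[of _ 0]) (simp_all add: d_free_simps em_0 coord_rep_0)
  next
    case (monomial w z)
    then obtain f h where "f \<in> coord_rep (n + 2)" "h \<in> coord_rep (n - 2)"
      "em q (d_free q (word w)) = em q f * em q (word [EMinus]) + em q h * em q (word [EPlus])
        + em q (scalar (q_bracket q n)) * (em q (word w) * em q (word [EZero]))"
      using word[of w] by auto
    moreover note em_central[of q "scalar z"]
    ultimately show ?case
      by (intro bexI[of _ "scalar z * f"] bexI[of _ "scalar z * h"])
        (simp_all add: d_free_simps em_mult coord_rep_scalar_mult distrib_left mult.assoc)
  next
    case (add x y)
    then obtain f h f' h' where "f \<in> coord_rep (n + 2)" "h \<in> coord_rep (n - 2)"
      "f' \<in> coord_rep (n + 2)" "h' \<in> coord_rep (n - 2)"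
      "em q (d_free q x) = em q f * em q (word [EMinus]) + em q h * em q (word [EPlus])
        + em q (scalar (q_bracket q n)) * (em q x * em q (word [EZero]))"
      "em q (d_free q y) = em q f' * em q (word [EMinus]) + em q h' * em q (word [EPlus])
        + em q (scalar (q_bracket q n)) * (em q y * em q (word [EZero]))"
      by blast
    then show ?case
      by (intro bexI[of _ "f + f'"] bexI[of _ "h + h'"])
        (simp_all add: d_free_simps em_add coord_rep_add distrib_left distrib_right algebra_simps)
  qed
qed

lemma dif_coordE:
  assumes "V \<in> coord q n"
  obtains F H where "F \<in> coord q (n + 2)" "H \<in> coord q (n - 2)"
    "dif q V = F \<^bold>* e_minus q \<^bold>+ H \<^bold>* e_plus q \<^bold>+ scal (q_bracket q n) \<^bold>* (V \<^bold>* e_zero q)"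
proof -
  obtain x where x: "x \<in> coord_rep n" "V = cls q x"
    using assms by (rule coordE)
  obtain f h where "f \<in> coord_rep (n + 2)" "h \<in> coord_rep (n - 2)"
    "em q (d_free q x) = em q f * em q (word [EMinus]) + em q h * em q (word [EPlus])
      + em q (scalar (q_bracket q n)) * (em q x * em q (word [EZero]))"
    using em_d_coord[OF x(1)] by blast
  then show thesis
    using x by (intro that[of "cls q f" "cls q h"])
      (auto simp: coord_eq dif_cls em_add em_mult intro!: cls_eqI simp flip: cls_add cls_mult)
qed

text \<open>On e x - q^(deg x) x e the twist of the right factor reproduces the commutation factor,
  so the relation goes to zero in the free algebra itself. For e^0 that factor is q^(2 deg x),
  whence the restriction on e.\<close>

lemma form_coeff_ideal:
  assumes "e = EMinus \<or> e = EPlus"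
  shows "x \<in> relation_ideal q \<Longrightarrow> form_coeff q e x \<in> relation_ideal q"
  unfolding form_coeff_def
proof (rule der_relation_ideal[OF endo_twist_ideal[OF q] endo_twist_ideal[OF q]])
  have "\<forall>r\<in>relations q. der (twist 1) (twist q) (\<lambda>x. if x = e then 1 else 0) r = 0"
    using assms unfolding relations_ball unfolding sl2_relations_def wedge_relations_def
    by (auto simp: coord_gens_def twist_def der_simps)
  then show "der (twist 1) (twist q) (\<lambda>x. if x = e then 1 else 0) r \<in> relation_ideal q"
    if "r \<in> relations q" for r
    using that relation_ideal_closed(1) by metis
qed auto

text \<open>The coefficient maps descend to the quotient and read off both coefficients. Uniqueness
  in the two definite descriptions rests on this.\<close>

lemma forms_independent:
  assumes "F \<in> coord q m" "F' \<in> coord q m" "H \<in> coord q n" "H' \<in> coord q n"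
    and eq: "F \<^bold>* e_minus q \<^bold>+ H \<^bold>* e_plus q = F' \<^bold>* e_minus q \<^bold>+ H' \<^bold>* e_plus q"
  shows "F = F'" "H = H'"
proof -
  obtain f f' h h' where rep: "f \<in> coord_rep m" "f' \<in> coord_rep m" "h \<in> coord_rep n" "h' \<in> coord_rep n"
    and cls: "F = cls q f" "F' = cls q f'" "H = cls q h" "H' = cls q h'"
    using assms by (elim coordE) blast
  let ?x = "f * word [EMinus] + h * word [EPlus] - (f' * word [EMinus] + h' * word [EPlus])"
  have "?x \<in> relation_ideal q"
    using eq unfolding cls by (simp flip: cls_mult cls_add add: cls_eq_iff)
  from form_coeff_ideal[OF _ this, of EMinus] form_coeff_ideal[OF _ this, of EPlus]
  have "f - f' \<in> relation_ideal q" "h - h' \<in> relation_ideal q"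
    using rep by (simp_all add: form_coeff_def der_simps(1,2))
      (simp_all add: form_coeff_mult_form coord_gens_def flip: form_coeff_def)
  then show "F = F'" "H = H'"
    by (simp_all add: cls cls_eq_iff)
qed

section \<open>One-forms on the quantum sphere\<close>

text \<open>\<open>frame k\<close> is the basis form whose coefficients on the sphere have degree \<open>k = \<plusminus>2\<close>.\<close>

definition frame :: "int \<Rightarrow> free_alg set" where
  "frame k = (if k = 2 then e_minus q else e_plus q)"

lemma frame_simps [simp]: "frame 2 = e_minus q" "frame (- 2) = e_plus q"
  by (simp_all add: frame_def)

lemma frame_closed [simp]: "frame k \<in> carrier (Forms q)"
  by (simp add: frame_def)

lemma frame_commute:
  assumes "V \<in> coord q n"
  shows "frame k \<^bold>* V = scal (q powi n) \<^bold>* (V \<^bold>* frame k)"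
  using form_commute[OF assms, of EMinus] form_commute[OF assms, of EPlus]
  by (simp add: frame_def form_weight_def coord_gens_def)

text \<open>Functions on the sphere have degree zero, so the commutation factor is 1; this lets them
  pass from one side of a basis form to the other.\<close>

lemma frame_commute_sphere: "V \<in> sphere q \<Longrightarrow> frame k \<^bold>* V = V \<^bold>* frame k"
  using frame_commute[of V 0 k] by (simp add: cls_one)

definition one_forms :: "free_alg set set" where
  "one_forms = {F \<^bold>* e_minus q \<^bold>+ H \<^bold>* e_plus q | F H. F \<in> coord q 2 \<and> H \<in> coord q (- 2)}"

lemma one_formsE:
  assumes "V \<in> one_forms"
  obtains F H where "F \<in> coord q 2" "H \<in> coord q (- 2)" "V = F \<^bold>* e_minus q \<^bold>+ H \<^bold>* e_plus q"
  using assms unfolding one_forms_def by blast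

lemma one_formsI:
  "\<lbrakk>F \<in> coord q 2; H \<in> coord q (- 2)\<rbrakk> \<Longrightarrow> F \<^bold>* e_minus q \<^bold>+ H \<^bold>* e_plus q \<in> one_forms"
  unfolding one_forms_def by blast

lemma one_forms_zero: "\<zero>\<^bsub>Forms q\<^esub> \<in> one_forms"
  using one_formsI[OF coord_zero coord_zero] by simp

lemma one_forms_add:
  assumes "V \<in> one_forms" "W \<in> one_forms"
  shows "V \<^bold>+ W \<in> one_forms"
proof -
  obtain F H F' H' where *: "F \<in> coord q 2" "H \<in> coord q (- 2)" "V = F \<^bold>* e_minus q \<^bold>+ H \<^bold>* e_plus q"
    "F' \<in> coord q 2" "H' \<in> coord q (- 2)" "W = F' \<^bold>* e_minus q \<^bold>+ H' \<^bold>* e_plus q"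
    using assms by (elim one_formsE) blast
  then have "V \<^bold>+ W = (F \<^bold>+ F') \<^bold>* e_minus q \<^bold>+ (H \<^bold>+ H') \<^bold>* e_plus q"
    by (simp add: l_distr a_ac)
  with * show ?thesis
    by (simp add: one_formsI coord_add)
qed

lemma one_forms_mult_left:
  assumes "V \<in> sphere q" "W \<in> one_forms"
  shows "V \<^bold>* W \<in> one_forms"
proof -
  obtain F H where *: "F \<in> coord q 2" "H \<in> coord q (- 2)" "W = F \<^bold>* e_minus q \<^bold>+ H \<^bold>* e_plus q"
    using assms by (elim one_formsE) blast
  then have "V \<^bold>* W = V \<^bold>* F \<^bold>* e_minus q \<^bold>+ V \<^bold>* H \<^bold>* e_plus q"
    using assms(1) by (simp add: r_distr m_assoc)
  moreover have "V \<^bold>* F \<in> coord q 2" "V \<^bold>* H \<in> coord q (- 2)"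
    using * assms(1) by (auto intro: coord_mult)
  ultimately show ?thesis
    by (simp add: one_formsI)
qed

lemma one_forms_mult_right:
  assumes "V \<in> sphere q" "W \<in> one_forms"
  shows "W \<^bold>* V \<in> one_forms"
proof -
  obtain F H where *: "F \<in> coord q 2" "H \<in> coord q (- 2)" "W = F \<^bold>* e_minus q \<^bold>+ H \<^bold>* e_plus q"
    using assms by (elim one_formsE) blast
  then have "W \<^bold>* V = F \<^bold>* V \<^bold>* e_minus q \<^bold>+ H \<^bold>* V \<^bold>* e_plus q"
    using assms(1) frame_commute_sphere[OF assms(1), of 2] frame_commute_sphere[OF assms(1), of "- 2"]
    by (simp add: l_distr m_assoc)
  moreover have "F \<^bold>* V \<in> coord q 2" "H \<^bold>* V \<in> coord q (- 2)"
    using * assms(1) by (auto intro: coord_mult)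
  ultimately show ?thesis
    by (simp add: one_formsI)
qed

lemma dif_sphere:
  assumes "V \<in> sphere q"
  shows "dif q V \<in> one_forms"
  using assms
proof (rule dif_coordE)
  fix F H
  assume "F \<in> coord q (0 + 2)" "H \<in> coord q (0 - 2)"
    "dif q V = F \<^bold>* e_minus q \<^bold>+ H \<^bold>* e_plus q \<^bold>+ scal (q_bracket q 0) \<^bold>* (V \<^bold>* e_zero q)"
  then show ?thesis
    using assms by (simp add: q_bracket_values q cls_zero one_formsI)
qed

lemma proj1_ideal: "x \<in> relation_ideal q \<Longrightarrow> proj1 x \<in> relation_ideal q"
  unfolding proj1_def
proof (rule der_relation_ideal[OF endo_twist_ideal[OF q] endo_twist_ideal[OF q]])
  have "\<forall>r\<in>relations q. em q (proj1 r) = 0"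
    unfolding relations_ball unfolding sl2_relations_def wedge_relations_def
    by (simp add: coord_gens_def twist_def proj1_simps endo_simps endo_mult em_normal q)
  then show "der (twist 1) (twist 1) (\<lambda>x. if x \<in> coord_gens then 0 else word [x]) r \<in> relation_ideal q"
    if "r \<in> relations q" for r
    using that unfolding relation_ideal_iff proj1_def by blast
qed auto

text \<open>Stability under \<open>d\<close> holds because \<open>proj1 (d x) = d (proj0 x)\<close>, so that nothing needs to be known
  about forms of degree two.\<close>

lemma sphere_exterior_proj:
  assumes "V \<in> sphere_exterior q"
  shows "\<exists>x. V = cls q x \<and> cls q (proj0 x) \<in> sphere q \<and> cls q (proj1 x) \<in> one_forms"
  using assms
proof induction
  case (base V)
  then obtain x where x: "x \<in> coord_rep 0" "V = cls q x"
    by (rule coordE)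
  then have "proj0 x = x" "proj1 x = 0"
    using endo_twist_coord[OF x(1), of 1] der_coord[OF x(1)] by (simp_all add: proj1_def)
  with x base show ?case
    by (auto simp: cls_zero one_forms_zero)
next
  case (dif V)
  then obtain x where "V = cls q x" "cls q (proj0 x) \<in> sphere q"
    by blast
  then show ?case
    using dif_sphere[of "cls q (proj0 x)"]
    by (auto simp: dif_cls proj0_d_free proj1_d_free cls_zero coord_zero intro!: exI[of _ "d_free q x"])
next
  case (add V W)
  then obtain x y where "V = cls q x" "cls q (proj0 x) \<in> sphere q" "cls q (proj1 x) \<in> one_forms"
    "W = cls q y" "cls q (proj0 y) \<in> sphere q" "cls q (proj1 y) \<in> one_forms"
    by blast
  then show ?case
    by (intro exI[of _ "x + y"]) (simp add: cls_add endo_simps proj1_simps(1) coord_add one_forms_add)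
next
  case (mult V W)
  then obtain x y where "V = cls q x" "cls q (proj0 x) \<in> sphere q" "cls q (proj1 x) \<in> one_forms"
    "W = cls q y" "cls q (proj0 y) \<in> sphere q" "cls q (proj1 y) \<in> one_forms"
    by blast
  then show ?case
    by (intro exI[of _ "x * y"])
      (simp add: cls_mult cls_add endo_mult proj1_simps(8) coord_mult one_forms_add
        one_forms_mult_left one_forms_mult_right)
qed

lemma sphere_forms_subset: "sphere_forms q 1 \<subseteq> one_forms"
proof
  fix V assume "V \<in> sphere_forms q 1"
  then obtain y where y: "V \<in> sphere_exterior q" "y \<in> forms_rep 1" "V = cls q y"
    by (auto simp: sphere_forms_def forms_eq)
  obtain x where x: "V = cls q x" "cls q (proj1 x) \<in> one_forms"
    using sphere_exterior_proj[OF y(1)] by metis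
  \<comment> \<open>V has a representative y of pure form degree one, fixed by \<open>proj1\<close>,
    and another one x that projects into \<open>one_forms\<close>; \<open>proj1\<close> respects the
    ideal, so the projections agree.\<close>
  have "x - y \<in> relation_ideal q"
    using x(1) y(3) unfolding cls_eq_iff[symmetric] by metis
  then have "cls q (proj1 x) = cls q (proj1 y)"
    using proj1_ideal unfolding cls_eq_iff proj1_simps(2)[symmetric] by blast
  with x y show "V \<in> one_forms"
    by (simp add: proj1_forms)
qed

text \<open>The indices 0, 1, 2 stand for \<open>b\<^sub>-\<close>, \<open>b\<^sub>+\<close>, \<open>b\<^sub>0\<close>, and the metric is
  \<open>\<Sum>i<3. metric_coeff i \<cdot> db\<^sub>i \<otimes> db\<^bsub>dual i\<^esub>\<close>.\<close>

definition sphere_gen :: "nat \<Rightarrow> free_alg" where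
  "sphere_gen i = [word [GA, GB], word [GC, GD], word [GB, GC]] ! i"

text \<open>Explicitly, the differentials of b_-, b_+ and b_0 are a^2 e^- + b^2 e^+, c^2 e^- + d^2
  e^+ and c a e^- + d b e^+. The order of the letters in the last one absorbs the factor q of c a =
  q a c and d b = q b d.\<close>

definition dif_coeff :: "int \<Rightarrow> nat \<Rightarrow> free_alg" where
  "dif_coeff k i = (if k = 2 then [word [GA, GA], word [GC, GC], word [GC, GA]] ! i
                    else [word [GB, GB], word [GD, GD], word [GD, GB]] ! i)"

definition dual :: "nat \<Rightarrow> nat" where
  "dual i = [1, 0, 2] ! i"

definition metric_coeff :: "nat \<Rightarrow> complex" where
  "metric_coeff i = [q\<^sup>2, 1, - q_two q] ! i"

definition metric_value :: "int \<Rightarrow> int \<Rightarrow> complex" where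
  "metric_value k l = (if k = l then 0 else if k = 2 then q\<^sup>2 else 1)"

lemma less_3_cases: "i < 3 \<longleftrightarrow> i = 0 \<or> i = 1 \<or> i = (2 :: nat)"
  by auto

lemmas list_simps = dif_coeff_def sphere_gen_def dual_def metric_coeff_def metric_value_def q_two_def
  numeral_3_eq_3 lessThan_Suc

lemma dif_sphere_gen:
  assumes "i < 3"
  shows "dif q (cls q (sphere_gen i)) = cls q (dif_coeff 2 i) \<^bold>* e_minus q \<^bold>+ cls q (dif_coeff (- 2) i) \<^bold>* e_plus q"
  using assms unfolding less_3_cases dif_cls
  by (elim disjE; simp flip: cls_mult cls_add; intro cls_eqI;
      simp add: list_simps d_free_der der_simps der_mult endo_simps parity_def coord_gens_def em_normal q)

lemma dif_sphere_gen_frame: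
  assumes "k = 2 \<or> k = - 2" "i < 3"
  shows "dif q (cls q (sphere_gen i)) = cls q (dif_coeff k i) \<^bold>* frame k \<^bold>+ cls q (dif_coeff (- k) i) \<^bold>* frame (- k)"
  using assms(1) dif_sphere_gen[OF assms(2)]
    a_comm[of "cls q (dif_coeff 2 i) \<^bold>* e_minus q" "cls q (dif_coeff (- 2) i) \<^bold>* e_plus q"] by auto

text \<open>At q = 1 these read (ad - bc)^2 = 1 for opposite indices, and for equal ones a
  cancellation such as a^2 c^2 + c^2 a^2 - 2 (ca)^2 = 0; the weights q^2, 1 and -[2] are the ones
  for which both survive for general q.\<close>

lemma metric_identity:
  assumes "k = 2 \<or> k = - 2" "l = 2 \<or> l = - 2"
  shows "cls q (\<Sum>i<3. scalar (metric_coeff i) * (dif_coeff k i * dif_coeff l (dual i))) = scal (metric_value k l)"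
  using assms by (elim disjE; intro cls_eqI; simp add: list_simps scalar_diff em_normal q)

lemma metric_value_nonzero: "\<lbrakk>k = 2 \<or> k = - 2; l = - k\<rbrakk> \<Longrightarrow> metric_value k l \<noteq> 0"
  using q by (auto simp: metric_value_def)

lemma dif_coeff_rep:
  assumes "k = 2 \<or> k = - 2" "i < 3"
  shows "dif_coeff k i \<in> coord_rep k"
  using assms unfolding less_3_cases
  by (elim disjE; simp add: dif_coeff_def coord_rep_word coord_gens_def)

lemma dual_less: "i < 3 \<Longrightarrow> dual i < 3"
  unfolding less_3_cases by (elim disjE) (simp_all add: dual_def)

lemma sphere_gen_sphere: "i < 3 \<Longrightarrow> cls q (sphere_gen i) \<in> sphere q"
  unfolding less_3_cases
  by (elim disjE; simp add: sphere_gen_def coord_word coord_gens_def)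

lemma forms_closed:
  "V \<in> forms q k \<Longrightarrow> V \<in> carrier (Forms q)"
  "\<lbrakk>V \<in> forms q k; W \<in> forms q k\<rbrakk> \<Longrightarrow> V \<^bold>+ W \<in> forms q k"
  "\<lbrakk>V \<in> forms q k; W \<in> forms q l\<rbrakk> \<Longrightarrow> V \<^bold>* W \<in> forms q (k + l)"
  "V \<in> coord q n \<Longrightarrow> V \<in> forms q 0"
  by (auto simp: forms_eq coord_eq forms_rep_add forms_rep_mult coord_rep_forms_rep
      simp flip: cls_add cls_mult)

lemma frame_forms: "frame k \<in> forms q 1"
  by (simp add: frame_def forms_eq forms_rep_word form_degree_def coord_gens_def)

lemma sphere_exterior_zero: "\<zero>\<^bsub>Forms q\<^esub> \<in> sphere_exterior q"
  by (rule sphere_exterior.base[OF coord_zero])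

lemma sphere_exterior_sum:
  "(\<And>i. i < (n :: nat) \<Longrightarrow> cls q (f i) \<in> sphere_exterior q) \<Longrightarrow> cls q (\<Sum>i<n. f i) \<in> sphere_exterior q"
  by (induction n) (auto simp: cls_zero cls_add sphere_exterior_zero intro: sphere_exterior.add)

text \<open>The metric, paired with the coefficients of one of the two basis forms, isolates the other one.\<close>

lemma frame_sphere_forms:
  assumes k: "k = 2 \<or> k = - 2" and F: "F \<in> coord q k"
  shows "F \<^bold>* frame k \<in> sphere_forms q 1"
proof -
  obtain f where f: "f \<in> coord_rep k" "F = cls q f"
    using F by (rule coordE)
  define e e' where "e = word [if k = 2 then EMinus else EPlus]" and "e' = word [if k = 2 then EPlus else EMinus]"
  have e: "frame k = cls q e" "frame (- k) = cls q e'"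
    using k by (auto simp: e_def e'_def)
  have k': "- k = 2 \<or> - k = - 2"
    using k by auto
  define c where "c i = scalar (inverse (metric_value (- k) k)) * (scalar (metric_coeff i) * dif_coeff (- k) i)" for i
  let ?d = "\<lambda>i. dif_coeff k (dual i) * e + dif_coeff (- k) (dual i) * e'"
  have d: "cls q (?d i) = dif q (cls q (sphere_gen (dual i)))" if "i < 3" for i
    unfolding dif_sphere_gen_frame[OF k dual_less[OF that]] e by (simp only: cls_add cls_mult)
  have "(\<Sum>i<3. c i * ?d i)
    = scalar (inverse (metric_value (- k) k)) *
      ((\<Sum>i<3. scalar (metric_coeff i) * (dif_coeff (- k) i * dif_coeff k (dual i))) * e
        + (\<Sum>i<3. scalar (metric_coeff i) * (dif_coeff (- k) i * dif_coeff (- k) (dual i))) * e')"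
    by (simp add: c_def sum_distrib_left sum_distrib_right sum.distrib distrib_left mult.assoc)
  then have "cls q (\<Sum>i<3. c i * ?d i) = cls q (scalar (inverse (metric_value (- k) k)) * (scalar (metric_value (- k) k) * e))"
    by (simp add: cls_mult cls_add metric_identity[OF k' k] metric_identity[OF k' k'])
      (simp add: metric_value_def cls_zero)
  then have "cls q (\<Sum>i<3. c i * ?d i) = cls q e"
    using metric_value_nonzero[OF k', of k] by (simp flip: mult.assoc scalar_mult)
  then have "F \<^bold>* frame k = cls q (\<Sum>i<3. f * c i * ?d i)"
    by (simp add: f e cls_mult mult.assoc flip: sum_distrib_left)
  moreover have "cls q (f * c i * ?d i) \<in> sphere_exterior q" if "i < 3" for i
  proof -
    \<comment> \<open>The degrees k and -k cancel: the form is a combination of differentials with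
      coefficients on the sphere.\<close>
    have "f * c i \<in> coord_rep (k + - k)"
      unfolding c_def
      by (intro coord_rep_mult f coord_rep_scalar_mult dif_coeff_rep k' that)
    then have "cls q (f * c i) \<in> sphere q"
      by (simp add: coord_eq)
    then show ?thesis
      unfolding cls_mult[of _ _ "?d i"] d[OF that]
      using sphere_gen_sphere[OF dual_less[OF that]]
      by (intro sphere_exterior.intros)
  qed
  ultimately have "F \<^bold>* frame k \<in> sphere_exterior q"
    by (simp add: sphere_exterior_sum)
  moreover have "F \<^bold>* frame k \<in> forms q (0 + 1)"
    using F frame_forms by (intro forms_closed)
  ultimately show ?thesis
    by (simp add: sphere_forms_def)
qed

lemma sphere_forms_closed:
  "V \<in> sphere_forms q k \<Longrightarrow> V \<in> carrier (Forms q)"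
  "\<lbrakk>V \<in> sphere_forms q k; W \<in> sphere_forms q k\<rbrakk> \<Longrightarrow> V \<^bold>+ W \<in> sphere_forms q k"
  "\<lbrakk>V \<in> sphere_forms q k; W \<in> sphere_forms q l; k + l = m\<rbrakk> \<Longrightarrow> V \<^bold>* W \<in> sphere_forms q m"
  "V \<in> sphere q \<Longrightarrow> V \<in> sphere_forms q 0"
  by (auto simp: sphere_forms_def forms_closed intro: sphere_exterior.intros)

lemma sphere_forms_1: "sphere_forms q 1 = one_forms"
proof
  show "one_forms \<subseteq> sphere_forms q 1"
    using frame_sphere_forms[of 2] frame_sphere_forms[of "- 2"]
    by (auto simp: one_forms_def intro!: sphere_forms_closed(2))
qed (rule sphere_forms_subset)

lemma subgroup_sphere_forms: "subgroup (sphere_forms q k) (add_monoid (Forms q))"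
proof (rule add.subgroupI)
  have zero: "\<zero>\<^bsub>Forms q\<^esub> \<in> forms q k"
    unfolding forms_eq cls_zero[symmetric] by (rule imageI) (simp add: forms_rep_def)
  then show "sphere_forms q k \<noteq> {}"
    using sphere_exterior_zero by (auto simp: sphere_forms_def)
  show "\<ominus>\<^bsub>Forms q\<^esub> V \<in> sphere_forms q k" if "V \<in> sphere_forms q k" for V
    using sphere_forms_closed(3)[OF sphere_forms_closed(4)[OF coord_uminus[OF coord_one]] that, of k]
      sphere_forms_closed(1)[OF that] by (simp add: l_minus)
qed (auto intro: sphere_forms_closed)

lemma subgroup_coord: "subgroup (coord q n) (add_monoid (Forms q))"
  by (rule add.subgroupI) (auto intro: coord_add coord_uminus coord_zero)

end

text \<open>Keeps the degree in \<open>sphere_forms q 1\<close> in the shape in which the tensor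
  groups are stated.\<close>

declare One_nat_def [simp del]

text \<open>The three terms stand for the three generators. The group is a parameter because the
  same sum is formed among tensors and, through \<open>add_monoid\<close>, among forms.\<close>

definition sum3 :: "('g, 'm) monoid_scheme \<Rightarrow> (nat \<Rightarrow> 'g) \<Rightarrow> 'g" where
  "sum3 G f = f 0 \<otimes>\<^bsub>G\<^esub> (f 1 \<otimes>\<^bsub>G\<^esub> f 2)"

lemma sum3_closed:
  assumes "comm_group G" "\<And>i. i < 3 \<Longrightarrow> f i \<in> carrier G"
  shows "sum3 G f \<in> carrier G"
proof -
  interpret G: comm_group G by fact
  show ?thesis
    using assms(2)[of 0] assms(2)[of 1] assms(2)[of 2] by (simp add: sum3_def)
qed

lemma sum3_mult:
  assumes "comm_group G" "\<And>i. i < 3 \<Longrightarrow> f i \<in> carrier G" "\<And>i. i < 3 \<Longrightarrow> g i \<in> carrier G"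
  shows "sum3 G (\<lambda>i. f i \<otimes>\<^bsub>G\<^esub> g i) = sum3 G f \<otimes>\<^bsub>G\<^esub> sum3 G g"
proof -
  interpret G: comm_group G by fact
  show ?thesis
    using assms(2)[of 0] assms(2)[of 1] assms(2)[of 2] assms(3)[of 0] assms(3)[of 1] assms(3)[of 2]
    by (simp add: sum3_def G.m_ac)
qed

lemma sum3_hom:
  assumes "h \<in> hom G H" "comm_group G" "\<And>i. i < 3 \<Longrightarrow> f i \<in> carrier G"
  shows "h (sum3 G f) = sum3 H (\<lambda>i. h (f i))"
proof -
  interpret G: comm_group G by fact
  show ?thesis
    using assms(3)[of 0] assms(3)[of 1] assms(3)[of 2]
    by (simp add: sum3_def hom_mult[OF assms(1)])
qed

lemma sum3_cong: "(\<And>i. i < 3 \<Longrightarrow> f i = g i) \<Longrightarrow> sum3 G f = sum3 G g"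
  by (simp add: sum3_def)

context quantum_sphere
begin

section \<open>Tensors on the quantum sphere\<close>

sublocale charged: tensor_product "Forms q" "sphere q" "sphere_forms q 1" "coord q n" for n
  by (intro tensor_product.intro tensor_product_axioms.intro ring_Forms subgroup_sphere_forms subgroup_coord)
    (auto intro: sphere_forms_closed(3,4) coord_mult)

sublocale sphere: tensor_product "Forms q" "sphere q" "sphere_forms q k" "sphere_forms q l" for k l
  by (intro tensor_product.intro tensor_product_axioms.intro ring_Forms subgroup_sphere_forms)
    (auto intro: sphere_forms_closed(3,4))

abbreviation "T1 n \<equiv> stensor q (sphere_forms q 1) (coord q n)"
abbreviation "tens1 n \<equiv> stens q (sphere_forms q 1) (coord q n)"

text \<open>\<open>\<Sum>i<3. dif_coeff k i \<cdot> dual_coeff k i = 1\<close> expresses that \<open>1\<close> is a product of elements of degrees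
  \<open>k\<close> and \<open>- k\<close>, whence \<open>F e \<otimes> V\<close> depends on \<open>F V\<close> only.\<close>

definition dual_coeff :: "int \<Rightarrow> nat \<Rightarrow> free_alg" where
  "dual_coeff k i = scalar (inverse (metric_value k (- k)) * metric_coeff i) * dif_coeff (- k) (dual i)"

definition form_sum3 :: "(nat \<Rightarrow> free_alg set) \<Rightarrow> free_alg set" where
  "form_sum3 f = f 0 \<^bold>+ (f 1 \<^bold>+ f 2)"

text \<open>From 1 = \<Sum> u_i v_i one gets W = \<Sum> u_i (v_i W), and this is the tensor \<Sum>
  u_i e \<otimes> v_i W. Up to the scalar q^n it inverts multiplication on tensors whose first
  factor is a multiple of the one basis form \<open>frame k\<close>.\<close>

definition collapse :: "int \<Rightarrow> int \<Rightarrow> free_alg set \<Rightarrow> (free_alg set \<times> free_alg set \<Rightarrow>\<^sub>0 int) set" where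
  "collapse k n W =
    sum3 (T1 n) (\<lambda>i. tens1 n (cls q (dif_coeff k i) \<^bold>* frame k) (cls q (dual_coeff k i) \<^bold>* W))"

lemma form_sum3_eq: "form_sum3 f = sum3 (add_monoid (Forms q)) f"
  by (simp add: form_sum3_def sum3_def)

lemma form_sum3_cls: "form_sum3 (\<lambda>i. cls q (f i)) = cls q (\<Sum>i<3. f i)"
  by (simp add: form_sum3_def numeral_3_eq_3 lessThan_Suc numeral_2_eq_2 One_nat_def cls_add a_ac)

lemma form_sum3_cong: "(\<And>i. i < 3 \<Longrightarrow> f i = g i) \<Longrightarrow> form_sum3 f = form_sum3 g"
  by (simp add: form_sum3_def)

lemma form_sum3_distrib_right:
  "\<lbrakk>\<And>i. i < 3 \<Longrightarrow> f i \<in> carrier (Forms q); V \<in> carrier (Forms q)\<rbrakk> \<Longrightarrow>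
    form_sum3 (\<lambda>i. f i \<^bold>* V) = form_sum3 f \<^bold>* V"
  by (simp add: form_sum3_def l_distr)

lemma form_sum3_distrib_left:
  "\<lbrakk>\<And>i. i < 3 \<Longrightarrow> f i \<in> carrier (Forms q); V \<in> carrier (Forms q)\<rbrakk> \<Longrightarrow>
    form_sum3 (\<lambda>i. V \<^bold>* f i) = V \<^bold>* form_sum3 f"
  by (simp add: form_sum3_def r_distr)

lemma dual_coeff_coord:
  assumes "k = 2 \<or> k = - 2" "i < 3"
  shows "cls q (dual_coeff k i) \<in> coord q (- k)" "cls q (dif_coeff k i) \<in> coord q k"
  using dif_coeff_rep[of "- k" "dual i"] dif_coeff_rep[of k i] assms dual_less[OF assms(2)]
  by (auto simp: dual_coeff_def coord_eq coord_rep_scalar_mult)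

lemma sum3_dif_dual:
  assumes "k = 2 \<or> k = - 2"
  shows "form_sum3 (\<lambda>i. cls q (dif_coeff k i) \<^bold>* cls q (dual_coeff k i)) = \<one>\<^bsub>Forms q\<^esub>"
proof -
  have "- k = 2 \<or> - k = - 2"
    using assms by auto
  note identity = metric_identity[OF assms this]
  have "dif_coeff k i * dual_coeff k i
      = scalar (inverse (metric_value k (- k))) *
        (scalar (metric_coeff i) * (dif_coeff k i * dif_coeff (- k) (dual i)))" for i
    unfolding dual_coeff_def
    using monomial_mult[of 1 "dif_coeff k i" "inverse (metric_value k (- k)) * metric_coeff i"]
    by (simp add: scalar_mult mult.assoc)
  then have "cls q (\<Sum>i<3. dif_coeff k i * dual_coeff k i)
      = cls q (scalar (inverse (metric_value k (- k))) * scalar (metric_value k (- k)))"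
    by (simp only: flip: sum_distrib_left) (simp only: cls_mult identity)
  then show ?thesis
    using metric_value_nonzero[OF assms, of "- k"]
    by (simp add: form_sum3_cls flip: cls_mult scalar_mult) (simp add: cls_one)
qed

lemma tens1_closed:
  "\<lbrakk>k = 2 \<or> k = - 2; F \<in> coord q k; W \<in> coord q n\<rbrakk> \<Longrightarrow> tens1 n (F \<^bold>* frame k) W \<in> carrier (T1 n)"
  by (intro charged.tens_closed frame_sphere_forms)

lemma collapse_summand:
  assumes "k = 2 \<or> k = - 2" "W \<in> coord q (n + k)" "i < 3"
  shows "cls q (dual_coeff k i) \<^bold>* W \<in> coord q n"
    "tens1 n (cls q (dif_coeff k i) \<^bold>* frame k) (cls q (dual_coeff k i) \<^bold>* W) \<in> carrier (T1 n)"
proof -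
  show "cls q (dual_coeff k i) \<^bold>* W \<in> coord q n"
    using dual_coeff_coord[OF assms(1,3)] assms(2) by (auto intro: coord_mult)
  then show "tens1 n (cls q (dif_coeff k i) \<^bold>* frame k) (cls q (dual_coeff k i) \<^bold>* W) \<in> carrier (T1 n)"
    using dual_coeff_coord[OF assms(1,3)] by (intro tens1_closed assms)
qed

lemma collapse_closed:
  "\<lbrakk>k = 2 \<or> k = - 2; W \<in> coord q (n + k)\<rbrakk> \<Longrightarrow> collapse k n W \<in> carrier (T1 n)"
  unfolding collapse_def by (intro sum3_closed charged.comm_group_tensor collapse_summand)

text \<open>Insert 1 = \<Sum> u_i v_i in front of F. Each v_i F has degree zero, so it commutes with
  \<open>frame k\<close> and crosses the tensor sign by balancing.\<close>

lemma tens1_eq_collapse: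
  assumes k: "k = 2 \<or> k = - 2" and F: "F \<in> coord q k" and W: "W \<in> coord q n"
  shows "tens1 n (F \<^bold>* frame k) W = collapse k n (F \<^bold>* W)"
proof -
  let ?u = "\<lambda>i. cls q (dif_coeff k i)" and ?v = "\<lambda>i. cls q (dual_coeff k i)"
  have uv: "?u i \<in> coord q k" "?v i \<^bold>* F \<in> sphere q" "?u i \<^bold>* frame k \<in> sphere_forms q 1" if "i < 3" for i
    using dual_coeff_coord[OF k that] F k by (auto intro: coord_mult frame_sphere_forms)
  have step: "?u i \<^bold>* frame k \<^bold>* (?v i \<^bold>* F) = ?u i \<^bold>* ?v i \<^bold>* (F \<^bold>* frame k)" if "i < 3" for i
  proof -
    have "?u i \<^bold>* frame k \<^bold>* (?v i \<^bold>* F) = ?u i \<^bold>* (frame k \<^bold>* (?v i \<^bold>* F))"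
      using F by (simp add: m_assoc)
    also have "\<dots> = ?u i \<^bold>* (?v i \<^bold>* F \<^bold>* frame k)"
      by (simp only: frame_commute_sphere[OF uv(2)[OF that]])
    finally show ?thesis
      using F by (simp add: m_assoc)
  qed
  have "F \<^bold>* frame k = form_sum3 (\<lambda>i. ?u i \<^bold>* ?v i) \<^bold>* (F \<^bold>* frame k)"
    using F by (simp add: sum3_dif_dual[OF k])
  also have "\<dots> = form_sum3 (\<lambda>i. ?u i \<^bold>* ?v i \<^bold>* (F \<^bold>* frame k))"
    using F by (intro form_sum3_distrib_right[symmetric]) auto
  also have "\<dots> = form_sum3 (\<lambda>i. ?u i \<^bold>* frame k \<^bold>* (?v i \<^bold>* F))"
    by (intro form_sum3_cong) (simp add: step)
  finally have "tens1 n (F \<^bold>* frame k) W = tens1 n (form_sum3 (\<lambda>i. ?u i \<^bold>* frame k \<^bold>* (?v i \<^bold>* F))) W"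
    by simp
  also have "\<dots> = sum3 (T1 n) (\<lambda>i. tens1 n (?u i \<^bold>* frame k \<^bold>* (?v i \<^bold>* F)) W)"
  proof -
    have "?u i \<^bold>* frame k \<^bold>* (?v i \<^bold>* F) \<in> sphere_forms q 1" if "i < 3" for i
      by (rule charged.right_action[OF uv(3)[OF that] uv(2)[OF that]])
    then show ?thesis
      using W by (simp add: sum3_def form_sum3_def charged.tens_add_left charged.M_closed)
  qed
  also have "\<dots> = sum3 (T1 n) (\<lambda>i. tens1 n (?u i \<^bold>* frame k) (?v i \<^bold>* (F \<^bold>* W)))"
  proof (rule sum3_cong)
    fix i :: nat assume i: "i < 3"
    have "tens1 n (?u i \<^bold>* frame k \<^bold>* (?v i \<^bold>* F)) W = tens1 n (?u i \<^bold>* frame k) (?v i \<^bold>* F \<^bold>* W)"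
      by (rule charged.tens_balance[OF uv(3)[OF i] uv(2)[OF i] W])
    moreover have "?v i \<^bold>* F \<^bold>* W = ?v i \<^bold>* (F \<^bold>* W)"
      using F W by (simp add: m_assoc)
    ultimately show "tens1 n (?u i \<^bold>* frame k \<^bold>* (?v i \<^bold>* F)) W
        = tens1 n (?u i \<^bold>* frame k) (?v i \<^bold>* (F \<^bold>* W))"
      by simp
  qed
  finally show ?thesis
    by (simp add: collapse_def)
qed

lemma collapse_add:
  assumes "k = 2 \<or> k = - 2" "V \<in> coord q (n + k)" "W \<in> coord q (n + k)"
  shows "collapse k n (V \<^bold>+ W) = collapse k n V \<otimes>\<^bsub>T1 n\<^esub> collapse k n W"
proof -
  have "collapse k n (V \<^bold>+ W) = sum3 (T1 n) (\<lambda>i.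
      tens1 n (cls q (dif_coeff k i) \<^bold>* frame k) (cls q (dual_coeff k i) \<^bold>* V) \<otimes>\<^bsub>T1 n\<^esub>
      tens1 n (cls q (dif_coeff k i) \<^bold>* frame k) (cls q (dual_coeff k i) \<^bold>* W))"
    unfolding collapse_def
  proof (rule sum3_cong)
    fix i :: nat assume "i < 3"
    then show "tens1 n (cls q (dif_coeff k i) \<^bold>* frame k) (cls q (dual_coeff k i) \<^bold>* (V \<^bold>+ W)) =
      tens1 n (cls q (dif_coeff k i) \<^bold>* frame k) (cls q (dual_coeff k i) \<^bold>* V) \<otimes>\<^bsub>T1 n\<^esub>
      tens1 n (cls q (dif_coeff k i) \<^bold>* frame k) (cls q (dual_coeff k i) \<^bold>* W)"
      using assms collapse_summand(1)[OF assms(1,2)] collapse_summand(1)[OF assms(1,3)]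
        frame_sphere_forms[OF assms(1) dual_coeff_coord(2)[OF assms(1)]]
      by (simp add: r_distr charged.tens_add_right)
  qed
  also have "\<dots> = collapse k n V \<otimes>\<^bsub>T1 n\<^esub> collapse k n W"
    unfolding collapse_def
    by (rule sum3_mult) (use assms in \<open>auto intro: charged.comm_group_tensor collapse_summand(2)\<close>)
  finally show ?thesis .
qed

lemma collapse_zero: "k = 2 \<or> k = - 2 \<Longrightarrow> collapse k n \<zero>\<^bsub>Forms q\<^esub> = \<one>\<^bsub>T1 n\<^esub>"
  using collapse_add[of k "\<zero>\<^bsub>Forms q\<^esub>" n "\<zero>\<^bsub>Forms q\<^esub>"] collapse_closed[of k "\<zero>\<^bsub>Forms q\<^esub>" n] coord_zero
  by simp

text \<open>The scalar arises when \<open>frame k\<close> passes the sections v_i W, all of degree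
  n; afterwards \<Sum> u_i v_i = 1 applies.\<close>

lemma tensor_mult_collapse:
  assumes "k = 2 \<or> k = - 2" "W \<in> coord q (n + k)"
  shows "tensor_mult (Forms q) (collapse k n W) = scal (q powi n) \<^bold>* (W \<^bold>* frame k)"
proof -
  let ?u = "\<lambda>i. cls q (dif_coeff k i)" and ?v = "\<lambda>i. cls q (dual_coeff k i)"
  have "tensor_mult (Forms q) (collapse k n W)
      = form_sum3 (\<lambda>i. tensor_mult (Forms q) (tens1 n (?u i \<^bold>* frame k) (?v i \<^bold>* W)))"
    unfolding collapse_def form_sum3_eq
    by (rule sum3_hom[OF charged.tensor_mult_hom charged.comm_group_tensor]) (intro collapse_summand(2) assms)
  also have "\<dots> = form_sum3 (\<lambda>i. ?u i \<^bold>* ?v i \<^bold>* (scal (q powi n) \<^bold>* (W \<^bold>* frame k)))"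
  proof (rule form_sum3_cong)
    fix i :: nat assume i: "i < 3"
    have "tensor_mult (Forms q) (tens1 n (?u i \<^bold>* frame k) (?v i \<^bold>* W)) = ?u i \<^bold>* frame k \<^bold>* (?v i \<^bold>* W)"
      using dual_coeff_coord[OF assms(1) i] collapse_summand(1)[OF assms i] assms(1)
      by (intro charged.tensor_mult_tens frame_sphere_forms)
    also have "\<dots> = ?u i \<^bold>* (frame k \<^bold>* (?v i \<^bold>* W))"
      using assms by (simp add: m_assoc)
    also have "\<dots> = ?u i \<^bold>* (scal (q powi n) \<^bold>* (?v i \<^bold>* W \<^bold>* frame k))"
      by (simp only: frame_commute[OF collapse_summand(1)[OF assms i]])
    also have "\<dots> = ?u i \<^bold>* (scal (q powi n) \<^bold>* ?v i \<^bold>* (W \<^bold>* frame k))"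
      using assms by (simp add: m_assoc)
    also have "scal (q powi n) \<^bold>* ?v i = ?v i \<^bold>* scal (q powi n)"
      by (simp add: scal_commute)
    finally show "tensor_mult (Forms q) (tens1 n (?u i \<^bold>* frame k) (?v i \<^bold>* W))
        = ?u i \<^bold>* ?v i \<^bold>* (scal (q powi n) \<^bold>* (W \<^bold>* frame k))"
      using assms by (simp add: m_assoc)
  qed
  also have "\<dots> = scal (q powi n) \<^bold>* (W \<^bold>* frame k)"
    using assms by (simp add: form_sum3_distrib_right sum3_dif_dual)
  finally show ?thesis .
qed

text \<open>With \<open>tensor_mult_collapse\<close> and \<open>forms_independent\<close> this makes
  multiplication injective. The degree is written \<open>n + - 2\<close> as the instance k = -2 of n
  + k.\<close>

lemma T1_normal_form:
  assumes "t \<in> carrier (T1 n)"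
  shows "\<exists>V\<in>coord q (n + 2). \<exists>W\<in>coord q (n + - 2).
    t = collapse 2 n V \<otimes>\<^bsub>T1 n\<^esub> collapse (- 2) n W"
  using assms
proof (induction rule: charged.tensor_induct)
  case zero
  show ?case
    by (intro bexI[OF _ coord_zero]) (simp add: collapse_zero)
next
  case (tens \<tau> V)
  obtain F H where FH: "F \<in> coord q 2" "H \<in> coord q (- 2)" "\<tau> = F \<^bold>* e_minus q \<^bold>+ H \<^bold>* e_plus q"
    using tens unfolding sphere_forms_1 by (elim one_formsE)
  then have "tens1 n \<tau> V = tens1 n (F \<^bold>* frame 2) V \<otimes>\<^bsub>T1 n\<^esub> tens1 n (H \<^bold>* frame (- 2)) V"
    using tens frame_sphere_forms[of 2 F] frame_sphere_forms[of "- 2" H]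
    by (simp add: charged.tens_add_left)
  also have "\<dots> = collapse 2 n (F \<^bold>* V) \<otimes>\<^bsub>T1 n\<^esub> collapse (- 2) n (H \<^bold>* V)"
    using FH tens by (simp only: tens1_eq_collapse simp_thms)
  finally show ?case
    using FH tens by (intro bexI) (auto intro: coord_mult)
next
  case (add t t')
  then obtain V W V' W' where "V \<in> coord q (n + 2)" "W \<in> coord q (n + - 2)"
    "t = collapse 2 n V \<otimes>\<^bsub>T1 n\<^esub> collapse (- 2) n W" "V' \<in> coord q (n + 2)" "W' \<in> coord q (n + - 2)"
    "t' = collapse 2 n V' \<otimes>\<^bsub>T1 n\<^esub> collapse (- 2) n W'"
    by blast
  then show ?case
    by (intro bexI[of _ "V \<^bold>+ V'"] bexI[of _ "W \<^bold>+ W'"])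
      (simp_all add: collapse_add collapse_closed coord_add charged.tensors.m_ac)
qed

lemma scal_cancel:
  assumes "V \<in> carrier (Forms q)" "n + m = 0"
  shows "scal (q powi n) \<^bold>* (scal (q powi m) \<^bold>* V) = V"
proof -
  have "q powi n * q powi m = 1"
    using q assms(2) by (simp flip: power_int_add)
  then show ?thesis
    using assms(1) by (elim FormsE) (simp flip: cls_mult scalar_mult mult.assoc)
qed

lemma coord_scal_mult: "V \<in> coord q n \<Longrightarrow> scal z \<^bold>* V \<in> coord q n"
  using coord_mult[OF coord_scal, of V n n z] by simp

lemma monopole_D_eq:
  assumes "V \<in> coord q n" "F \<in> coord q (n + 2)" "H \<in> coord q (n + - 2)"
    and "dif q V = F \<^bold>* e_minus q \<^bold>+ H \<^bold>* e_plus q \<^bold>+ scal (q_bracket q n) \<^bold>* (V \<^bold>* e_zero q)"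
  shows "monopole_D q n V = F \<^bold>* e_minus q \<^bold>+ H \<^bold>* e_plus q"
proof -
  have "V \<^bold>* monopole_form q n = scal (q_bracket q n) \<^bold>* (V \<^bold>* e_zero q)"
    using assms(1) scal_commute[of V "q_bracket q n"]
    by (simp add: monopole_form_def cls_mult flip: m_assoc)
  then show ?thesis
    using assms by (simp add: monopole_D_def a_minus_def a_assoc r_neg)
qed

text \<open>The factor q^(-n) compensates the q^n that multiplication produces.\<close>

lemma monopole_D_tensor_eq:
  assumes "V \<in> coord q n" "F \<in> coord q (n + 2)" "H \<in> coord q (n + - 2)"
    and "dif q V = F \<^bold>* e_minus q \<^bold>+ H \<^bold>* e_plus q \<^bold>+ scal (q_bracket q n) \<^bold>* (V \<^bold>* e_zero q)"
  shows "monopole_D_tensor q n V =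
    collapse 2 n (scal (q powi (- n)) \<^bold>* F) \<otimes>\<^bsub>T1 n\<^esub> collapse (- 2) n (scal (q powi (- n)) \<^bold>* H)"
  unfolding monopole_D_tensor_def monopole_D_eq[OF assms]
proof (rule the_equality)
  let ?s = "\<lambda>V. scal (q powi (- n)) \<^bold>* V"
  have mult: "tensor_mult (Forms q) (collapse 2 n V \<otimes>\<^bsub>T1 n\<^esub> collapse (- 2) n W)
      = scal (q powi n) \<^bold>* V \<^bold>* e_minus q \<^bold>+ scal (q powi n) \<^bold>* W \<^bold>* e_plus q"
    if "V \<in> coord q (n + 2)" "W \<in> coord q (n + - 2)" for V W
    using that by (simp add: charged.tensor_mult_add collapse_closed tensor_mult_collapse m_assoc)
  show "collapse 2 n (?s F) \<otimes>\<^bsub>T1 n\<^esub> collapse (- 2) n (?s H) \<in> carrier (T1 n) \<and>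
    tensor_mult (Forms q) (collapse 2 n (?s F) \<otimes>\<^bsub>T1 n\<^esub> collapse (- 2) n (?s H)) =
    F \<^bold>* e_minus q \<^bold>+ H \<^bold>* e_plus q"
    using assms(2,3)
    by (simp add: mult coord_scal_mult collapse_closed scal_cancel del: add_uminus_conv_diff)
  \<comment> \<open>Uniqueness: the product of any candidate in normal form determines its two
    coefficients.\<close>
  fix t
  assume t: "t \<in> carrier (T1 n) \<and> tensor_mult (Forms q) t = F \<^bold>* e_minus q \<^bold>+ H \<^bold>* e_plus q"
  obtain V W where VW: "V \<in> coord q (n + 2)" "W \<in> coord q (n + - 2)"
    "t = collapse 2 n V \<otimes>\<^bsub>T1 n\<^esub> collapse (- 2) n W"
    using T1_normal_form[OF conjunct1[OF t]] by (elim bexE)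
  have "scal (q powi n) \<^bold>* V \<^bold>* e_minus q \<^bold>+ scal (q powi n) \<^bold>* W \<^bold>* e_plus q = F \<^bold>* e_minus q \<^bold>+ H \<^bold>* e_plus q"
    using mult[OF VW(1,2)] conjunct2[OF t] unfolding VW(3) by (rule trans[OF sym])
  from forms_independent[OF coord_scal_mult[OF VW(1)] assms(2) coord_scal_mult[OF VW(2)] assms(3) this]
  have "scal (q powi n) \<^bold>* V = F" "scal (q powi n) \<^bold>* W = H" .
  then have "?s F = V" "?s H = W"
    using scal_cancel[of V "- n" n] scal_cancel[of W "- n" n] VW(1,2) by auto
  then show "t = collapse 2 n (?s F) \<otimes>\<^bsub>T1 n\<^esub> collapse (- 2) n (?s H)"
    by (simp only: VW(3))
qed

section \<open>Tensors of two one-forms\<close>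

abbreviation "frame_tensor k l W \<equiv> frame_right q (frame l) (collapse k l W)"

lemma frame_right_balanced:
  assumes "k = 2 \<or> k = - 2"
  shows "balanced (Forms q) (sphere q) (sphere_forms q 1) (coord q k) (T11 q)
    (\<lambda>(\<tau>, \<rho>). tens11 q \<tau> (\<rho> \<^bold>* frame k))"
proof -
  note frame_sphere_forms[OF assms]
  moreover have "(\<rho> \<^bold>+ \<rho>') \<^bold>* frame k = \<rho> \<^bold>* frame k \<^bold>+ \<rho>' \<^bold>* frame k"
    if "\<rho> \<in> coord q k" "\<rho>' \<in> coord q k" for \<rho> \<rho>'
    using that by (simp add: l_distr)
  moreover have "b \<^bold>* \<rho> \<^bold>* frame k = b \<^bold>* (\<rho> \<^bold>* frame k)" if "b \<in> sphere q" "\<rho> \<in> coord q k" for b \<rho>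
    using that by (simp add: m_assoc)
  ultimately show ?thesis
    unfolding balanced_def
    by (auto simp: sphere.tens_add_left sphere.tens_add_right sphere.tens_balance intro!: sphere.tens_closed)
qed

lemma frame_right_hom: "k = 2 \<or> k = - 2 \<Longrightarrow> frame_right q (frame k) \<in> hom (T1 k) (T11 q)"
  unfolding frame_right_def
  by (intro charged.tensor_lift_hom sphere.comm_group_tensor frame_right_balanced)

lemma frame_right_tens:
  "\<lbrakk>k = 2 \<or> k = - 2; \<tau> \<in> sphere_forms q 1; \<rho> \<in> coord q k\<rbrakk> \<Longrightarrow>
    frame_right q (frame k) (tens1 k \<tau> \<rho>) = tens11 q \<tau> (\<rho> \<^bold>* frame k)"
  unfolding frame_right_def
  by (simp add: charged.tensor_lift_tens[OF sphere.comm_group_tensor frame_right_balanced])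

lemma lact_balanced:
  assumes "m \<in> sphere q"
  shows "balanced (Forms q) (sphere q) (sphere_forms q 1) (sphere_forms q 1) (T11 q)
    (\<lambda>(x, y). tens11 q (m \<^bold>* x) y)"
proof -
  have "m \<^bold>* x \<in> sphere_forms q 1" if "x \<in> sphere_forms q 1" for x
    using that assms by (intro sphere.left_action)
  moreover have "m \<^bold>* (x \<^bold>+ x') = m \<^bold>* x \<^bold>+ m \<^bold>* x'"
    if "x \<in> sphere_forms q 1" "x' \<in> sphere_forms q 1" for x x'
    using that assms by (simp add: r_distr sphere_forms_closed(1))
  moreover have "m \<^bold>* (x \<^bold>* b) = m \<^bold>* x \<^bold>* b" if "b \<in> sphere q" "x \<in> sphere_forms q 1" for b x
    using that assms by (simp add: m_assoc sphere_forms_closed(1))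
  ultimately show ?thesis
    unfolding balanced_def
    by (auto simp: sphere.tens_add_left sphere.tens_add_right sphere.tens_balance intro!: sphere.tens_closed)
qed

lemma lact_hom: "m \<in> sphere q \<Longrightarrow> lact q m \<in> hom (T11 q) (T11 q)"
  unfolding lact_def by (intro sphere.tensor_lift_hom sphere.comm_group_tensor lact_balanced)

lemma lact_tens:
  "\<lbrakk>m \<in> sphere q; x \<in> sphere_forms q 1; y \<in> sphere_forms q 1\<rbrakk> \<Longrightarrow>
    lact q m (tens11 q x y) = tens11 q (m \<^bold>* x) y"
  unfolding lact_def by (simp add: sphere.tensor_lift_tens[OF sphere.comm_group_tensor lact_balanced])

lemma sphere_forms_wedge: "\<lbrakk>\<tau> \<in> sphere_forms q 1; x \<in> sphere_forms q 1\<rbrakk> \<Longrightarrow> \<tau> \<^bold>* x \<in> sphere_forms q 2"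
  by (rule sphere_forms_closed(3)[OF _ _ one_add_one])

lemma wedge_left_balanced:
  assumes "\<tau> \<in> sphere_forms q 1"
  shows "balanced (Forms q) (sphere q) (sphere_forms q 1) (sphere_forms q 1) (T21 q)
    (\<lambda>(x, y). tens21 q (\<tau> \<^bold>* x) y)"
proof -
  note sphere_forms_wedge[OF assms]
  moreover have "\<tau> \<^bold>* (x \<^bold>+ x') = \<tau> \<^bold>* x \<^bold>+ \<tau> \<^bold>* x'"
    if "x \<in> sphere_forms q 1" "x' \<in> sphere_forms q 1" for x x'
    using that assms by (simp add: r_distr sphere_forms_closed(1))
  moreover have "\<tau> \<^bold>* (x \<^bold>* b) = \<tau> \<^bold>* x \<^bold>* b" if "b \<in> sphere q" "x \<in> sphere_forms q 1" for b x
    using that assms by (simp add: m_assoc sphere_forms_closed(1))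
  ultimately show ?thesis
    unfolding balanced_def
    by (auto simp: sphere.tens_add_left sphere.tens_add_right sphere.tens_balance intro!: sphere.tens_closed)
qed

lemma wedge_left_hom: "\<tau> \<in> sphere_forms q 1 \<Longrightarrow> wedge_left q \<tau> \<in> hom (T11 q) (T21 q)"
  unfolding wedge_left_def by (intro sphere.tensor_lift_hom sphere.comm_group_tensor wedge_left_balanced)

lemma wedge_left_tens:
  "\<lbrakk>\<tau> \<in> sphere_forms q 1; x \<in> sphere_forms q 1; y \<in> sphere_forms q 1\<rbrakk> \<Longrightarrow>
    wedge_left q \<tau> (tens11 q x y) = tens21 q (\<tau> \<^bold>* x) y"
  unfolding wedge_left_def
  by (simp add: sphere.tensor_lift_tens[OF sphere.comm_group_tensor wedge_left_balanced])

lemma frame_tensor_closed: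
  "\<lbrakk>k = 2 \<or> k = - 2; l = 2 \<or> l = - 2; W \<in> coord q (l + k)\<rbrakk> \<Longrightarrow> frame_tensor k l W \<in> carrier (T11 q)"
  by (rule hom_in_carrier[OF frame_right_hom collapse_closed])

lemma frame_tensor_add:
  "\<lbrakk>k = 2 \<or> k = - 2; l = 2 \<or> l = - 2; V \<in> coord q (l + k); W \<in> coord q (l + k)\<rbrakk> \<Longrightarrow>
    frame_tensor k l (V \<^bold>+ W) = frame_tensor k l V \<otimes>\<^bsub>T11 q\<^esub> frame_tensor k l W"
  by (simp only: collapse_add) (rule hom_mult[OF frame_right_hom]; simp add: collapse_closed)

text \<open>For fixed basis forms in the two places a tensor is described by a single coordinate
  element of degree k + l, the product of the two coefficients.\<close>

lemma tens11_frame: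
  assumes "k = 2 \<or> k = - 2" "l = 2 \<or> l = - 2" "F \<in> coord q k" "G \<in> coord q l"
  shows "tens11 q (F \<^bold>* frame k) (G \<^bold>* frame l) = frame_tensor k l (F \<^bold>* G)"
  using assms frame_right_tens[OF assms(2) frame_sphere_forms[OF assms(1,3)] assms(4)]
  by (simp add: tens1_eq_collapse)

lemma frame_tensor_expand:
  assumes "k = 2 \<or> k = - 2" "l = 2 \<or> l = - 2" "W \<in> coord q (l + k)"
  shows "frame_tensor k l W = sum3 (T11 q)
    (\<lambda>i. tens11 q (cls q (dif_coeff k i) \<^bold>* frame k) (cls q (dual_coeff k i) \<^bold>* W \<^bold>* frame l))"
proof -
  have "frame_tensor k l W = sum3 (T11 q) (\<lambda>i. frame_right q (frame l)
      (tens1 l (cls q (dif_coeff k i) \<^bold>* frame k) (cls q (dual_coeff k i) \<^bold>* W)))"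
    unfolding collapse_def
    by (rule sum3_hom[OF frame_right_hom[OF assms(2)] charged.comm_group_tensor])
      (intro collapse_summand(2) assms)
  also have "\<dots> = sum3 (T11 q)
    (\<lambda>i. tens11 q (cls q (dif_coeff k i) \<^bold>* frame k) (cls q (dual_coeff k i) \<^bold>* W \<^bold>* frame l))"
    by (intro sum3_cong frame_right_tens frame_sphere_forms dual_coeff_coord collapse_summand(1) assms)
  finally show ?thesis .
qed

text \<open>Expand into pure tensors, act on the first factors and collapse again: \<Sum> (m u_i)
  (v_i W) = m W.\<close>

lemma lact_frame_tensor:
  assumes "k = 2 \<or> k = - 2" "l = 2 \<or> l = - 2" "W \<in> coord q (l + k)" "m \<in> sphere q"
  shows "lact q m (frame_tensor k l W) = frame_tensor k l (m \<^bold>* W)"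
proof -
  let ?u = "\<lambda>i. cls q (dif_coeff k i)" and ?v = "\<lambda>i. cls q (dual_coeff k i)"
  have mem: "?u i \<^bold>* frame k \<in> sphere_forms q 1" "?v i \<^bold>* W \<^bold>* frame l \<in> sphere_forms q 1"
    "m \<^bold>* ?u i \<in> coord q k" "m \<^bold>* ?u i \<^bold>* (?v i \<^bold>* W) \<in> coord q (l + k)" if "i < 3" for i
    using assms dual_coeff_coord[OF assms(1) that] collapse_summand(1)[OF assms(1,3) that]
    by (auto intro!: frame_sphere_forms coord_mult[of m 0] coord_mult[of "m \<^bold>* _" k])
  have "lact q m (frame_tensor k l W) = sum3 (T11 q) (\<lambda>i. lact q m (tens11 q (?u i \<^bold>* frame k) (?v i \<^bold>* W \<^bold>* frame l)))"
    unfolding frame_tensor_expand[OF assms(1-3)]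
    by (rule sum3_hom[OF lact_hom[OF assms(4)] sphere.comm_group_tensor]) (intro sphere.tens_closed mem)
  also have "\<dots> = sum3 (T11 q) (\<lambda>i. frame_tensor k l (m \<^bold>* ?u i \<^bold>* (?v i \<^bold>* W)))"
  proof (rule sum3_cong)
    fix i :: nat assume i: "i < 3"
    have "m \<^bold>* (?u i \<^bold>* frame k) = m \<^bold>* ?u i \<^bold>* frame k"
      using assms(4) by (simp add: m_assoc)
    then show "lact q m (tens11 q (?u i \<^bold>* frame k) (?v i \<^bold>* W \<^bold>* frame l)) = frame_tensor k l (m \<^bold>* ?u i \<^bold>* (?v i \<^bold>* W))"
      using lact_tens[OF assms(4) mem(1,2)[OF i]]
        tens11_frame[OF assms(1,2) mem(3)[OF i] collapse_summand(1)[OF assms(1,3) i]] by simp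
  qed
  also have "\<dots> = frame_tensor k l (form_sum3 (\<lambda>i. m \<^bold>* ?u i \<^bold>* (?v i \<^bold>* W)))"
    using mem(4)[of 0] mem(4)[of 1] mem(4)[of 2] assms(1,2)
    by (simp add: form_sum3_def sum3_def frame_tensor_add coord_add)
  also have "form_sum3 (\<lambda>i. m \<^bold>* ?u i \<^bold>* (?v i \<^bold>* W)) = form_sum3 (\<lambda>i. m \<^bold>* (?u i \<^bold>* ?v i \<^bold>* W))"
    using assms by (intro form_sum3_cong) (simp add: m_assoc)
  also have "\<dots> = m \<^bold>* W"
    using assms by (simp add: form_sum3_distrib_left form_sum3_distrib_right sum3_dif_dual)
  finally show ?thesis .
qed

lemma tensor_mult_frame_right:
  assumes "k = 2 \<or> k = - 2" "t \<in> carrier (T1 k)"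
  shows "tensor_mult (Forms q) (frame_right q (frame k) t) = tensor_mult (Forms q) t \<^bold>* frame k"
  using assms(2)
proof (induction rule: charged.tensor_induct)
  case zero
  show ?case
    using hom_one[OF frame_right_hom[OF assms(1)]]
    by (simp add: charged.tensors.is_group sphere.tensors.is_group charged.tensor_mult_zero sphere.tensor_mult_zero)
next
  case (tens \<tau> \<rho>)
  then show ?case
    using frame_sphere_forms[OF assms(1)]
    by (simp add: frame_right_tens[OF assms(1)] charged.tensor_mult_tens sphere.tensor_mult_tens m_assoc
        sphere_forms_closed(1))
next
  case (add t t')
  then show ?case
    using hom_mult[OF frame_right_hom[OF assms(1)]] hom_in_carrier[OF frame_right_hom[OF assms(1)]]
    by (simp add: charged.tensor_mult_add sphere.tensor_mult_add charged.tensor_mult_closed l_distr)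
qed

lemma tensor_mult_frame_tensor:
  assumes "k = 2 \<or> k = - 2" "l = 2 \<or> l = - 2" "W \<in> coord q (l + k)"
  shows "tensor_mult (Forms q) (frame_tensor k l W) = scal (q powi l) \<^bold>* (W \<^bold>* (frame k \<^bold>* frame l))"
  using assms by (simp add: tensor_mult_frame_right collapse_closed tensor_mult_collapse m_assoc)

lemma tensor_mult_lact:
  assumes "m \<in> sphere q" "t \<in> carrier (T11 q)"
  shows "tensor_mult (Forms q) (lact q m t) = m \<^bold>* tensor_mult (Forms q) t"
  using assms(2)
proof (induction rule: sphere.tensor_induct)
  case zero
  show ?case
    using hom_one[OF lact_hom[OF assms(1)]] assms(1)
    by (simp add: sphere.tensors.is_group sphere.tensor_mult_zero)
next
  case (tens x y)
  then show ?case
    using assms(1) sphere.left_action[OF assms(1) tens(1)]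
    by (simp add: lact_tens sphere.tensor_mult_tens m_assoc sphere_forms_closed(1))
next
  case (add t t')
  then show ?case
    using hom_mult[OF lact_hom[OF assms(1)]] hom_in_carrier[OF lact_hom[OF assms(1)]] assms(1)
    by (simp add: sphere.tensor_mult_add sphere.tensor_mult_closed r_distr)
qed

text \<open>Serves the second term of the cotorsion: as \<nabla> db_j = c_j g, the function c_j
  moves into the form on the left, and the three summands acquire the common second argument
  g.\<close>

lemma wedge_left_lact:
  assumes "\<tau> \<in> sphere_forms q 1" "m \<in> sphere q" "t \<in> carrier (T11 q)"
  shows "wedge_left q \<tau> (lact q m t) = wedge_left q (\<tau> \<^bold>* m) t"
  using assms(3)
proof (induction rule: sphere.tensor_induct)
  case zero
  have "\<tau> \<^bold>* m \<in> sphere_forms q 1"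
    using assms by (intro sphere.right_action)
  then show ?case
    using hom_one[OF lact_hom[OF assms(2)]] hom_one[OF wedge_left_hom] assms(1)
    by (simp add: sphere.tensors.is_group)
next
  case (tens x y)
  have "\<tau> \<^bold>* m \<in> sphere_forms q 1" "m \<^bold>* x \<in> sphere_forms q 1"
    using assms tens by (auto intro: sphere.right_action sphere.left_action)
  then show ?case
    using assms tens by (simp add: lact_tens wedge_left_tens m_assoc sphere_forms_closed(1))
next
  case (add t t')
  have "\<tau> \<^bold>* m \<in> sphere_forms q 1"
    using assms by (intro sphere.right_action)
  with add show ?case
    using hom_mult[OF lact_hom[OF assms(2)]] hom_in_carrier[OF lact_hom[OF assms(2)]] hom_mult[OF wedge_left_hom]
      assms(1) by simp
qed

lemma wedge_left_add:
  assumes "\<tau> \<in> sphere_forms q 1" "\<tau>' \<in> sphere_forms q 1" "t \<in> carrier (T11 q)"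
  shows "wedge_left q (\<tau> \<^bold>+ \<tau>') t = wedge_left q \<tau> t \<otimes>\<^bsub>T21 q\<^esub> wedge_left q \<tau>' t"
  using assms(3)
proof (induction rule: sphere.tensor_induct)
  case zero
  have "\<tau> \<^bold>+ \<tau>' \<in> sphere_forms q 1"
    using assms by (intro sphere_forms_closed)
  then show ?case
    using hom_one[OF wedge_left_hom] assms by (simp add: sphere.tensors.is_group)
next
  case (tens x y)
  have "\<tau> \<^bold>+ \<tau>' \<in> sphere_forms q 1"
    using assms by (intro sphere_forms_closed)
  then show ?case
    using assms tens
    by (simp add: wedge_left_tens l_distr sphere_forms_closed(1) sphere.tens_add_left sphere_forms_wedge)
next
  case (add t t')
  have "\<tau> \<^bold>+ \<tau>' \<in> sphere_forms q 1"
    using assms by (intro sphere_forms_closed)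
  with add show ?case
    using hom_mult[OF wedge_left_hom] hom_in_carrier[OF wedge_left_hom] assms
    by (simp add: sphere.tensors.m_ac)
qed

section \<open>The covariant derivative\<close>

text \<open>The arguments are the coefficients of e^- \<otimes> e^-, e^+ \<otimes> e^-, e^-
  \<otimes> e^+ and e^+ \<otimes> e^+, of degrees 4, 0, 0, -4. The bracketing follows
  \<open>nabla\<close>, whose first summand ends in e^- and whose second ends in e^+.\<close>

definition two_tensor where
  "two_tensor A B C D =
    (frame_tensor 2 2 A \<otimes>\<^bsub>T11 q\<^esub> frame_tensor (- 2) 2 B) \<otimes>\<^bsub>T11 q\<^esub> (frame_tensor 2 (- 2) C \<otimes>\<^bsub>T11 q\<^esub> frame_tensor (- 2) (- 2) D)"

text \<open>Given \<open>df = F e\<^sup>- + H e\<^sup>+ + \<dots>\<close> and \<open>dh = F' e\<^sup>- + H' e\<^sup>+ + \<dots>\<close>, this is \<open>\<nabla>(f e\<^sup>- + h e\<^sup>+)\<close>; the scalars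
  come from moving \<open>e\<^sup>\<plusminus>\<close> past sections of degree \<open>\<plusminus>2\<close>.\<close>

definition nabla_value where
  "nabla_value F H F' H' = two_tensor (scal (q powi (- 2)) \<^bold>* F) (scal (q powi (- 2)) \<^bold>* H)
    (scal (q powi 2) \<^bold>* F') (scal (q powi 2) \<^bold>* H')"

text \<open>As a relation it can be established for explicit coefficients and combined under sums
  and products, after which \<open>nabla_eq\<close> gives the covariant derivative.\<close>

definition dif_split where
  "dif_split f h F H F' H' \<longleftrightarrow>
    f \<in> coord q 2 \<and> h \<in> coord q (- 2) \<and>
    F \<in> coord q 4 \<and> H \<in> coord q 0 \<and> F' \<in> coord q 0 \<and> H' \<in> coord q (- 4) \<and>
    dif q f = F \<^bold>* e_minus q \<^bold>+ H \<^bold>* e_plus q \<^bold>+ scal (q_bracket q 2) \<^bold>* (f \<^bold>* e_zero q) \<and>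
    dif q h = F' \<^bold>* e_minus q \<^bold>+ H' \<^bold>* e_plus q \<^bold>+ scal (q_bracket q (- 2)) \<^bold>* (h \<^bold>* e_zero q)"

lemma dif_split_exists:
  assumes "f \<in> coord q 2" "h \<in> coord q (- 2)"
  obtains F H F' H' where "dif_split f h F H F' H'"
proof -
  obtain F H where "F \<in> coord q 4" "H \<in> coord q 0"
    "dif q f = F \<^bold>* e_minus q \<^bold>+ H \<^bold>* e_plus q \<^bold>+ scal (q_bracket q 2) \<^bold>* (f \<^bold>* e_zero q)"
    using assms(1) by (rule dif_coordE) simp
  moreover obtain F' H' where "F' \<in> coord q 0" "H' \<in> coord q (- 4)"
    "dif q h = F' \<^bold>* e_minus q \<^bold>+ H' \<^bold>* e_plus q \<^bold>+ scal (q_bracket q (- 2)) \<^bold>* (h \<^bold>* e_zero q)"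
    using assms(2) by (rule dif_coordE) simp
  ultimately show thesis
    using assms that unfolding dif_split_def by blast
qed

lemma nabla_eq:
  assumes "dif_split f h F H F' H'"
  shows "nabla q (f \<^bold>* e_minus q \<^bold>+ h \<^bold>* e_plus q) = nabla_value F H F' H'"
proof -
  have *: "f \<in> coord q 2" "h \<in> coord q (- 2)" "F \<in> coord q (2 + 2)" "H \<in> coord q (2 + - 2)"
    "F' \<in> coord q (- 2 + 2)" "H' \<in> coord q (- 2 + - 2)"
    using assms by (simp_all add: dif_split_def)
  have "monopole_D_tensor q 2 f = collapse 2 2 (scal (q powi (- 2)) \<^bold>* F) \<otimes>\<^bsub>T1 2\<^esub> collapse (- 2) 2 (scal (q powi (- 2)) \<^bold>* H)"
    using assms by (intro monopole_D_tensor_eq *) (simp add: dif_split_def)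
  then have f: "frame_right q (e_minus q) (monopole_D_tensor q 2 f)
      = frame_tensor 2 2 (scal (q powi (- 2)) \<^bold>* F) \<otimes>\<^bsub>T11 q\<^esub> frame_tensor (- 2) 2 (scal (q powi (- 2)) \<^bold>* H)"
    using hom_mult[OF frame_right_hom[of 2] collapse_closed collapse_closed] * coord_scal_mult by simp
  have "monopole_D_tensor q (- 2) h = collapse 2 (- 2) (scal (q powi (- (- 2))) \<^bold>* F') \<otimes>\<^bsub>T1 (- 2)\<^esub> collapse (- 2) (- 2) (scal (q powi (- (- 2))) \<^bold>* H')"
    using assms by (intro monopole_D_tensor_eq *) (simp add: dif_split_def)
  then have h: "frame_right q (e_plus q) (monopole_D_tensor q (- 2) h)
      = frame_tensor 2 (- 2) (scal (q powi 2) \<^bold>* F') \<otimes>\<^bsub>T11 q\<^esub> frame_tensor (- 2) (- 2) (scal (q powi 2) \<^bold>* H')"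
    using hom_mult[OF frame_right_hom[of "- 2"] collapse_closed collapse_closed] * coord_scal_mult by simp
  show ?thesis
    unfolding nabla_def
  proof (rule the_equality)
    show "\<exists>f'\<in>coord q 2. \<exists>h'\<in>coord q (- 2).
       f \<^bold>* e_minus q \<^bold>+ h \<^bold>* e_plus q = f' \<^bold>* e_minus q \<^bold>+ h' \<^bold>* e_plus q \<and>
       nabla_value F H F' H' = frame_right q (e_minus q) (monopole_D_tensor q 2 f')
         \<otimes>\<^bsub>T11 q\<^esub> frame_right q (e_plus q) (monopole_D_tensor q (- 2) h')"
      using *(1,2) unfolding nabla_value_def two_tensor_def f[symmetric] h[symmetric] by blast
    \<comment> \<open>Another decomposition of the same form has the same coefficients, so there is
      no second value.\<close>
    fix t
    assume "\<exists>f'\<in>coord q 2. \<exists>h'\<in>coord q (- 2).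
       f \<^bold>* e_minus q \<^bold>+ h \<^bold>* e_plus q = f' \<^bold>* e_minus q \<^bold>+ h' \<^bold>* e_plus q \<and>
       t = frame_right q (e_minus q) (monopole_D_tensor q 2 f')
         \<otimes>\<^bsub>T11 q\<^esub> frame_right q (e_plus q) (monopole_D_tensor q (- 2) h')"
    then show "t = nabla_value F H F' H'"
      using forms_independent[OF *(1) _ *(2)] unfolding nabla_value_def two_tensor_def f[symmetric] h[symmetric] by blast
  qed
qed

lemma two_tensor_closed:
  "\<lbrakk>A \<in> coord q 4; B \<in> coord q 0; C \<in> coord q 0; D \<in> coord q (- 4)\<rbrakk> \<Longrightarrow> two_tensor A B C D \<in> carrier (T11 q)"
  unfolding two_tensor_def by (intro sphere.tensors.m_closed frame_tensor_closed) simp_all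

lemma two_tensor_add:
  assumes "A \<in> coord q 4" "B \<in> coord q 0" "C \<in> coord q 0" "D \<in> coord q (- 4)"
    "A' \<in> coord q 4" "B' \<in> coord q 0" "C' \<in> coord q 0" "D' \<in> coord q (- 4)"
  shows "two_tensor (A \<^bold>+ A') (B \<^bold>+ B') (C \<^bold>+ C') (D \<^bold>+ D') = two_tensor A B C D \<otimes>\<^bsub>T11 q\<^esub> two_tensor A' B' C' D'"
  using assms by (simp add: two_tensor_def frame_tensor_add frame_tensor_closed sphere.tensors.m_ac del: frame_simps)

lemma lact_two_tensor:
  assumes "m \<in> sphere q" "A \<in> coord q 4" "B \<in> coord q 0" "C \<in> coord q 0" "D \<in> coord q (- 4)"
  shows "lact q m (two_tensor A B C D) = two_tensor (m \<^bold>* A) (m \<^bold>* B) (m \<^bold>* C) (m \<^bold>* D)"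
  using assms hom_mult[OF lact_hom[OF assms(1)]]
  by (simp add: two_tensor_def frame_tensor_closed lact_frame_tensor del: frame_simps)

lemma tensor_mult_two_tensor:
  assumes "A \<in> coord q 4" "B \<in> coord q 0" "C \<in> coord q 0" "D \<in> coord q (- 4)"
  shows "tensor_mult (Forms q) (two_tensor A B C D) =
    (scal (q powi 2) \<^bold>* (A \<^bold>* (e_minus q \<^bold>* e_minus q)) \<^bold>+ scal (q powi 2) \<^bold>* (B \<^bold>* (e_plus q \<^bold>* e_minus q))) \<^bold>+
    (scal (q powi (- 2)) \<^bold>* (C \<^bold>* (e_minus q \<^bold>* e_plus q)) \<^bold>+ scal (q powi (- 2)) \<^bold>* (D \<^bold>* (e_plus q \<^bold>* e_plus q)))"
  using assms by (simp add: two_tensor_def frame_tensor_closed sphere.tensor_mult_add tensor_mult_frame_tensor del: frame_simps) simp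

lemma tens11_forms:
  assumes "F \<in> coord q 2" "H \<in> coord q (- 2)" "F' \<in> coord q 2" "H' \<in> coord q (- 2)"
  shows "tens11 q (F \<^bold>* e_minus q \<^bold>+ H \<^bold>* e_plus q) (F' \<^bold>* e_minus q \<^bold>+ H' \<^bold>* e_plus q)
    = two_tensor (F \<^bold>* F') (H \<^bold>* F') (F \<^bold>* H') (H \<^bold>* H')"
proof -
  have mem: "F \<^bold>* frame 2 \<in> sphere_forms q 1" "H \<^bold>* frame (- 2) \<in> sphere_forms q 1"
    "F' \<^bold>* frame 2 \<in> sphere_forms q 1" "H' \<^bold>* frame (- 2) \<in> sphere_forms q 1"
    by (rule frame_sphere_forms; simp add: assms)+
  then have sum: "F' \<^bold>* frame 2 \<^bold>+ H' \<^bold>* frame (- 2) \<in> sphere_forms q 1"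
    by (intro sphere_forms_closed(2))
  have coord: "F \<^bold>* F' \<in> coord q 4" "H \<^bold>* F' \<in> coord q 0" "F \<^bold>* H' \<in> coord q 0" "H \<^bold>* H' \<in> coord q (- 4)"
    by (rule coord_mult[OF assms(1,3)] coord_mult[OF assms(2,3)] coord_mult[OF assms(1,4)] coord_mult[OF assms(2,4)]; simp)+
  have "tens11 q (F \<^bold>* frame 2 \<^bold>+ H \<^bold>* frame (- 2)) (F' \<^bold>* frame 2 \<^bold>+ H' \<^bold>* frame (- 2))
    = two_tensor (F \<^bold>* F') (H \<^bold>* F') (F \<^bold>* H') (H \<^bold>* H')"
    using mem sum coord assms
    by (simp add: two_tensor_def tens11_frame sphere.tens_add_left sphere.tens_add_right frame_tensor_closed
        sphere.tensors.m_ac del: frame_simps)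
  then show ?thesis
    by simp
qed

lemma scal_left_commute:
  "\<lbrakk>V \<in> carrier (Forms q); W \<in> carrier (Forms q)\<rbrakk> \<Longrightarrow> V \<^bold>* (scal z \<^bold>* W) = scal z \<^bold>* (V \<^bold>* W)"
  using scal_commute[of V z] by (simp flip: m_assoc)

section \<open>Additivity and the Leibniz rule\<close>

lemma dif_splitD:
  assumes "dif_split f h F H F' H'"
  shows "f \<in> coord q 2" "h \<in> coord q (- 2)" "F \<in> coord q 4" "H \<in> coord q 0" "F' \<in> coord q 0" "H' \<in> coord q (- 4)"
    "dif q f = F \<^bold>* e_minus q \<^bold>+ H \<^bold>* e_plus q \<^bold>+ scal (q_bracket q 2) \<^bold>* (f \<^bold>* e_zero q)"
    "dif q h = F' \<^bold>* e_minus q \<^bold>+ H' \<^bold>* e_plus q \<^bold>+ scal (q_bracket q (- 2)) \<^bold>* (h \<^bold>* e_zero q)"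
  using assms by (simp_all add: dif_split_def)

lemma dif_split_add:
  assumes "dif_split f h F H F' H'" "dif_split f2 h2 F2 H2 F2' H2'"
  shows "dif_split (f \<^bold>+ f2) (h \<^bold>+ h2) (F \<^bold>+ F2) (H \<^bold>+ H2) (F' \<^bold>+ F2') (H' \<^bold>+ H2')"
  using dif_splitD[OF assms(1)] dif_splitD[OF assms(2)] unfolding dif_split_def
  by (simp add: coord_add dif_add l_distr r_distr a_ac)

text \<open>In dm f the forms e^- and e^+ pass f of degree 2, in dm h they pass h of degree -2; this
  is the origin of q^2 and q^(-2).\<close>

lemma dif_split_mult:
  assumes "m \<in> sphere q" "x \<in> coord q 2" "y \<in> coord q (- 2)"
    and m: "dif q m = x \<^bold>* e_minus q \<^bold>+ y \<^bold>* e_plus q"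
    and split: "dif_split f h F H F' H'"
  shows "dif_split (m \<^bold>* f) (m \<^bold>* h)
    (scal (q powi 2) \<^bold>* (x \<^bold>* f) \<^bold>+ m \<^bold>* F) (scal (q powi 2) \<^bold>* (y \<^bold>* f) \<^bold>+ m \<^bold>* H)
    (scal (q powi (- 2)) \<^bold>* (x \<^bold>* h) \<^bold>+ m \<^bold>* F') (scal (q powi (- 2)) \<^bold>* (y \<^bold>* h) \<^bold>+ m \<^bold>* H')"
proof -
  note * = dif_splitD[OF split]
  have mem: "m \<^bold>* f \<in> coord q 2" "m \<^bold>* h \<in> coord q (- 2)" "x \<^bold>* f \<in> coord q 4" "y \<^bold>* f \<in> coord q 0"
    "x \<^bold>* h \<in> coord q 0" "y \<^bold>* h \<in> coord q (- 4)" "m \<^bold>* F \<in> coord q 4" "m \<^bold>* H \<in> coord q 0"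
    "m \<^bold>* F' \<in> coord q 0" "m \<^bold>* H' \<in> coord q (- 4)"
    using assms(1-3) * by (auto intro: coord_mult)
  have f: "e_minus q \<^bold>* f = scal (q powi 2) \<^bold>* (f \<^bold>* e_minus q)" "e_plus q \<^bold>* f = scal (q powi 2) \<^bold>* (f \<^bold>* e_plus q)"
    and h: "e_minus q \<^bold>* h = scal (q powi (- 2)) \<^bold>* (h \<^bold>* e_minus q)" "e_plus q \<^bold>* h = scal (q powi (- 2)) \<^bold>* (h \<^bold>* e_plus q)"
    using frame_commute[OF *(1), of 2] frame_commute[OF *(1), of "- 2"]
      frame_commute[OF *(2), of 2] frame_commute[OF *(2), of "- 2"] by simp_all
  have "dif q (m \<^bold>* f) = dif q m \<^bold>* f \<^bold>+ m \<^bold>* dif q f" "dif q (m \<^bold>* h) = dif q m \<^bold>* h \<^bold>+ m \<^bold>* dif q h"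
    using dif_coord_mult[OF assms(1)] * by auto
  with * assms(1-3) show ?thesis
    unfolding dif_split_def m
    by (simp add: mem coord_add coord_scal_mult l_distr r_distr m_assoc f h scal_left_commute a_ac)
qed

lemma nabla_value_closed:
  assumes "dif_split f h F H F' H'"
  shows "nabla_value F H F' H' \<in> carrier (T11 q)"
  using assms unfolding nabla_value_def dif_split_def by (intro two_tensor_closed coord_scal_mult) simp_all

lemma sphere_forms_splitE:
  assumes "\<tau> \<in> sphere_forms q 1"
  obtains f h F H F' H' where "\<tau> = f \<^bold>* e_minus q \<^bold>+ h \<^bold>* e_plus q" "dif_split f h F H F' H'"
    "nabla q \<tau> = nabla_value F H F' H'"
  using assms unfolding sphere_forms_1
  by (elim one_formsE) (metis dif_split_exists nabla_eq)

lemma nabla_closed: "\<tau> \<in> sphere_forms q 1 \<Longrightarrow> nabla q \<tau> \<in> carrier (T11 q)"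
  by (elim sphere_forms_splitE) (simp add: nabla_value_closed)

lemma nabla_add:
  assumes "\<tau> \<in> sphere_forms q 1" "\<eta> \<in> sphere_forms q 1"
  shows "nabla q (\<tau> \<^bold>+ \<eta>) = nabla q \<tau> \<otimes>\<^bsub>T11 q\<^esub> nabla q \<eta>"
proof -
  obtain f h F H F' H' where 1: "\<tau> = f \<^bold>* e_minus q \<^bold>+ h \<^bold>* e_plus q" "dif_split f h F H F' H'"
    "nabla q \<tau> = nabla_value F H F' H'"
    using assms(1) by (rule sphere_forms_splitE)
  obtain f2 h2 F2 H2 F2' H2' where 2: "\<eta> = f2 \<^bold>* e_minus q \<^bold>+ h2 \<^bold>* e_plus q" "dif_split f2 h2 F2 H2 F2' H2'"
    "nabla q \<eta> = nabla_value F2 H2 F2' H2'"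
    using assms(2) by (rule sphere_forms_splitE)
  have "\<tau> \<^bold>+ \<eta> = (f \<^bold>+ f2) \<^bold>* e_minus q \<^bold>+ (h \<^bold>+ h2) \<^bold>* e_plus q"
    using dif_splitD(1,2)[OF 1(2)] dif_splitD(1,2)[OF 2(2)] by (simp add: 1(1) 2(1) l_distr a_ac)
  then have "nabla q (\<tau> \<^bold>+ \<eta>) = nabla_value (F \<^bold>+ F2) (H \<^bold>+ H2) (F' \<^bold>+ F2') (H' \<^bold>+ H2')"
    by (simp add: nabla_eq[OF dif_split_add[OF 1(2) 2(2)]])
  also have "\<dots> = nabla_value F H F' H' \<otimes>\<^bsub>T11 q\<^esub> nabla_value F2 H2 F2' H2'"
    using dif_splitD(1-6)[OF 1(2)] dif_splitD(1-6)[OF 2(2)]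
    by (simp add: nabla_value_def r_distr two_tensor_add coord_scal_mult)
  finally show ?thesis
    by (simp add: 1(3) 2(3))
qed

lemma nabla_leibniz:
  assumes "m \<in> sphere q" "\<tau> \<in> sphere_forms q 1"
  shows "nabla q (m \<^bold>* \<tau>) = tens11 q (dif q m) \<tau> \<otimes>\<^bsub>T11 q\<^esub> lact q m (nabla q \<tau>)"
proof -
  obtain f h F H F' H' where 1: "\<tau> = f \<^bold>* e_minus q \<^bold>+ h \<^bold>* e_plus q" "dif_split f h F H F' H'"
    "nabla q \<tau> = nabla_value F H F' H'"
    using assms(2) by (rule sphere_forms_splitE)
  obtain x y where xy: "x \<in> coord q 2" "y \<in> coord q (- 2)" "dif q m = x \<^bold>* e_minus q \<^bold>+ y \<^bold>* e_plus q"
    using dif_sphere[OF assms(1)] by (rule one_formsE)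
  note * = dif_splitD(1-6)[OF 1(2)]
  have mem: "x \<^bold>* f \<in> coord q 4" "y \<^bold>* f \<in> coord q 0"
    "x \<^bold>* h \<in> coord q 0" "y \<^bold>* h \<in> coord q (- 4)" "m \<^bold>* F \<in> coord q 4" "m \<^bold>* H \<in> coord q 0"
    "m \<^bold>* F' \<in> coord q 0" "m \<^bold>* H' \<in> coord q (- 4)"
    using assms(1) xy * by (auto intro: coord_mult)
  \<comment> \<open>The scalars of \<open>dif_split_mult\<close> are inverse to those in
    \<open>nabla_value\<close>, so dm \<otimes> \<tau> appears with coefficient one.\<close>
  have cancel: "scal (q powi k) \<^bold>* (scal (q powi - k) \<^bold>* V \<^bold>+ m \<^bold>* W) = V \<^bold>+ m \<^bold>* (scal (q powi k) \<^bold>* W)"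
    if "V \<in> carrier (Forms q)" "W \<in> carrier (Forms q)" for V W k
    using that assms(1) by (simp add: r_distr scal_cancel scal_left_commute[of m])
  have "m \<^bold>* \<tau> = m \<^bold>* f \<^bold>* e_minus q \<^bold>+ m \<^bold>* h \<^bold>* e_plus q"
    using assms(1) * by (simp add: 1(1) r_distr m_assoc)
  then have "nabla q (m \<^bold>* \<tau>) = nabla_value
      (scal (q powi 2) \<^bold>* (x \<^bold>* f) \<^bold>+ m \<^bold>* F) (scal (q powi 2) \<^bold>* (y \<^bold>* f) \<^bold>+ m \<^bold>* H)
      (scal (q powi (- 2)) \<^bold>* (x \<^bold>* h) \<^bold>+ m \<^bold>* F') (scal (q powi (- 2)) \<^bold>* (y \<^bold>* h) \<^bold>+ m \<^bold>* H')"
    by (simp only: nabla_eq[OF dif_split_mult[OF assms(1) xy 1(2)]])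
  also have "\<dots> = two_tensor (x \<^bold>* f \<^bold>+ m \<^bold>* (scal (q powi (- 2)) \<^bold>* F)) (y \<^bold>* f \<^bold>+ m \<^bold>* (scal (q powi (- 2)) \<^bold>* H))
      (x \<^bold>* h \<^bold>+ m \<^bold>* (scal (q powi 2) \<^bold>* F')) (y \<^bold>* h \<^bold>+ m \<^bold>* (scal (q powi 2) \<^bold>* H'))"
    using cancel[of "x \<^bold>* f" F "- 2"] cancel[of "y \<^bold>* f" H "- 2"] cancel[of "x \<^bold>* h" F' 2] cancel[of "y \<^bold>* h" H' 2] * xy
    by (simp add: nabla_value_def)
  also have "\<dots> = two_tensor (x \<^bold>* f) (y \<^bold>* f) (x \<^bold>* h) (y \<^bold>* h) \<otimes>\<^bsub>T11 q\<^esub>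
      two_tensor (m \<^bold>* (scal (q powi (- 2)) \<^bold>* F)) (m \<^bold>* (scal (q powi (- 2)) \<^bold>* H))
        (m \<^bold>* (scal (q powi 2) \<^bold>* F')) (m \<^bold>* (scal (q powi 2) \<^bold>* H'))"
    using mem * assms(1) by (intro two_tensor_add) (auto simp: scal_left_commute[of m] coord_scal_mult)
  also have "two_tensor (x \<^bold>* f) (y \<^bold>* f) (x \<^bold>* h) (y \<^bold>* h) = tens11 q (dif q m) \<tau>"
    unfolding xy(3) 1(1) by (rule tens11_forms[OF xy(1,2) *(1,2), symmetric])
  also have "two_tensor (m \<^bold>* (scal (q powi (- 2)) \<^bold>* F)) (m \<^bold>* (scal (q powi (- 2)) \<^bold>* H))
      (m \<^bold>* (scal (q powi 2) \<^bold>* F')) (m \<^bold>* (scal (q powi 2) \<^bold>* H')) = lact q m (nabla q \<tau>)"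
    unfolding 1(3) nabla_value_def by (rule lact_two_tensor[symmetric]) (simp_all add: assms(1) * coord_scal_mult)
  finally show ?thesis .
qed

lemma covariant_derivative_nabla: "covariant_derivative q (nabla q)"
  unfolding covariant_derivative_def by (auto simp: nabla_closed nabla_add nabla_leibniz)

section \<open>Torsion, metric and cotorsion\<close>

text \<open>The e^0 terms cancel: [2; q^2] f e^0 \<and> e^- against f de^-, and [-2; q^2] h e^0
  \<and> e^+ against h de^+. The squares of e^- and e^+ vanish, and the mixed terms agree because
  the scalars of \<open>nabla_value\<close> undo those from multiplication.\<close>

lemma torsion_free:
  assumes "\<tau> \<in> sphere_forms q 1"
  shows "tensor_mult (Forms q) (nabla q \<tau>) = dif q \<tau>"
proof -
  obtain f h F H F' H' where 1: "\<tau> = f \<^bold>* e_minus q \<^bold>+ h \<^bold>* e_plus q" "dif_split f h F H F' H'"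
    "nabla q \<tau> = nabla_value F H F' H'"
    using assms by (rule sphere_forms_splitE)
  note * = dif_splitD[OF 1(2)]
  obtain f' h' where rep: "f = cls q f'" "h = cls q h'"
    using *(1,2) by (elim coordE) blast
  obtain F2 H2 F2' H2' where rep2: "F = cls q F2" "H = cls q H2" "F' = cls q F2'" "H' = cls q H2'"
    using *(3-6) by (elim coordE) blast
  have "dif q \<tau> = (dif q f \<^bold>* e_minus q \<^bold>+ f \<^bold>* dif q (e_minus q)) \<^bold>+ (dif q h \<^bold>* e_plus q \<^bold>+ h \<^bold>* dif q (e_plus q))"
    using *(1,2) by (simp add: 1(1) dif_add dif_coord_mult[OF *(1)] dif_coord_mult[OF *(2)])
  also have "\<dots> = tensor_mult (Forms q) (nabla_value F H F' H')"
    using *(1-6) unfolding *(7,8)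
    by (simp add: nabla_value_def tensor_mult_two_tensor coord_scal_mult)
      (simp add: rep rep2 dif_cls d_free_simps flip: cls_mult cls_add,
        intro cls_eqI, simp add: em_normal q q_bracket_values scalar_diff em_central[of q f'] em_central[of q h']
          em_central[of q F2] em_central[of q H2] em_central[of q F2'] em_central[of q H2'])
  finally show ?thesis
    by (simp add: 1(3))
qed

section \<open>The metric and the derivatives of the generators\<close>

lemma metric_summands:
  "metric_sum q = frag_of (scal (metric_coeff 0) \<^bold>* dif q (cls q (sphere_gen 0)), dif q (cls q (sphere_gen (dual 0))))
    + frag_of (scal (metric_coeff 1) \<^bold>* dif q (cls q (sphere_gen 1)), dif q (cls q (sphere_gen (dual 1))))
    + frag_of (scal (metric_coeff 2) \<^bold>* dif q (cls q (sphere_gen 2)), dif q (cls q (sphere_gen (dual 2))))"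
  by (simp add: metric_sum_def metric_coeff_def sphere_gen_def dual_def b_minus_def b_plus_def b_zero_def cls_one)

lemma dif_sphere_gen_forms: "i < 3 \<Longrightarrow> dif q (cls q (sphere_gen i)) \<in> sphere_forms q 1"
  unfolding sphere_forms_1 by (intro dif_sphere sphere_gen_sphere)

lemma metric_eq: "metric q = two_tensor \<zero>\<^bsub>Forms q\<^esub> \<one>\<^bsub>Forms q\<^esub> (scal (q\<^sup>2)) \<zero>\<^bsub>Forms q\<^esub>"
proof -
  let ?\<tau> = "\<lambda>i. scal (metric_coeff i) \<^bold>* dif q (cls q (sphere_gen i))"
  let ?\<eta> = "\<lambda>i. dif q (cls q (sphere_gen (dual i)))"
  let ?c = "\<lambda>k l i. cls q (scalar (metric_coeff i) * (dif_coeff k i * dif_coeff l (dual i)))"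
  have mem: "?\<tau> i \<in> sphere_forms q 1" "?\<eta> i \<in> sphere_forms q 1" if "i < 3" for i
    using dif_sphere_gen_forms[OF that] dif_sphere_gen_forms[OF dual_less[OF that]] coord_scal
    by (auto intro: sphere.left_action)
  have c: "?c k l i \<in> coord q (k + l)" if "k = 2 \<or> k = - 2" "l = 2 \<or> l = - 2" "i < 3" for k l i
    unfolding coord_eq
    by (intro imageI coord_rep_scalar_mult coord_rep_mult dif_coeff_rep that dual_less)
  have tens: "tens11 q (?\<tau> i) (?\<eta> i) = two_tensor (?c 2 2 i) (?c (- 2) 2 i) (?c 2 (- 2) i) (?c (- 2) (- 2) i)"
    if "i < 3" for i
  proof -
    have "?\<tau> i = cls q (scalar (metric_coeff i) * dif_coeff 2 i) \<^bold>* e_minus q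
        \<^bold>+ cls q (scalar (metric_coeff i) * dif_coeff (- 2) i) \<^bold>* e_plus q"
      by (simp add: dif_sphere_gen[OF that] r_distr m_assoc cls_mult)
    moreover have "cls q (scalar (metric_coeff i) * dif_coeff k i) \<in> coord q k"
      "cls q (dif_coeff k (dual i)) \<in> coord q k" if "k = 2 \<or> k = - 2" for k
      using that \<open>i < 3\<close> by (auto simp: coord_eq intro!: coord_rep_scalar_mult dif_coeff_rep dual_less)
    ultimately have "tens11 q (?\<tau> i) (?\<eta> i) = two_tensor
        (cls q (scalar (metric_coeff i) * dif_coeff 2 i) \<^bold>* cls q (dif_coeff 2 (dual i)))
        (cls q (scalar (metric_coeff i) * dif_coeff (- 2) i) \<^bold>* cls q (dif_coeff 2 (dual i)))
        (cls q (scalar (metric_coeff i) * dif_coeff 2 i) \<^bold>* cls q (dif_coeff (- 2) (dual i)))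
        (cls q (scalar (metric_coeff i) * dif_coeff (- 2) i) \<^bold>* cls q (dif_coeff (- 2) (dual i)))"
      unfolding dif_sphere_gen[OF dual_less[OF that]] by (simp only: tens11_forms simp_thms)
    then show ?thesis
      by (simp only: cls_mult[symmetric] mult.assoc)
  qed
  have "metric q = (tens11 q (?\<tau> 0) (?\<eta> 0) \<otimes>\<^bsub>T11 q\<^esub> tens11 q (?\<tau> 1) (?\<eta> 1)) \<otimes>\<^bsub>T11 q\<^esub> tens11 q (?\<tau> 2) (?\<eta> 2)"
    unfolding metric_def metric_summands tens_def
    using mem[of 0] mem[of 1] mem[of 2]
    by (simp add: sphere.tensor_class_add keys_frag_of sphere.keys_frag_sum)
  also have "\<dots> = two_tensor (form_sum3 (?c 2 2)) (form_sum3 (?c (- 2) 2)) (form_sum3 (?c 2 (- 2))) (form_sum3 (?c (- 2) (- 2)))"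
    using c[of 2 2] c[of 2 "- 2"] c[of "- 2" 2] c[of "- 2" "- 2"]
    by (simp add: tens form_sum3_def two_tensor_add two_tensor_closed coord_add sphere.tensors.m_assoc)
  also have "\<dots> = two_tensor \<zero>\<^bsub>Forms q\<^esub> \<one>\<^bsub>Forms q\<^esub> (scal (q\<^sup>2)) \<zero>\<^bsub>Forms q\<^esub>"
    by (simp add: form_sum3_cls metric_identity) (simp add: metric_value_def cls_zero cls_one)
  finally show ?thesis .
qed

lemma metric_closed: "metric q \<in> carrier (T11 q)"
  unfolding metric_eq by (intro two_tensor_closed coord_zero coord_one coord_scal)

text \<open>The factors c_i in \<nabla> db_i = c_i g, in the order b_-, b_+, b_0.\<close>

definition nabla_coeff :: "nat \<Rightarrow> free_alg" where
  "nabla_coeff i = [scalar (q_two q) * word [GA, GB], scalar (q_two q) * word [GC, GD],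
    1 + scalar (q_two q) * word [GB, GC]] ! i"

lemma nabla_coeff_coord: "i < 3 \<Longrightarrow> cls q (nabla_coeff i) \<in> sphere q"
  unfolding less_3_cases coord_eq
  by (elim disjE; intro imageI; simp add: nabla_coeff_def)
    (auto intro!: coord_rep_scalar_mult coord_rep_word coord_rep_add coord_rep_word[of "[]", simplified]
      simp: coord_gens_def)

text \<open>The u_i are products of letters a and c, whose differentials contain only e^0 and e^+;
  the v_i are products of b and d, with only e^0 and e^-. This gives the two zeros. As an example,
  a^2 has e^+ coefficient q^2 b a + q a b = q^2 [2] a b.\<close>

lemma dif_split_sphere_gen:
  assumes "i < 3"
  shows "dif_split (cls q (dif_coeff 2 i)) (cls q (dif_coeff (- 2) i))
    \<zero>\<^bsub>Forms q\<^esub> (scal (q powi 2) \<^bold>* cls q (nabla_coeff i)) (cls q (nabla_coeff i)) \<zero>\<^bsub>Forms q\<^esub>"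
proof -
  have "dif q (cls q (dif_coeff 2 i)) = \<zero>\<^bsub>Forms q\<^esub> \<^bold>* e_minus q \<^bold>+ scal (q powi 2) \<^bold>* cls q (nabla_coeff i) \<^bold>* e_plus q
      \<^bold>+ scal (q_bracket q 2) \<^bold>* (cls q (dif_coeff 2 i) \<^bold>* e_zero q)"
    "dif q (cls q (dif_coeff (- 2) i)) = cls q (nabla_coeff i) \<^bold>* e_minus q \<^bold>+ \<zero>\<^bsub>Forms q\<^esub> \<^bold>* e_plus q
      \<^bold>+ scal (q_bracket q (- 2)) \<^bold>* (cls q (dif_coeff (- 2) i) \<^bold>* e_zero q)"
    using assms unfolding less_3_cases dif_cls cls_zero[symmetric]
    by (elim disjE; simp only: flip: cls_mult cls_add; intro cls_eqI;
        simp add: list_simps nabla_coeff_def d_free_der der_simps der_mult endo_simps parity_def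
          coord_gens_def q_bracket_values scalar_diff em_normal q)+
  then show ?thesis
    using assms dif_coeff_rep nabla_coeff_coord[OF assms]
    by (simp add: dif_split_def coord_zero coord_scal_mult) (simp add: coord_eq)
qed

lemma nabla_dif_sphere_gen:
  assumes "i < 3"
  shows "nabla q (dif q (cls q (sphere_gen i))) = lact q (cls q (nabla_coeff i)) (metric q)"
proof -
  have "nabla q (dif q (cls q (sphere_gen i)))
      = nabla_value \<zero>\<^bsub>Forms q\<^esub> (scal (q powi 2) \<^bold>* cls q (nabla_coeff i)) (cls q (nabla_coeff i)) \<zero>\<^bsub>Forms q\<^esub>"
    unfolding dif_sphere_gen[OF assms] by (rule nabla_eq[OF dif_split_sphere_gen[OF assms]])
  \<comment> \<open>The normalizations q^(-2) and q^2 lead to c_i and q^2 c_i, which is c_i times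
    the components of g.\<close>
  also have "\<dots> = two_tensor \<zero>\<^bsub>Forms q\<^esub> (cls q (nabla_coeff i)) (cls q (nabla_coeff i) \<^bold>* scal (q\<^sup>2)) \<zero>\<^bsub>Forms q\<^esub>"
    using scal_cancel[of "cls q (nabla_coeff i)" "- 2" 2] by (simp add: nabla_value_def scal_commute)
  also have "\<dots> = lact q (cls q (nabla_coeff i)) (metric q)"
    unfolding metric_eq
    using nabla_coeff_coord[OF assms] by (simp add: lact_two_tensor coord_zero coord_one coord_scal)
  finally show ?thesis .
qed

text \<open>The product is q^2 e^+ \<and> e^- + e^- \<and> e^+, zero by a wedge relation:
  multiplication contributes q^2 to the e^+ \<otimes> e^- term and q^(-2) to the other one.\<close>

lemma tensor_mult_metric: "tensor_mult (Forms q) (metric q) = \<zero>\<^bsub>Forms q\<^esub>"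
  unfolding metric_eq
  by (simp add: tensor_mult_two_tensor coord_zero coord_one coord_scal)
    (simp flip: cls_mult cls_add cls_zero, intro cls_eqI, simp add: em_normal q)

text \<open>Torsion-freeness identifies d (db_i) with the wedge of \<nabla> db_i = c_i g, and the
  wedge of g vanishes.\<close>

lemma dif_dif_sphere_gen:
  assumes "i < 3"
  shows "dif q (dif q (cls q (sphere_gen i))) = \<zero>\<^bsub>Forms q\<^esub>"
  using torsion_free[OF dif_sphere_gen_forms[OF assms]] nabla_dif_sphere_gen[OF assms]
    tensor_mult_lact[OF nabla_coeff_coord[OF assms] metric_closed]
  by (simp add: tensor_mult_metric)

text \<open>The homomorphism property adds the three terms correctly even if some of the three pairs
  coincide and the formal sum has fewer keys.\<close>

lemma free_lift_metric_sum:
  assumes "comm_group G"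
    and "\<And>i. i < 3 \<Longrightarrow> \<phi> (scal (metric_coeff i) \<^bold>* dif q (cls q (sphere_gen i)), dif q (cls q (sphere_gen (dual i)))) = f i"
    and "\<And>i. i < 3 \<Longrightarrow> f i \<in> carrier G"
  shows "free_lift G \<phi> (metric_sum q) = sum3 G f"
proof -
  interpret G: comm_group G by fact
  let ?p = "\<lambda>i. (scal (metric_coeff i) \<^bold>* dif q (cls q (sphere_gen i)), dif q (cls q (sphere_gen (dual i))))"
  let ?S = "{?p 0, ?p 1, ?p 2}"
  have \<phi>: "\<phi> (?p i) \<in> carrier G" if "i < 3" for i
    using assms(2,3)[OF that] by simp
  then have hom: "free_lift G \<phi> \<in> hom (free_Abelian_group ?S) G"
    using \<phi>[of 0] \<phi>[of 1] \<phi>[of 2] by (intro G.free_lift_hom) auto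
  have keys: "Poly_Mapping.keys (frag_of (?p 0) + frag_of (?p 1)) \<subseteq> ?S"
    by (rule sphere.keys_frag_sum) simp_all
  have "free_lift G \<phi> (frag_of (?p 0) + frag_of (?p 1) + frag_of (?p 2))
      = free_lift G \<phi> (frag_of (?p 0) + frag_of (?p 1)) \<otimes>\<^bsub>G\<^esub> free_lift G \<phi> (frag_of (?p 2))"
    using hom_mult[OF hom, of "frag_of (?p 0) + frag_of (?p 1)" "frag_of (?p 2)"] keys
    by (simp add: keys_frag_of)
  also have "free_lift G \<phi> (frag_of (?p 0) + frag_of (?p 1)) = free_lift G \<phi> (frag_of (?p 0)) \<otimes>\<^bsub>G\<^esub> free_lift G \<phi> (frag_of (?p 1))"
    using hom_mult[OF hom, of "frag_of (?p 0)" "frag_of (?p 1)"] by (simp add: keys_frag_of)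
  finally show ?thesis
    unfolding metric_summands sum3_def
    using assms(3)[of 0] assms(3)[of 1] assms(3)[of 2]
    by (simp add: G.free_lift_frag_of assms(2) G.m_assoc)
qed

lemma metric_summand_forms: "i < 3 \<Longrightarrow> scal z \<^bold>* dif q (cls q (sphere_gen i)) \<in> sphere_forms q 1"
  by (rule sphere.left_action[OF coord_scal dif_sphere_gen_forms])

lemma nabla_wedge_id_metric: "nabla_wedge_id q (metric_sum q) = \<one>\<^bsub>T21 q\<^esub>"
proof -
  have "nabla_wedge_id q (metric_sum q) = sum3 (T21 q) (\<lambda>i. \<one>\<^bsub>T21 q\<^esub>)"
    unfolding nabla_wedge_id_def
  proof (rule free_lift_metric_sum[OF sphere.comm_group_tensor])
    fix i :: nat assume i: "i < 3"
    have "tensor_mult (Forms q) (nabla q (scal (metric_coeff i) \<^bold>* dif q (cls q (sphere_gen i)))) = \<zero>\<^bsub>Forms q\<^esub>"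
      using torsion_free[OF metric_summand_forms[OF i]] dif_dif_sphere_gen[OF i]
      by (simp add: dif_scal_mult)
    then show "(case (scal (metric_coeff i) \<^bold>* dif q (cls q (sphere_gen i)), dif q (cls q (sphere_gen (dual i)))) of
        (\<tau>, \<eta>) \<Rightarrow> tens21 q (tensor_mult (Forms q) (nabla q \<tau>)) \<eta>) = \<one>\<^bsub>T21 q\<^esub>"
      using dif_sphere_gen_forms[OF dual_less[OF i]] by (simp add: sphere.tens_zero_left)
  qed simp
  then show ?thesis
    by (simp add: sum3_def)
qed

lemma wedge_left_zero: "t \<in> carrier (T11 q) \<Longrightarrow> wedge_left q \<zero>\<^bsub>Forms q\<^esub> t = \<one>\<^bsub>T21 q\<^esub>"
  using wedge_left_add[of "\<zero>\<^bsub>Forms q\<^esub>" "\<zero>\<^bsub>Forms q\<^esub>" t] hom_in_carrier[OF wedge_left_hom, of "\<zero>\<^bsub>Forms q\<^esub>" t]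
    sphere.M_closed(2)[of 1] by simp

lemma id_wedge_nabla_metric: "id_wedge_nabla q (metric_sum q) = \<one>\<^bsub>T21 q\<^esub>"
proof -
  let ?\<tau> = "\<lambda>i. scal (metric_coeff i) \<^bold>* dif q (cls q (sphere_gen i)) \<^bold>* cls q (nabla_coeff (dual i))"
  have mem: "?\<tau> i \<in> sphere_forms q 1" if "i < 3" for i
    by (rule sphere.right_action[OF metric_summand_forms[OF that] nabla_coeff_coord[OF dual_less[OF that]]])
  have "id_wedge_nabla q (metric_sum q) = sum3 (T21 q) (\<lambda>i. wedge_left q (?\<tau> i) (metric q))"
    unfolding id_wedge_nabla_def
  proof (rule free_lift_metric_sum[OF sphere.comm_group_tensor])
    fix i :: nat assume i: "i < 3"
    show "(case (scal (metric_coeff i) \<^bold>* dif q (cls q (sphere_gen i)), dif q (cls q (sphere_gen (dual i)))) of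
        (\<tau>, \<eta>) \<Rightarrow> wedge_left q \<tau> (nabla q \<eta>)) = wedge_left q (?\<tau> i) (metric q)"
      by (simp add: nabla_dif_sphere_gen[OF dual_less[OF i]]
          wedge_left_lact[OF metric_summand_forms[OF i] nabla_coeff_coord[OF dual_less[OF i]] metric_closed])
    show "wedge_left q (?\<tau> i) (metric q) \<in> carrier (T21 q)"
      by (rule hom_in_carrier[OF wedge_left_hom[OF mem[OF i]] metric_closed])
  qed
  also have "\<dots> = wedge_left q (form_sum3 ?\<tau>) (metric q)"
    using mem[of 0] mem[of 1] mem[of 2] metric_closed
    by (simp add: sum3_def form_sum3_def wedge_left_add sphere_forms_closed(2))
  \<comment> \<open>This is the form \<theta> of the overview. At q = 1 it is twice the differential
    of b_- b_+ - b_0 (1 + b_0), the equation of the sphere.\<close>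
  also have "form_sum3 ?\<tau> = cls q (\<Sum>i<3. scalar (metric_coeff i) * d_free q (sphere_gen i) * nabla_coeff (dual i))"
    by (simp add: dif_cls form_sum3_cls flip: cls_mult)
  also have "\<dots> = \<zero>\<^bsub>Forms q\<^esub>"
    unfolding cls_zero[symmetric]
    by (intro cls_eqI) (simp add: list_simps nabla_coeff_def d_free_der der_simps der_mult endo_simps parity_def
          coord_gens_def scalar_diff em_normal q)
  finally show ?thesis
    by (simp add: wedge_left_zero metric_closed)
qed

end

theorem theorem5p1:
  fixes q :: complex
  assumes "q \<noteq> 0"
  shows
    "covariant_derivative q (nabla q) \<and>
     nabla q (dif q (b_plus q)) =
       lact q (cls q (scalar (q_two q)) \<otimes>\<^bsub>Forms q\<^esub> b_plus q) (metric q) \<and>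
     nabla q (dif q (b_minus q)) =
       lact q (cls q (scalar (q_two q)) \<otimes>\<^bsub>Forms q\<^esub> b_minus q) (metric q) \<and>
     nabla q (dif q (b_zero q)) =
       lact q (\<one>\<^bsub>Forms q\<^esub> \<oplus>\<^bsub>Forms q\<^esub> cls q (scalar (q_two q)) \<otimes>\<^bsub>Forms q\<^esub> b_zero q) (metric q) \<and>
     (\<forall>\<tau> \<in> sphere_forms q 1.
        tensor_mult (Forms q) (nabla q \<tau>) \<ominus>\<^bsub>Forms q\<^esub> dif q \<tau> = \<zero>\<^bsub>Forms q\<^esub>) \<and>
     nabla_wedge_id q (metric_sum q) \<otimes>\<^bsub>T21 q\<^esub> inv\<^bsub>T21 q\<^esub> id_wedge_nabla q (metric_sum q)
       = \<one>\<^bsub>T21 q\<^esub>"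
proof -
  interpret quantum_sphere q
    by unfold_locales (rule assms)
  have "tensor_mult (Forms q) (nabla q \<tau>) \<ominus>\<^bsub>Forms q\<^esub> dif q \<tau> = \<zero>\<^bsub>Forms q\<^esub>" if "\<tau> \<in> sphere_forms q 1" for \<tau>
    using that by (simp add: torsion_free sphere_forms_closed(1) a_minus_def r_neg)
  then show ?thesis
    using nabla_dif_sphere_gen[of 0] nabla_dif_sphere_gen[of 1] nabla_dif_sphere_gen[of 2]
    by (simp add: covariant_derivative_nabla nabla_wedge_id_metric id_wedge_nabla_metric
        sphere_gen_def nabla_coeff_def b_plus_def b_minus_def b_zero_def cls_mult cls_add cls_one)
qed

end
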